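(* Let $\mathcal E\subset \mathbb{R}\mathrm{P}^8$ be the essential variety and let $L\sim\psi$ be the random linear space $L=\{E\in\mathbb{R}\mathrm{P}^8\mid \mathbf u_1^TE\mathbf v_1=\cdots=\mathbf u_5^TE\mathbf v_5=0\}$ with $\mathbf u_1,\mathbf v_1,\ldots,\mathbf u_5,\mathbf v_5\sim\mathrm{Unif}(\mathbb{R}\mathrm{P}^2)$ i.i.d. Then $$\mathop{\mathbb E}_{L\sim\psi}\#(\mathcal E\cap L)\geq 0.93.$$
   Context: For $\mathbf t\in\mathbb R^3$ let $[\mathbf t]_\times\in\mathbb R^{3\times 3}$ be the matrix with $[\mathbf t]_\times\mathbf x=\mathbf t\times\mathbf x$ (cross product) for all $\mathbf x\in\mathbb R^3$. For $R\in\mathrm{SO}(3)$ and $\mathbf t\in\mathbb R^3$ put $E(R,\mathbf t)=[\mathbf t]_\times R$, and let $\widehat{\mathcal E}=\{E(R,\mathbf t)\mid R\in\mathrm{SO}(3),\ \mathbf t\in\mathbb R^3\}\subset\mathbb R^{3\times 3}$. The essential variety $\mathcal E\subset \mathrm P(\mathbb R^{3\times 3})\cong\mathbb{R}\mathrm{P}^8$ is the image of $\widehat{\mathcal E}\setminus\{0\}$ under projectivization; elements of $\mathbb{R}\mathrm{P}^8$ are viewed as real $3\times 3$ matrices up to scaling. $\mathrm{Unif}(\mathbb{R}\mathrm{P}^2)$ is the law of $U\cdot\mathbf a_0$, where $\mathbf a_0\in\mathbb{R}\mathrm{P}^2$ is fixed and $U$ is distributed according to the normalized Haar measure on $\mathrm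 O(3)$. $\psi$ denotes the resulting distribution of $L$. $\#$ denotes the number of (real) points. *)

theory Defs
  imports "HOL-Probability.Probability"
begin

section \<open>Real projective space\<close>

definition proportional :: "'a::euclidean_space \<Rightarrow> 'a \<Rightarrow> bool" where
  "proportional x y \<longleftrightarrow> x \<noteq> 0 \<and> y \<noteq> 0 \<and> (\<exists>c::real. y = c *\<^sub>R x)"

lemma part_equivp_proportional: "part_equivp (proportional :: 'a::euclidean_space \<Rightarrow> 'a \<Rightarrow> bool)"
proof (rule part_equivpI)
  obtain b :: 'a where "b \<in> Basis"
    using nonempty_Basis by blast
  then have "proportional b b"
    unfolding proportional_def by (metis nonzero_Basis scaleR_one)
  then show "\<exists>x::'a. proportional x x" by blast
  show "symp (proportional :: 'a \<Rightarrow> 'a \<Rightarrow> bool)"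
  proof (rule sympI)
    fix x y :: 'a
    assume "proportional x y"
    then obtain c where "x \<noteq> 0" "y \<noteq> 0" and y: "y = c *\<^sub>R x"
      unfolding proportional_def by blast
    moreover from this have "x = inverse c *\<^sub>R y" by auto
    ultimately show "proportional y x"
      unfolding proportional_def by blast
  qed
  show "transp (proportional :: 'a \<Rightarrow> 'a \<Rightarrow> bool)"
    unfolding proportional_def by (rule transpI) (metis scaleR_scaleR)
qed

text \<open>The points of \<open>P('a)\<close> are the nonzero vectors up to scaling; only the values of
  \<open>abs_projective\<close> at nonzero vectors are meaningful.\<close>

quotient_type (overloaded) 'a projective = "'a::euclidean_space" / partial: proportional
  by (rule part_equivp_proportional)

text \<open>The quotient topology, so that \<open>borel\<close> is available on projective space.\<close>

instantiation projective :: (euclidean_space) topological_space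
begin

definition open_projective :: "'a projective set \<Rightarrow> bool" where
  "open_projective U \<longleftrightarrow> open {x::'a. x \<noteq> 0 \<and> abs_projective x \<in> U}"

instance
proof
  have "{x::'a. x \<noteq> 0 \<and> abs_projective x \<in> UNIV} = - {0}" by auto
  then show "open (UNIV :: 'a projective set)"
    unfolding open_projective_def by (metis open_Compl closed_singleton)
next
  fix S T :: "'a projective set"
  assume "open S" "open T"
  moreover have "{x::'a. x \<noteq> 0 \<and> abs_projective x \<in> S \<inter> T} =
      {x. x \<noteq> 0 \<and> abs_projective x \<in> S} \<inter> {x. x \<noteq> 0 \<and> abs_projective x \<in> T}" by auto
  ultimately show "open (S \<inter> T)"
    unfolding open_projective_def by (simp add: open_Int)
next
  fix K :: "'a projective set set"
  assume "\<forall>S\<in>K. open S"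
  moreover have "{x::'a. x \<noteq> 0 \<and> abs_projective x \<in> \<Union>K} =
      (\<Union>S\<in>K. {x. x \<noteq> 0 \<and> abs_projective x \<in> S})" by auto
  ultimately show "open (\<Union>K)"
    unfolding open_projective_def by (simp add: open_UN)
qed

end


section \<open>The essential variety\<close>

definition cross_matrix :: "real^3 \<Rightarrow> real^3^3" where
  "cross_matrix t = matrix (cross3 t)"

lemma cross_matrix_mult: "cross_matrix t *v x = cross3 t x"
proof -
  have "linear (cross3 t)"
    by (rule linearI) (simp_all add: cross_add_right cross_mult_right)
  then show ?thesis
    unfolding cross_matrix_def by (simp add: matrix_works)
qed

definition essential_cone :: "(real^3^3) set" where
  "essential_cone = {cross_matrix t ** R | t R. rotation_matrix R}"

definition essential_variety :: "(real^3^3) projective set" where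
  "essential_variety = abs_projective ` (essential_cone - {0})"


section \<open>The random linear space\<close>

lift_definition bilinear_vanishes ::
    "(real^3) projective \<Rightarrow> (real^3^3) projective \<Rightarrow> (real^3) projective \<Rightarrow> bool"
  is "\<lambda>u A v. u \<bullet> (A *v v) = 0"
  by (auto simp: proportional_def scaleR_matrix_vector_assoc[symmetric] matrix_vector_mult_scaleR)

definition linear_space ::
    "(nat \<Rightarrow> (real^3) projective) \<Rightarrow> (nat \<Rightarrow> (real^3) projective) \<Rightarrow> (real^3^3) projective set"
  where "linear_space u v = {A. \<forall>i\<in>{1..5}. bilinear_vanishes (u i) A (v i)}"

definition O3 :: "(real^3^3) set" where
  "O3 = {U. orthogonal_matrix U}"

text \<open>Left invariance determines the Haar probability measure; on the compact group \<open>O(3)\<close>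
  it implies right invariance.\<close>

definition normalized_haar_O3 :: "(real^3^3) measure \<Rightarrow> bool" where
  "normalized_haar_O3 \<mu> \<longleftrightarrow>
     prob_space \<mu> \<and> sets \<mu> = sets (restrict_space borel O3) \<and>
     (\<forall>Q\<in>O3. distr \<mu> \<mu> (\<lambda>U. Q ** U) = \<mu>)"

text \<open>On \<open>O(3)\<close> this does not depend on the chosen representative, see \<open>proj_action_abs\<close> below.\<close>

definition proj_action :: "real^3^3 \<Rightarrow> (real^3) projective \<Rightarrow> (real^3) projective" where
  "proj_action U a = abs_projective (U *v rep_projective a)"

lemma orthogonal_mult_eq_0:
  assumes "U \<in> O3"
  shows "U *v x = 0 \<longleftrightarrow> x = 0"
proof
  assume "U *v x = 0"
  then have "(transpose U ** U) *v x = 0"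
    by (simp add: matrix_vector_mul_assoc[symmetric])
  then show "x = 0"
    using assms by (simp add: O3_def orthogonal_matrix)
qed simp

lemma rep_projective_nonzero: "rep_projective a \<noteq> (0::'a::euclidean_space)"
  using Quotient3_rep_reflp[OF Quotient3_projective, of a] by (simp add: proportional_def)

lemma proj_action_abs:
  assumes "U \<in> O3" and "x \<noteq> 0"
  shows "proj_action U (abs_projective x) = abs_projective (U *v x)"
proof -
  have "proportional x x"
    using \<open>x \<noteq> 0\<close> unfolding proportional_def by (metis scaleR_one)
  then have "proportional (rep_projective (abs_projective x)) x"
    by (rule rep_abs_rsp_left[OF Quotient3_projective])
  then have "proportional (U *v rep_projective (abs_projective x)) (U *v x)"
    using orthogonal_mult_eq_0[OF assms(1)]
    unfolding proportional_def by (metis matrix_vector_mult_scaleR)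
  then show ?thesis
    unfolding proj_action_def using Quotient3_rel_abs[OF Quotient3_projective] by blast
qed

lemma proj_action_measurable:
  assumes "sets \<mu> = sets (restrict_space borel O3)"
  shows "(\<lambda>U. proj_action U a) \<in> measurable \<mu> borel"
proof -
  have "(\<lambda>U. proj_action U a) \<in> measurable (restrict_space borel O3) borel"
  proof (rule borel_measurableI)
    fix S :: "(real^3) projective set"
    assume "open S"
    then have "open {x. x \<noteq> 0 \<and> abs_projective x \<in> S}"
      by (simp add: open_projective_def)
    moreover have "continuous_on UNIV (\<lambda>U::real^3^3. U *v rep_projective a)"
      unfolding matrix_vector_mult_def by (intro continuous_intros)
    ultimately have "open ((\<lambda>U. U *v rep_projective a) -` {x. x \<noteq> 0 \<and> abs_projective x \<in> S})"
      by (rule open_vimage)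
    moreover have "(\<lambda>U. proj_action U a) -` S \<inter> O3 =
        O3 \<inter> (\<lambda>U. U *v rep_projective a) -` {x. x \<noteq> 0 \<and> abs_projective x \<in> S}"
      using orthogonal_mult_eq_0 rep_projective_nonzero
      by (auto simp: proj_action_def)
    ultimately show "(\<lambda>U. proj_action U a) -` S \<inter> space (restrict_space borel O3)
        \<in> sets (restrict_space borel O3)"
      by (auto simp: space_restrict_space sets_restrict_space intro!: imageI)
  qed
  then show ?thesis
    using assms measurable_cong_sets by blast
qed

definition unif_RP2 :: "(real^3^3) measure \<Rightarrow> (real^3) projective \<Rightarrow> (real^3) projective measure"
  where "unif_RP2 \<mu> a = distr \<mu> borel (\<lambda>U. proj_action U a)"

end

theory Submission
  imports Defs "HOL-Real_Asymp.Real_Asymp"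
begin

text \<open>
  Let \<open>p\<close> be the probability that the five equations have a solution in the image of a small box
  \<open>[-h, h]\<^sup>5\<close> under a chart \<open>\<xi> \<mapsto> left_frame \<xi> \<cdot> diag(1, 1, 0) \<cdot> right_frame \<xi>\<close> of the essential
  variety. The law of the data and the variety are invariant under \<open>O(3) \<times> O(3)\<close>, which acts
  transitively on the variety, so averaging over the group shows that \<open>p\<close> is at most the expected
  number of solutions times the invariant mass of the box. That mass is asymptotically at most
  \<open>(2h)\<^sup>5 / (8 \<pi>\<^sup>3)\<close>: rotating the box about the two kernel directions gives many disjoint copies, all
  with both kernels in small caps.

  For a lower bound of \<open>p\<close>, a polar angle of each \<open>\<^bold>u\<^sub>i\<close> yields a unit vector \<open>e\<^sub>i\<close> of the plane, and
  independent cotangents \<open>x\<^sub>i, y\<^sub>i\<close> describe the third coordinates of \<open>\<^bold>u\<^sub>i, \<^bold>v\<^sub>i\<close>; the one remaining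
  coordinate of \<open>\<^bold>v\<^sub>i\<close> is solved for as a function of \<open>\<xi>\<close>. The change of variables formula and Fatou's
  lemma give the limit \<open>\<pi>\<^sup>-\<^sup>5 E \<bar>det D\<bar>\<close> of \<open>p / (2h)\<^sup>5\<close> as a lower bound, where \<open>D\<close> has the rows
  \<open>(1, y\<^sub>i e\<^sub>i, x\<^sub>i e\<^sub>i)\<close>. So the expected count is at least \<open>8 / \<pi>\<^sup>2 \<cdot> E \<bar>det D\<bar>\<close>.

  Since \<open>det D\<close> is affine in each pair \<open>(x\<^sub>i, y\<^sub>i)\<close>, on every orthant the pairs may be replaced by their
  means, that is by signs. Whenever \<open>x\<^sub>i = y\<^sub>i\<close> for exactly two or three indices (20 patterns) the
  determinant splits into a \<open>2 \<times> 2\<close> and a \<open>3 \<times> 3\<close> block, whose means are elementary. The result is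
  \<open>E \<bar>det D\<bar> \<ge> 10 / \<pi>\<^sup>2 \<cdot> (1 + 4 / (5 \<pi>))\<close>.
\<close>

section \<open>Means of cosines and cotangents\<close>

text \<open>The count enters through one inequality: for fixed data it dominates, up to the mass of
  the box, the group average of a measurable indicator. All later estimates go the same way, so a
  change of variables in R^5 replaces integration over the variety. The obstacle is the mean of |det
  D|, and the coordinates are chosen to make a crude bound for it good enough. The cotangent of the
  angle to the third axis has mean exactly 1 or -1 on each half line, so Jensen's inequality on
  orthants yields signs. The chart density of the right point is split so that \<open>y\<close> gets
  this law too and the remaining weight at the chart centre is 1 / pi for all \<open>y\<close>; five
  pairs give pi^-5, and 8 pi^3 * pi^-5 = 8 / pi^2. Right points are described in a frame turned with
  the slope of their left partners, which is legitimate because a uniform direction is invariant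
  under rotations. In the block means, sqrt (1 + t) >= 1 + 2 t / 5 on [0, 1] is the source of the
  term 4 / (5 pi). The final value is about 1.03, which leaves room for a crude estimate of
  pi.\<close>

lemma nn_integral_split_reflect:
  fixes f :: "real \<Rightarrow> ennreal" and c :: real
  assumes [measurable]: "f \<in> borel_measurable borel"
  shows "(\<integral>\<^sup>+x. f x \<partial>lborel) =
    (\<integral>\<^sup>+x. f x * indicator {c..} x \<partial>lborel) + (\<integral>\<^sup>+x. f (- x) * indicator {-c..} x \<partial>lborel)"
proof -
  have "(\<integral>\<^sup>+x. f x \<partial>lborel) =
    (\<integral>\<^sup>+x. f x * indicator {c..} x + f x * indicator {..c} x \<partial>lborel)"
    by (rule nn_integral_cong_AE, rule AE_mp[OF AE_lborel_singleton[of c]], rule AE_I2)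
      (auto split: split_indicator)
  also have "\<dots> = (\<integral>\<^sup>+x. f x * indicator {c..} x \<partial>lborel) + (\<integral>\<^sup>+x. f x * indicator {..c} x \<partial>lborel)"
    by (rule nn_integral_add) auto
  also have "(\<integral>\<^sup>+x. f x * indicator {..c} x \<partial>lborel) = (\<integral>\<^sup>+x. f (- x) * indicator {-c..} x \<partial>lborel)"
  proof -
    have "(\<integral>\<^sup>+x. f x * indicator {..c} x \<partial>lborel) =
      (\<integral>\<^sup>+x. f (- x) * indicator {..c} (- x) \<partial>lborel)"
      by (subst nn_integral_real_affine[where c = "-1" and t = 0]) simp_all
    also have "\<dots> = (\<integral>\<^sup>+x. f (- x) * indicator {-c..} x \<partial>lborel)"
      by (rule nn_integral_cong) (auto split: split_indicator)
    finally show ?thesis .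
  qed
  finally show ?thesis .
qed

lemma sqrt_1_square_pos [simp]: "0 < sqrt (1 + x\<^sup>2)" for x :: real
  by (simp add: add_pos_nonneg)

lemma one_plus_square_nonzero [simp]: "1 + x\<^sup>2 \<noteq> 0" for x :: real
  by (rule less_imp_neq[symmetric]) (simp add: add_pos_nonneg)

lemma one_plus_square_pos [simp]: "0 < 1 + x\<^sup>2" for x :: real
  by (simp add: add_pos_nonneg)

text \<open>Under q = tan theta the function is a sin theta - b cos theta, and (a + b q) / sqrt (1 +
  q^2)^3 dq becomes (a cos theta + b sin theta) d theta.\<close>

lemma DERIV_rotated_cosine:
  "((\<lambda>q. (a * q - b) / sqrt (1 + q\<^sup>2)) has_real_derivative (a + b * q) / sqrt (1 + q\<^sup>2) ^ 3) (at q)"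
proof -
  define s where "s = sqrt (1 + q\<^sup>2)"
  have s: "s \<noteq> 0" "s * s = 1 + q\<^sup>2" unfolding s_def by (simp_all add: add_nonneg_nonneg)
  have "((\<lambda>q. sqrt (1 + q\<^sup>2)) has_real_derivative q / s) (at q)"
  proof -
    have "((\<lambda>q. 1 + q\<^sup>2) has_real_derivative 2 * q) (at q)"
      by (auto intro!: derivative_eq_intros)
    from DERIV_chain2[OF DERIV_real_sqrt[OF one_plus_square_pos] this]
    show ?thesis by (simp add: s_def field_simps)
  qed
  moreover have "((\<lambda>q. a * q - b) has_real_derivative a) (at q)"
    by (auto intro!: derivative_eq_intros)
  ultimately have "((\<lambda>q. (a * q - b) / sqrt (1 + q\<^sup>2)) has_real_derivative
      (a * s - (a * q - b) * (q / s)) / (s * s)) (at q)"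
    using s(1) unfolding s_def by (intro DERIV_divide)
  also have "(a * s - (a * q - b) * (q / s)) / (s * s) = (a * (s * s) - (a * q - b) * q) / s ^ 3"
    using s(1) by (simp add: field_simps power3_eq_cube)
  also have "a * (s * s) - (a * q - b) * q = a + b * q"
    by (simp add: s(2) algebra_simps power2_eq_square)
  finally show ?thesis by (simp add: s_def)
qed

lemma tendsto_rotated_cosine: "((\<lambda>q. (a * q - b) / sqrt (1 + q\<^sup>2)) \<longlongrightarrow> a) at_top"
proof -
  have "((\<lambda>q::real. q / sqrt (1 + q\<^sup>2)) \<longlongrightarrow> 1) at_top" "((\<lambda>q::real. 1 / sqrt (1 + q\<^sup>2)) \<longlongrightarrow> 0) at_top"
    by real_asymp+
  then have "((\<lambda>q. a * (q / sqrt (1 + q\<^sup>2)) - b * (1 / sqrt (1 + q\<^sup>2))) \<longlongrightarrow> a * 1 - b * 0) at_top"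
    by (intro tendsto_intros)
  then show ?thesis by (simp add: diff_divide_distrib)
qed

lemma nn_integral_cosine_atLeast:
  assumes "\<And>q. c \<le> q \<Longrightarrow> 0 \<le> a + b * q"
  shows "(\<integral>\<^sup>+q. ennreal ((a + b * q) / sqrt (1 + q\<^sup>2) ^ 3) * indicator {c..} q \<partial>lborel)
    = ennreal (a - (a * c - b) / sqrt (1 + c\<^sup>2))"
  by (rule nn_integral_FTC_atLeast[OF _ DERIV_rotated_cosine _ tendsto_rotated_cosine])
    (use assms in auto)

text \<open>In the angle theta this is the integral of r |cos| over half a period, with r = sqrt
  (a^2 + b^2), which is 2 r. For b > 0 the sign changes at q = -a/b, so the line is cut there and
  its left part reflected; b < 0 follows by negating both coefficients.\<close>

lemma nn_integral_abs_cosine: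
  "(\<integral>\<^sup>+q. ennreal (\<bar>a + b * q\<bar> / sqrt (1 + q\<^sup>2) ^ 3) \<partial>lborel) = ennreal (2 * sqrt (a\<^sup>2 + b\<^sup>2))"
proof -
  have pos: "(\<integral>\<^sup>+q. ennreal (\<bar>a + b * q\<bar> / sqrt (1 + q\<^sup>2) ^ 3) \<partial>lborel) = ennreal (2 * sqrt (a\<^sup>2 + b\<^sup>2))"
    if "b > 0" for a b :: real
  proof -
    have b: "sqrt (1 + (a/b)\<^sup>2) = sqrt (a\<^sup>2 + b\<^sup>2) / b"
    proof -
      have "1 + (a/b)\<^sup>2 = (a\<^sup>2 + b\<^sup>2) / b\<^sup>2" using that by (simp add: field_simps)
      then show ?thesis using that by (simp add: real_sqrt_divide)
    qed
    have sp: "sqrt (a\<^sup>2 + b\<^sup>2) > 0" using that by (simp add: add_nonneg_pos)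
    have sq: "sqrt (a\<^sup>2 + b\<^sup>2) * sqrt (a\<^sup>2 + b\<^sup>2) = a\<^sup>2 + b\<^sup>2" by simp
    have 2: "((-a) * (a/b) - b) / sqrt (1 + (a/b)\<^sup>2) = - sqrt (a\<^sup>2 + b\<^sup>2)"
    proof -
      define w where "w = sqrt (a\<^sup>2 + b\<^sup>2)"
      have w: "w \<noteq> 0" "w * w = a\<^sup>2 + b\<^sup>2" using sp sq by (auto simp: w_def)
      have "(-a) * (a/b) - b = - (w * w) / b"
        unfolding w(2) using that by (simp add: divide_simps power2_eq_square)
      then show ?thesis using w(1) that unfolding b by (simp flip: w_def)
    qed
    then have 1: "(a * (-a/b) - b) / sqrt (1 + (-a/b)\<^sup>2) = - sqrt (a\<^sup>2 + b\<^sup>2)"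
      by simp
    have p1: "0 \<le> a + b * q" if "-a/b \<le> q" for q
      using that \<open>b > 0\<close> by (simp add: field_simps)
    have p2: "0 \<le> - a + b * q" if "a/b \<le> q" for q
      using that \<open>b > 0\<close> by (simp add: field_simps)
    have "(\<integral>\<^sup>+q. ennreal (\<bar>a + b * q\<bar> / sqrt (1 + q\<^sup>2) ^ 3) \<partial>lborel) =
      (\<integral>\<^sup>+q. ennreal (\<bar>a + b * q\<bar> / sqrt (1 + q\<^sup>2) ^ 3) * indicator {-a/b..} q \<partial>lborel) +
      (\<integral>\<^sup>+q. ennreal (\<bar>a + b * (- q)\<bar> / sqrt (1 + (- q)\<^sup>2) ^ 3) * indicator {-(-a/b)..} q \<partial>lborel)"
      by (rule nn_integral_split_reflect) measurable
    also have "(\<integral>\<^sup>+q. ennreal (\<bar>a + b * q\<bar> / sqrt (1 + q\<^sup>2) ^ 3) * indicator {-a/b..} q \<partial>lborel) =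
      (\<integral>\<^sup>+q. ennreal ((a + b * q) / sqrt (1 + q\<^sup>2) ^ 3) * indicator {-a/b..} q \<partial>lborel)"
      using that by (intro nn_integral_cong) (auto split: split_indicator simp: field_simps)
    also have "\<dots> = ennreal (a + sqrt (a\<^sup>2 + b\<^sup>2))"
      by (subst nn_integral_cosine_atLeast[OF p1]) (simp_all only: 1 diff_minus_eq_add)
    also have "(\<integral>\<^sup>+q. ennreal (\<bar>a + b * (- q)\<bar> / sqrt (1 + (- q)\<^sup>2) ^ 3) * indicator {-(-a/b)..} q \<partial>lborel) =
      (\<integral>\<^sup>+q. ennreal ((- a + b * q) / sqrt (1 + q\<^sup>2) ^ 3) * indicator {a/b..} q \<partial>lborel)"
      using that by (intro nn_integral_cong) (auto split: split_indicator simp: field_simps)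
    also have "\<dots> = ennreal (- a + sqrt (a\<^sup>2 + b\<^sup>2))"
      by (subst nn_integral_cosine_atLeast[OF p2]) (simp_all only: 2 diff_minus_eq_add)
    also have "ennreal (a + sqrt (a\<^sup>2 + b\<^sup>2)) + ennreal (- a + sqrt (a\<^sup>2 + b\<^sup>2)) = ennreal (2 * sqrt (a\<^sup>2 + b\<^sup>2))"
    proof -
      have "\<bar>a\<bar> \<le> sqrt (a\<^sup>2 + b\<^sup>2)" by (rule real_le_rsqrt) simp
      then have "0 \<le> a + sqrt (a\<^sup>2 + b\<^sup>2)" "0 \<le> - a + sqrt (a\<^sup>2 + b\<^sup>2)" by linarith+
      then show ?thesis by (simp flip: ennreal_plus)
    qed
    finally show ?thesis .
  qed
  consider "b > 0" | "b < 0" | "b = 0" by linarith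
  then show ?thesis
  proof cases
    case 2
    then have "(\<integral>\<^sup>+q. ennreal (\<bar>- a + (- b) * q\<bar> / sqrt (1 + q\<^sup>2) ^ 3) \<partial>lborel) = ennreal (2 * sqrt ((- a)\<^sup>2 + (- b)\<^sup>2))"
      by (intro pos) simp
    moreover have "\<bar>- a + (- b) * q\<bar> = \<bar>a + b * q\<bar>" for q by (simp add: abs_if)
    ultimately show ?thesis by simp
  next
    case 3
    have "(\<integral>\<^sup>+q. ennreal (\<bar>a\<bar> / sqrt (1 + q\<^sup>2) ^ 3) \<partial>lborel) =
      (\<integral>\<^sup>+q. ennreal (\<bar>a\<bar> / sqrt (1 + q\<^sup>2) ^ 3) * indicator {0..} q \<partial>lborel) +
      (\<integral>\<^sup>+q. ennreal (\<bar>a\<bar> / sqrt (1 + (- q)\<^sup>2) ^ 3) * indicator {-0..} q \<partial>lborel)"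
      by (rule nn_integral_split_reflect) measurable
    also have "\<dots> = ennreal \<bar>a\<bar> + ennreal \<bar>a\<bar>"
      using nn_integral_cosine_atLeast[of 0 "\<bar>a\<bar>" 0] by simp
    also have "\<dots> = ennreal (2 * sqrt (a\<^sup>2 + b\<^sup>2))"
      using 3 by (subst ennreal_plus[symmetric]) auto
    finally show ?thesis using 3 by simp
  qed (rule pos)
qed

lemma nn_integral_cauchy: "(\<integral>\<^sup>+q. ennreal (1 / (pi * (1 + q\<^sup>2))) \<partial>lborel) = 1"
proof -
  have *: "(\<integral>\<^sup>+q. ennreal (1 / (pi * (1 + q\<^sup>2))) * indicator {0..} q \<partial>lborel) = ennreal (1/2 - arctan 0 / pi)"
  proof (rule nn_integral_FTC_atLeast)
    show "((\<lambda>x. arctan x / pi) \<longlongrightarrow> 1 / 2) at_top"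
      using tendsto_divide[OF tendsto_arctan_at_top tendsto_const[of pi]] by simp
    show "((\<lambda>x. arctan x / pi) has_real_derivative 1 / (pi * (1 + x\<^sup>2))) (at x)" for x
      using DERIV_cdivide[OF DERIV_arctan[of x], of pi] by (simp add: field_simps)
  qed auto
  show ?thesis
    apply (subst nn_integral_split_reflect[where c = 0])
     apply measurable
    using * by (simp add: ennreal_plus[symmetric] del: ennreal_plus ennreal_half)
qed

text \<open>The law of the tangent of a uniform angle, that is, of the slope of a uniform line
  through the origin of the plane.\<close>

definition cauchy :: "real measure" where
  "cauchy = density lborel (\<lambda>q. ennreal (1 / (pi * (1 + q\<^sup>2))))"

text \<open>The height z of a uniform point of the sphere is uniform on [-1, 1] (Archimedes); this
  is the density of z / sqrt (1 - z^2), the cotangent of the angle to the third axis.\<close>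

definition cot_density :: "real \<Rightarrow> real" where
  "cot_density x = 1 / (2 * sqrt (1 + x\<^sup>2) ^ 3)"

definition cot_measure :: "real measure" where
  "cot_measure = density lborel (\<lambda>x. ennreal (cot_density x))"

lemma cot_density_measurable [measurable]: "cot_density \<in> borel_measurable borel"
  unfolding cot_density_def by measurable

lemma cot_density_nonneg [simp]: "0 \<le> cot_density x"
  by (simp add: cot_density_def)

lemma sets_cauchy [simp, measurable_cong]: "sets cauchy = sets borel"
  and space_cauchy [simp]: "space cauchy = UNIV"
  by (auto simp: cauchy_def)

lemma sets_cot_measure [simp, measurable_cong]: "sets cot_measure = sets borel"
  and space_cot_measure [simp]: "space cot_measure = UNIV"
  by (auto simp: cot_measure_def)

lemma borel_measurable_cauchy [simp]: "borel_measurable cauchy = borel_measurable borel"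
  by (rule measurable_cong_sets) simp_all

lemma prob_space_cauchy: "prob_space cauchy"
  by rule (simp add: cauchy_def emeasure_density nn_integral_cauchy)

lemma nn_integral_cot_density_atLeast:
  "(\<integral>\<^sup>+x. ennreal (cot_density x) * indicator {0..} x \<partial>lborel) = ennreal (1/2)"
  "(\<integral>\<^sup>+x. ennreal (x * cot_density x) * indicator {0..} x \<partial>lborel) = ennreal (1/2)"
proof -
  have 1: "cot_density x = (1/2 + 0 * x) / sqrt (1 + x\<^sup>2) ^ 3"
    and 2: "x * cot_density x = (0 + 1/2 * x) / sqrt (1 + x\<^sup>2) ^ 3" for x
    by (simp_all add: cot_density_def)
  show "(\<integral>\<^sup>+x. ennreal (cot_density x) * indicator {0..} x \<partial>lborel) = ennreal (1/2)"
    unfolding 1 by (subst nn_integral_cosine_atLeast) auto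
  show "(\<integral>\<^sup>+x. ennreal (x * cot_density x) * indicator {0..} x \<partial>lborel) = ennreal (1/2)"
    unfolding 2 by (subst nn_integral_cosine_atLeast) auto
qed

lemma prob_space_cot_measure: "prob_space cot_measure"
proof
  have "(\<integral>\<^sup>+x. ennreal (cot_density x) \<partial>lborel) = 1"
    apply (subst nn_integral_split_reflect[where c = 0])
     apply measurable
    using nn_integral_cot_density_atLeast(1)
    by (simp add: cot_density_def ennreal_plus[symmetric] del: ennreal_plus ennreal_half)
  then show "emeasure cot_measure (space cot_measure) = 1"
    by (simp add: cot_measure_def emeasure_density)
qed

text \<open>Mass 1/2 and first moment 1/2 in absolute value: the conditional mean on either half
  line is exactly 1 or -1. This is what turns cotangents into signs in the bound for the
  determinant.\<close>

lemma integral_cot_half_lines: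
  fixes \<sigma> :: bool
  defines "I \<equiv> (if \<sigma> then {0<..} else {..<0::real})"
  shows "integrable cot_measure (indicator I :: real \<Rightarrow> real)"
    and "integrable cot_measure (\<lambda>x. indicator I x * x)"
    and "(LINT x|cot_measure. indicator I x :: real) = 1/2"
    and "(LINT x|cot_measure. indicator I x * x) = (if \<sigma> then 1/2 else -1/2)"
proof -
  have A: "has_bochner_integral lborel (\<lambda>x. indicator {0<..} x * cot_density x) (1/2)"
  proof (rule has_bochner_integral_nn_integral)
    show "(\<integral>\<^sup>+x. ennreal (indicator {0<..} x * cot_density x) \<partial>lborel) = ennreal (1/2)"
      unfolding nn_integral_cot_density_atLeast(1)[symmetric]
      by (rule nn_integral_cong_AE, rule AE_mp[OF AE_lborel_singleton[of 0]], rule AE_I2)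
        (auto split: split_indicator)
  qed auto
  have B: "has_bochner_integral lborel (\<lambda>x. indicator {0<..} x * (x * cot_density x)) (1/2)"
  proof (rule has_bochner_integral_nn_integral)
    show "(\<integral>\<^sup>+x. ennreal (indicator {0<..} x * (x * cot_density x)) \<partial>lborel) = ennreal (1/2)"
      unfolding nn_integral_cot_density_atLeast(2)[symmetric]
      by (rule nn_integral_cong_AE, rule AE_mp[OF AE_lborel_singleton[of 0]], rule AE_I2)
        (auto split: split_indicator)
  qed (auto split: split_indicator)
  have ev: "cot_density (- x) = cot_density x" for x by (simp add: cot_density_def)
  have i: "indicator {0<..} (- x) = (indicator {..<0} x :: real)" for x :: real
    by (auto split: split_indicator)
  have A': "has_bochner_integral lborel (\<lambda>x. indicator {..<0} x * cot_density x) (1/2)"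
    using lborel_has_bochner_integral_real_affine_iff[of "-1" _ "1/2::real" 0, THEN iffD1, OF _ A]
    by (simp add: ev i)
  have B': "has_bochner_integral lborel (\<lambda>x. indicator {..<0} x * (x * cot_density x)) (-1/2)"
    using has_bochner_integral_minus[OF lborel_has_bochner_integral_real_affine_iff[of "-1" _ "1/2::real" 0, THEN iffD1, OF _ B]]
    by (simp add: ev i)
  have "has_bochner_integral cot_measure (indicator I :: real \<Rightarrow> real) (1/2)"
    unfolding cot_measure_def
    by (rule has_bochner_integral_density) (use A A' in \<open>auto simp: I_def mult_ac\<close>)
  then show "integrable cot_measure (indicator I :: real \<Rightarrow> real)"
    and "(LINT x|cot_measure. indicator I x :: real) = 1/2"
    unfolding has_bochner_integral_iff by blast+
  have "has_bochner_integral cot_measure (\<lambda>x. indicator I x * x) (if \<sigma> then 1/2 else -1/2)"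
    unfolding cot_measure_def
    by (rule has_bochner_integral_density) (use B B' in \<open>auto simp: I_def mult_ac\<close>)
  then show "integrable cot_measure (\<lambda>x. indicator I x * x)"
    and "(LINT x|cot_measure. indicator I x * x) = (if \<sigma> then 1/2 else -1/2)"
    unfolding has_bochner_integral_iff by blast+
qed

lemma nn_integral_cauchy_abs:
  "(\<integral>\<^sup>+q. ennreal (\<bar>a + b * q\<bar> / sqrt (1 + q\<^sup>2)) \<partial>cauchy) = ennreal (2 / pi * sqrt (a\<^sup>2 + b\<^sup>2))"
proof -
  have "(\<integral>\<^sup>+q. ennreal (\<bar>a + b * q\<bar> / sqrt (1 + q\<^sup>2)) \<partial>cauchy) =
    (\<integral>\<^sup>+q. ennreal (1 / pi) * ennreal (\<bar>a + b * q\<bar> / sqrt (1 + q\<^sup>2) ^ 3) \<partial>lborel)"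
    unfolding cauchy_def
    by (subst nn_integral_density)
      (auto intro!: nn_integral_cong simp: power3_eq_cube power2_eq_square
        simp flip: ennreal_mult real_sqrt_mult)
  also have "\<dots> = ennreal (1 / pi) * ennreal (2 * sqrt (a\<^sup>2 + b\<^sup>2))"
    by (subst nn_integral_cmult) (auto simp: nn_integral_abs_cosine)
  finally show ?thesis by (simp flip: ennreal_mult)
qed

section \<open>A lower bound for the mean Jacobian\<close>

lemma exhaust_5:
  fixes x :: 5
  shows "x = 1 \<or> x = 2 \<or> x = 3 \<or> x = 4 \<or> x = 5"
proof (induct x)
  case (of_int z)
  then have "z = 0 \<or> z = 1 \<or> z = 2 \<or> z = 3 \<or> z = 4" by fastforce
  then show ?case by auto
qed

lemma UNIV_5: "UNIV = {1, 2, 3, 4, 5::5}"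
  using exhaust_5 by auto

text \<open>Subtracting \<open>c\<close> times columns 2 and 3 from columns 4 and 5 clears rows 1 to
  3 and leaves \<open>- 2 * c * a i\<close> and \<open>- 2 * c * b i\<close> in rows 4 and 5, so the
  determinant is a 3 x 3 block times a 2 x 2 block. The proof expands over all permutations instead
  and ends with a polynomial identity modulo \<open>c * c = 1\<close>.\<close>

lemma det_two_blocks:
  fixes A :: "real^5^5" and a b :: "5 \<Rightarrow> real" and c :: real
  assumes "c * c = 1" "\<And>i. A $ i $ 1 = 1" "\<And>i. A $ i $ 2 = a i" "\<And>i. A $ i $ 3 = b i"
    and "\<And>i. A $ i $ 4 = c * (if i \<in> {1,2,3} then a i else - a i)"
    and "\<And>i. A $ i $ 5 = c * (if i \<in> {1,2,3} then b i else - b i)"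
  shows "det A = 4 * (a 4 * b 5 - a 5 * b 4) *
    ((a 2 * b 3 - a 3 * b 2) + (a 3 * b 1 - a 1 * b 3) + (a 1 * b 2 - a 2 * b 1))"
proof -
  have f: "finite {2::5,3,4,5}" "1 \<notin> {2::5,3,4,5}" "finite {3::5,4,5}" "2 \<notin> {3::5,4,5}"
    "finite {4::5,5}" "3 \<notin> {4::5,5}" "finite {5::5}" "4 \<notin> {5::5}"
    by auto
  show ?thesis
    unfolding det_def UNIV_5
    unfolding sum_over_permutations_insert[OF f(1,2)]
    unfolding sum_over_permutations_insert[OF f(3,4)]
    unfolding sum_over_permutations_insert[OF f(5,6)]
    unfolding sum_over_permutations_insert[OF f(7,8)]
    unfolding permutes_sing
    apply (simp add: sign_swap_id permutation_swap_id sign_compose swap_id_eq permutation_compose assms(2-))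
    using assms(1) by algebra
qed

text \<open>Every term of the Leibniz sum takes one entry from each row, so independence of the rows
  makes its mean the product of the means.\<close>

lemma integral_det_independent_rows:
  fixes M :: "'n::finite \<Rightarrow> 'a measure" and g :: "'n \<Rightarrow> 'n \<Rightarrow> 'a \<Rightarrow> real"
  assumes "\<And>i. prob_space (M i)" and "\<And>i j. integrable (M i) (g i j)"
  shows "integrable (Pi\<^sub>M UNIV M) (\<lambda>\<omega>. det (\<chi> i j. g i j (\<omega> i)))"
    and "(LINT \<omega>|Pi\<^sub>M UNIV M. det (\<chi> i j. g i j (\<omega> i))) = det (\<chi> i j. LINT x|M i. g i j x)"
proof -
  interpret prob_space "M i" for i by (rule assms)
  interpret product_sigma_finite M by standard
  have *: "integrable (Pi\<^sub>M UNIV M) (\<lambda>\<omega>. of_int (sign p) * (\<Prod>i\<in>UNIV. g i (p i) (\<omega> i)))" for p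
    by (intro integrable_mult_right product_integrable_prod) (auto intro: assms)
  show "integrable (Pi\<^sub>M UNIV M) (\<lambda>\<omega>. det (\<chi> i j. g i j (\<omega> i)))"
    unfolding det_def using * by (simp add: Bochner_Integration.integrable_sum)
  show "(LINT \<omega>|Pi\<^sub>M UNIV M. det (\<chi> i j. g i j (\<omega> i))) = det (\<chi> i j. LINT x|M i. g i j x)"
  proof -
    have "(LINT \<omega>|Pi\<^sub>M UNIV M. (\<Prod>i\<in>UNIV. g i (p i) (\<omega> i))) = (\<Prod>i\<in>UNIV. LINT x|M i. g i (p i) x)" for p
      by (rule product_integral_prod) (auto intro: assms)
    then show ?thesis
      unfolding det_def using * by (simp add: Bochner_Integration.integral_sum)
  qed
qed

lemma integral_pair_mult:
  fixes f :: "'a \<Rightarrow> real" and g :: "'b \<Rightarrow> real"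
  assumes "prob_space M" "prob_space N" and [simp]: "integrable M f" "integrable N g"
  shows "integrable (M \<Otimes>\<^sub>M N) (\<lambda>p. f (fst p) * g (snd p))"
    and "(LINT p|(M \<Otimes>\<^sub>M N). f (fst p) * g (snd p)) = (LINT x|M. f x) * (LINT y|N. g y)"
proof -
  interpret M: prob_space M by fact
  interpret N: prob_space N by fact
  interpret pair_sigma_finite M N by standard
  have [measurable]: "f \<in> borel_measurable M" "g \<in> borel_measurable N"
    using assms(3,4) by (auto intro: borel_measurable_integrable)
  have "integrable (M \<Otimes>\<^sub>M N) (\<lambda>(x, y). f x * g y)"
    by (rule Fubini_integrable) (auto simp: abs_mult)
  then show *: "integrable (M \<Otimes>\<^sub>M N) (\<lambda>p. f (fst p) * g (snd p))"
    by (simp add: case_prod_beta')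
  show "(LINT p|(M \<Otimes>\<^sub>M N). f (fst p) * g (snd p)) = (LINT x|M. f x) * (LINT y|N. g y)"
    using integral_fst'[OF *] by simp
qed

definition sg :: "bool \<Rightarrow> real" where "sg b = (if b then 1 else - 1)"

definition half_line :: "bool \<Rightarrow> real set" where
  "half_line b = (if b then {0<..} else {..<0})"

lemma mem_half_line: "x \<in> half_line b \<longleftrightarrow> x \<noteq> 0 \<and> (b \<longleftrightarrow> 0 < x)"
  by (auto simp: half_line_def)

text \<open>Up to sign, the gradient at the chart centre of one of the five equations (see
  \<open>gradient_bilinear_chart\<close>): \<open>(a, b)\<close> is the direction of the left vector
  in the plane, \<open>x\<close> and \<open>y\<close> are the third coordinates of the left and the
  right vector.\<close>

definition jacobian_row :: "real \<Rightarrow> real \<Rightarrow> real \<Rightarrow> real \<Rightarrow> 5 \<Rightarrow> real" where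
  "jacobian_row a b x y j =
    (if j = 1 then 1 else if j = 2 then y * a else if j = 3 then y * b else if j = 4 then x * a else x * b)"

lemma jacobian_row_measurable [measurable]:
  "(\<lambda>p. jacobian_row (a p) (b p) (x p) (y p) j) \<in> borel_measurable M"
  if [measurable]: "a \<in> borel_measurable M" "b \<in> borel_measurable M" "x \<in> borel_measurable M" "y \<in> borel_measurable M"
  unfolding jacobian_row_def by measurable

lemma det_measurable [measurable]:
  fixes A :: "'a \<Rightarrow> 'n::finite \<Rightarrow> 'n \<Rightarrow> real"
  assumes [measurable]: "\<And>i j. (\<lambda>x. A x i j) \<in> borel_measurable M"
  shows "(\<lambda>x. det (\<chi> i j. A x i j)) \<in> borel_measurable M"
  unfolding det_def by simp

text \<open>Each entry involves at most one of \<open>x\<close> and \<open>y\<close>, and linearly,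
  so its mean over a quadrant is its value at the conditional means, which are signs; 1/4 is the
  mass of the quadrant.\<close>

lemma integral_jacobian_row_quadrant:
  "integrable (cot_measure \<Otimes>\<^sub>M cot_measure)
     (\<lambda>p. indicator (half_line \<sigma> \<times> half_line \<tau>) p * jacobian_row a b (fst p) (snd p) j)" (is ?i)
  "(LINT p|(cot_measure \<Otimes>\<^sub>M cot_measure).
      indicator (half_line \<sigma> \<times> half_line \<tau>) p * jacobian_row a b (fst p) (snd p) j)
    = 1/4 * jacobian_row a b (sg \<sigma>) (sg \<tau>) j" (is ?e)
proof -
  note c = prob_space_cot_measure
  note I = integral_cot_half_lines[folded half_line_def]
  have *: "indicator (half_line \<sigma> \<times> half_line \<tau>) p * jacobian_row a b (fst p) (snd p) j =
    (if j = 1 then indicator (half_line \<sigma>) (fst p) * indicator (half_line \<tau>) (snd p)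
     else if j = 2 then a * (indicator (half_line \<sigma>) (fst p) * (indicator (half_line \<tau>) (snd p) * snd p))
     else if j = 3 then b * (indicator (half_line \<sigma>) (fst p) * (indicator (half_line \<tau>) (snd p) * snd p))
     else if j = 4 then a * ((indicator (half_line \<sigma>) (fst p) * fst p) * indicator (half_line \<tau>) (snd p))
     else b * ((indicator (half_line \<sigma>) (fst p) * fst p) * indicator (half_line \<tau>) (snd p)))" for p :: "real \<times> real"
    by (cases p) (simp add: jacobian_row_def indicator_times)
  note p1 = integral_pair_mult[OF c c I(1)[of \<sigma>] I(1)[of \<tau>], unfolded I]
    and p2 = integral_pair_mult[OF c c I(1)[of \<sigma>] I(2)[of \<tau>], unfolded I]
    and p3 = integral_pair_mult[OF c c I(2)[of \<sigma>] I(1)[of \<tau>], unfolded I]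
  consider "j = 1" | "j = 2" | "j = 3" | "j = 4" | "j = 5" using exhaust_5 by blast
  then have "?i \<and> ?e"
    by cases (unfold *, simp_all add: p1 p2 p3 jacobian_row_def sg_def)
  then show ?i ?e by blast+
qed

text \<open>The inequality |E f| <= E |f| is applied on each of the 4^5 orthants separately, which
  prevents cancellation between them. The orthants are disjoint, so their contributions add up to at
  most the full integral.\<close>

lemma nn_integral_abs_det_quadrants:
  fixes a b :: "5 \<Rightarrow> real"
  defines "N \<equiv> cot_measure \<Otimes>\<^sub>M cot_measure"
  defines "D \<equiv> \<lambda>x y. det (\<chi> i j. jacobian_row (a i) (b i) (x i) (y i) j)"
  shows "ennreal (\<Sum>(\<sigma>, \<tau>)\<in>UNIV. (1/4)^5 * \<bar>D (\<lambda>i. sg (\<sigma> i)) (\<lambda>i. sg (\<tau> i))\<bar>) \<le>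
    (\<integral>\<^sup>+\<omega>. ennreal \<bar>D (\<lambda>i. fst (\<omega> i)) (\<lambda>i. snd (\<omega> i))\<bar> \<partial>Pi\<^sub>M UNIV (\<lambda>_. N))"
proof -
  interpret c: prob_space cot_measure by (rule prob_space_cot_measure)
  interpret cc: pair_prob_space cot_measure cot_measure by standard
  have pN: "prob_space N" unfolding N_def by (rule cc.prob_space_axioms)
  have sN [measurable_cong]: "sets N = sets (borel \<Otimes>\<^sub>M borel)"
    unfolding N_def by (intro sets_pair_measure_cong) auto
  define P where "P = Pi\<^sub>M (UNIV :: 5 set) (\<lambda>_. N)"
  define f where "f \<omega> = D (\<lambda>i. fst (\<omega> i)) (\<lambda>i. snd (\<omega> i))" for \<omega>
  define Q where "Q z i = half_line (fst z i) \<times> half_line (snd z i)" for z :: "(5 \<Rightarrow> bool) \<times> (5 \<Rightarrow> bool)" and i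
  define I where "I z \<omega> = (\<Prod>i\<in>UNIV. indicator (Q z i) (\<omega> i) :: real)" for z \<omega>
  have [measurable]: "half_line s \<in> sets borel" for s by (simp add: half_line_def)
  have [measurable]: "Q z i \<in> sets N" for z i unfolding Q_def by measurable
  have fm [measurable]: "f \<in> borel_measurable P" unfolding f_def D_def P_def by measurable
  have Im [measurable]: "I z \<in> borel_measurable P" for z unfolding I_def P_def by measurable
  have I_val: "I z \<omega> = (if \<forall>i. \<omega> i \<in> Q z i then 1 else 0)" for z \<omega>
    by (auto simp: I_def indicator_def prod_zero_iff)
  \<comment> \<open>A point with a zero coordinate lies in no orthant, every other point in exactly
    one.\<close>
  have I_le: "(\<Sum>z\<in>UNIV. I z \<omega>) \<le> 1" for \<omega>
  proof (cases "\<exists>z. \<forall>i. \<omega> i \<in> Q z i")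
    case True
    then obtain z where z: "\<forall>i. \<omega> i \<in> Q z i" by blast
    have "z' = z" if "\<forall>i. \<omega> i \<in> Q z' i" for z'
      using that z by (auto simp: Q_def mem_half_line mem_Times_iff prod_eq_iff fun_eq_iff)
    then have "(\<Sum>z\<in>UNIV. I z \<omega>) = (\<Sum>z'\<in>{z}. I z' \<omega>)"
      by (intro sum.mono_neutral_right) (auto simp: I_val)
    then show ?thesis by (simp add: I_val)
  next
    case False
    then have "\<not> (\<forall>i. \<omega> i \<in> Q z i)" for z by blast
    then have "I z \<omega> = 0" for z unfolding I_val by (rule if_not_P)
    then show ?thesis by simp
  qed
  have val: "integrable P (\<lambda>\<omega>. I z \<omega> * f \<omega>) \<and> (LINT \<omega>|P. I z \<omega> * f \<omega>) =
      (1/4)^5 * D (\<lambda>i. sg (fst z i)) (\<lambda>i. sg (snd z i))" for z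
  proof -
    \<comment> \<open>The indicator of an orthant is a product over the rows and is absorbed into
      them by multilinearity.\<close>
    have eq: "I z \<omega> * f \<omega> = det (\<chi> i j. indicator (Q z i) (\<omega> i) *
        jacobian_row (a i) (b i) (fst (\<omega> i)) (snd (\<omega> i)) j)" for \<omega>
      unfolding I_def f_def D_def det_rows_mul[symmetric]
      by (simp add: vector_scalar_mult_def)
    have r: "integrable N (\<lambda>p. indicator (Q z i) p * jacobian_row (a i) (b i) (fst p) (snd p) j)"
      "(LINT p|N. indicator (Q z i) p * jacobian_row (a i) (b i) (fst p) (snd p) j)
        = 1/4 * jacobian_row (a i) (b i) (sg (fst z i)) (sg (snd z i)) j" for i j
      unfolding N_def Q_def by (rule integral_jacobian_row_quadrant)+
    have "det (\<chi> i j. 1/4 * jacobian_row (a i) (b i) (sg (fst z i)) (sg (snd z i)) j)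
      = (1/4)^5 * D (\<lambda>i. sg (fst z i)) (\<lambda>i. sg (snd z i))"
      using det_rows_mul[of "\<lambda>_. 1/4" "\<lambda>i. \<chi> j. jacobian_row (a i) (b i) (sg (fst z i)) (sg (snd z i)) j"]
      by (simp add: vector_scalar_mult_def D_def)
    then show ?thesis
      unfolding eq P_def
      using integral_det_independent_rows[of "\<lambda>_. N"
          "\<lambda>i j p. indicator (Q z i) p * jacobian_row (a i) (b i) (fst p) (snd p) j", OF pN r(1)]
      unfolding r(2) by simp
  qed
  have "ennreal (\<Sum>z\<in>UNIV. (1/4)^5 * \<bar>D (\<lambda>i. sg (fst z i)) (\<lambda>i. sg (snd z i))\<bar>) =
      (\<Sum>z\<in>UNIV. ennreal \<bar>LINT \<omega>|P. I z \<omega> * f \<omega>\<bar>)"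
    by (subst sum_ennreal[symmetric]) (auto simp: val abs_mult)
  also have "\<dots> \<le> (\<Sum>z\<in>UNIV. \<integral>\<^sup>+\<omega>. ennreal (I z \<omega> * \<bar>f \<omega>\<bar>) \<partial>P)"
  proof (rule sum_mono)
    fix z
    have "I z \<omega> \<ge> 0" for \<omega> by (simp add: I_val)
    then show "ennreal \<bar>LINT \<omega>|P. I z \<omega> * f \<omega>\<bar> \<le> (\<integral>\<^sup>+\<omega>. ennreal (I z \<omega> * \<bar>f \<omega>\<bar>) \<partial>P)"
      using integral_norm_bound_ennreal[of P "\<lambda>\<omega>. I z \<omega> * f \<omega>"] val[of z] by (simp add: abs_mult)
  qed
  also have "\<dots> = (\<integral>\<^sup>+\<omega>. (\<Sum>z\<in>UNIV. ennreal (I z \<omega> * \<bar>f \<omega>\<bar>)) \<partial>P)"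
    by (rule nn_integral_sum[symmetric]) measurable
  also have "\<dots> \<le> (\<integral>\<^sup>+\<omega>. ennreal \<bar>f \<omega>\<bar> \<partial>P)"
  proof (rule nn_integral_mono)
    fix \<omega>
    have "(\<Sum>z\<in>UNIV. ennreal (I z \<omega> * \<bar>f \<omega>\<bar>)) = ennreal ((\<Sum>z\<in>UNIV. I z \<omega>) * \<bar>f \<omega>\<bar>)"
      by (subst sum_ennreal) (auto simp: sum_distrib_right I_val)
    also have "\<dots> \<le> ennreal \<bar>f \<omega>\<bar>"
      using mult_right_mono[OF I_le, of "\<bar>f \<omega>\<bar>" \<omega>] by (intro ennreal_leI) simp
    finally show "(\<Sum>z\<in>UNIV. ennreal (I z \<omega> * \<bar>f \<omega>\<bar>)) \<le> ennreal \<bar>f \<omega>\<bar>" .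
  qed
  finally show ?thesis by (simp add: P_def f_def case_prod_beta')
qed

section \<open>Random lines in the plane and the block determinants\<close>

definition line_x :: "real \<Rightarrow> real" where "line_x q = 1 / sqrt (1 + q\<^sup>2)"
definition line_y :: "real \<Rightarrow> real" where "line_y q = q / sqrt (1 + q\<^sup>2)"

lemma line_measurable [measurable]: "line_x \<in> borel_measurable borel" "line_y \<in> borel_measurable borel"
  unfolding line_x_def line_y_def by measurable

lemma line_unit: "(line_x q)\<^sup>2 + (line_y q)\<^sup>2 = 1"
  by (simp add: line_x_def line_y_def power_divide add_divide_distrib[symmetric])

text \<open>The wedge of v with a uniform unit vector is |v| |sin| in absolute value, and |sin| has
  mean 2 / pi.\<close>

lemma nn_integral_cauchy_line:
  "(\<integral>\<^sup>+q. ennreal \<bar>line_x q * v2 - line_y q * v1\<bar> \<partial>cauchy) = ennreal (2 / pi * sqrt (v1\<^sup>2 + v2\<^sup>2))"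
proof -
  have "\<bar>line_x q * v2 - line_y q * v1\<bar> = \<bar>v2 + (- v1) * q\<bar> / sqrt (1 + q\<^sup>2)" for q
    by (simp add: line_x_def line_y_def diff_divide_distrib[symmetric] abs_divide mult.commute)
  then show ?thesis
    using nn_integral_cauchy_abs[of v2 "- v1"] by (simp add: add.commute)
qed

text \<open>Let t be the absolute sine and c the cosine of the angle between the two unit vectors.
  The right side squared is 4 + 4 t, because its two roots have product 2 t, and (1 + 2/5 t)^2 <= 1
  + t on [0, 1]. The constant 2/5 is a rational slightly below sqrt 2 - 1, the best slope on this
  interval.\<close>

lemma sqrt_sum_bound:
  fixes a1 a2 b1 b2 :: real
  assumes "a1\<^sup>2 + a2\<^sup>2 = 1" "b1\<^sup>2 + b2\<^sup>2 = 1"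
  shows "2 * (1 + 2/5 * \<bar>a1 * b2 - a2 * b1\<bar>) \<le>
    sqrt ((a1 - b1)\<^sup>2 + (a2 - b2)\<^sup>2) + sqrt ((a1 + b1)\<^sup>2 + (a2 + b2)\<^sup>2)"
proof -
  define t where "t = \<bar>a1 * b2 - a2 * b1\<bar>"
  define c where "c = a1 * b1 + a2 * b2"
  have tc: "t\<^sup>2 + c\<^sup>2 = 1"
  proof -
    have "t\<^sup>2 + c\<^sup>2 = (a1\<^sup>2 + a2\<^sup>2) * (b1\<^sup>2 + b2\<^sup>2)"
      by (simp add: t_def c_def power2_eq_square algebra_simps)
    then show ?thesis using assms by simp
  qed
  have t: "0 \<le> t" "t \<le> 1" using tc by (auto simp: t_def abs_le_square_iff[of 1, symmetric] intro: power2_le_imp_le)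
      (smt (verit) tc t_def power2_le_imp_le zero_le_power2 one_power2)
  have m: "(a1 - b1)\<^sup>2 + (a2 - b2)\<^sup>2 = 2 - 2 * c" and p: "(a1 + b1)\<^sup>2 + (a2 + b2)\<^sup>2 = 2 + 2 * c"
    using assms by (simp_all add: c_def power2_eq_square algebra_simps)
  have c: "2 - 2 * c \<ge> 0" "2 + 2 * c \<ge> 0" using m p by (metis sum_power2_ge_zero)+
  have "(2 * (1 + 2/5 * t))\<^sup>2 \<le> 4 + 4 * t"
    using t mult_left_mono[of t 1 t] by (simp add: power2_eq_square algebra_simps)
  also have "\<dots> = (sqrt (2 - 2 * c) + sqrt (2 + 2 * c))\<^sup>2"
  proof -
    have "(2 - 2 * c) * (2 + 2 * c) = (2 * t)\<^sup>2" using tc by (simp add: power2_eq_square algebra_simps)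
    then have "sqrt (2 - 2 * c) * sqrt (2 + 2 * c) = 2 * t"
      using t by (simp only: real_sqrt_mult[symmetric] real_sqrt_abs abs_of_nonneg)
    then show ?thesis using c by (simp add: power2_sum)
  qed
  finally show ?thesis
    unfolding m p t_def[symmetric] using c by (intro power2_le_imp_le[of "2 * (1 + 2/5 * t)"]) auto
qed

text \<open>\<open>\<delta> i\<close> is the sign of y, and \<open>s i\<close> records whether x and
  y have equal signs. Orthants are indexed this way because the block structure depends on
  \<open>s\<close> alone.\<close>

definition sign_det :: "(5 \<Rightarrow> real) \<Rightarrow> (5 \<Rightarrow> bool) \<Rightarrow> (5 \<Rightarrow> bool) \<Rightarrow> real" where
  "sign_det q s \<delta> = \<bar>det (\<chi> i j. jacobian_row (line_x (q i)) (line_y (q i)) (sg (s i) * sg (\<delta> i)) (sg (\<delta> i)) j)\<bar>"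

lemma sum_flip:
  fixes h :: "('i::finite \<Rightarrow> bool) \<Rightarrow> real"
  shows "(\<Sum>\<delta>\<in>UNIV. h \<delta>) = (\<Sum>\<delta>\<in>UNIV. (h \<delta> + h (\<delta>(i := \<not> \<delta> i))) / 2)"
proof -
  have "(\<Sum>\<delta>\<in>UNIV. h (\<delta>(i := \<not> \<delta> i))) = (\<Sum>\<delta>\<in>UNIV. h \<delta>)"
    by (rule sum.reindex_bij_witness[of _ "\<lambda>\<delta>. \<delta>(i := \<not> \<delta> i)" "\<lambda>\<delta>. \<delta>(i := \<not> \<delta> i)"]) auto
  then show ?thesis by (simp add: sum.distrib flip: sum_divide_distrib)
qed

definition wedge :: "real \<Rightarrow> real \<Rightarrow> real" where
  "wedge p q = line_x p * line_y q - line_y p * line_x q"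

lemma wedge_measurable [measurable]:
  "f \<in> borel_measurable M \<Longrightarrow> g \<in> borel_measurable M \<Longrightarrow> (\<lambda>x. wedge (f x) (g x)) \<in> borel_measurable M"
  unfolding wedge_def
  by (intro borel_measurable_diff borel_measurable_times measurable_compose[OF _ line_measurable(1)]
      measurable_compose[OF _ line_measurable(2)])

text \<open>Averaging over the sign of \<open>e\<^sub>3\<close> and the triangle inequality remove the term \<open>C\<close> that does not
  involve \<open>e\<^sub>3\<close>.\<close>

lemma sum_sign_det_ge:
  assumes s: "\<And>i. s i \<longleftrightarrow> ((i \<in> {1, 2, 3}) = b)"
  shows "64 * \<bar>wedge (q 4) (q 5)\<bar> * (\<bar>wedge (q 3) (q 1) - wedge (q 3) (q 2)\<bar> + \<bar>wedge (q 3) (q 1) + wedge (q 3) (q 2)\<bar>)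
    \<le> (\<Sum>\<delta>\<in>UNIV. sign_det q s \<delta>)"
proof -
  define W where "W = \<bar>wedge (q 4) (q 5)\<bar>"
  define S where "S \<delta> = sg (\<delta> 3) * (sg (\<delta> 1) * wedge (q 3) (q 1) - sg (\<delta> 2) * wedge (q 3) (q 2))" for \<delta> :: "5 \<Rightarrow> bool"
  define C where "C \<delta> = sg (\<delta> 1) * sg (\<delta> 2) * wedge (q 1) (q 2)" for \<delta> :: "5 \<Rightarrow> bool"
  have sgsg: "\<bar>sg x\<bar> = 1" for x by (simp add: sg_def)
  \<comment> \<open>The sign \<open>\<delta> i\<close> is moved from x and y onto the unit vector of
    row i. Columns 4 and 5 then equal \<open>sg b\<close> times columns 2 and 3 on rows 1 to 3, and
    minus that on rows 4 and 5, as \<open>det_two_blocks\<close> requires.\<close>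
  have sd: "sign_det q s \<delta> = 4 * W * \<bar>S \<delta> + C \<delta>\<bar>" for \<delta>
  proof -
    have "sg b * sg b = 1" by (simp add: sg_def)
    then have "det (\<chi> i j. jacobian_row (line_x (q i)) (line_y (q i)) (sg (s i) * sg (\<delta> i)) (sg (\<delta> i)) j) =
      4 * (sg (\<delta> 4) * line_x (q 4) * (sg (\<delta> 5) * line_y (q 5)) - sg (\<delta> 5) * line_x (q 5) * (sg (\<delta> 4) * line_y (q 4))) *
      ((sg (\<delta> 2) * line_x (q 2) * (sg (\<delta> 3) * line_y (q 3)) - sg (\<delta> 3) * line_x (q 3) * (sg (\<delta> 2) * line_y (q 2))) +
       (sg (\<delta> 3) * line_x (q 3) * (sg (\<delta> 1) * line_y (q 1)) - sg (\<delta> 1) * line_x (q 1) * (sg (\<delta> 3) * line_y (q 3))) +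
       (sg (\<delta> 1) * line_x (q 1) * (sg (\<delta> 2) * line_y (q 2)) - sg (\<delta> 2) * line_x (q 2) * (sg (\<delta> 1) * line_y (q 1))))"
      by (intro det_two_blocks[where c = "sg b"])
        (auto simp: jacobian_row_def s sg_def)
    also have "\<dots> = (sg (\<delta> 4) * sg (\<delta> 5)) * (4 * wedge (q 4) (q 5) * (S \<delta> + C \<delta>))"
      by (simp add: S_def C_def wedge_def algebra_simps)
    finally show ?thesis
      by (simp add: sign_det_def abs_mult sgsg W_def)
  qed
  have flip3: "S (\<delta>(3 := \<not> \<delta> 3)) = - S \<delta>" "C (\<delta>(3 := \<not> \<delta> 3)) = C \<delta>" for \<delta>
    by (simp_all add: S_def C_def sg_def)
  have "(\<Sum>\<delta>\<in>UNIV. sign_det q s \<delta>) = (\<Sum>\<delta>\<in>UNIV. (4 * W * \<bar>S \<delta> + C \<delta>\<bar> + 4 * W * \<bar>- S \<delta> + C \<delta>\<bar>) / 2)"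
    by (subst sum_flip[of _ 3]) (simp only: sd flip3)
  also have "\<dots> \<ge> (\<Sum>\<delta>\<in>UNIV. 4 * W * \<bar>S \<delta>\<bar>)" (is "_ \<ge> ?S")
  proof (rule sum_mono)
    fix \<delta>
    have "2 * \<bar>S \<delta>\<bar> \<le> \<bar>S \<delta> + C \<delta>\<bar> + \<bar>- S \<delta> + C \<delta>\<bar>" by linarith
    from mult_left_mono[OF this, of "2 * W"]
    show "4 * W * \<bar>S \<delta>\<bar> \<le> (4 * W * \<bar>S \<delta> + C \<delta>\<bar> + 4 * W * \<bar>- S \<delta> + C \<delta>\<bar>) / 2"
      by (simp add: W_def distrib_left)
  qed
  finally have "?S \<le> (\<Sum>\<delta>\<in>UNIV. sign_det q s \<delta>)" .
  \<comment> \<open>Flipping \<open>\<delta> 1\<close> as well makes the two wedges occur with both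
    relative signs. The factor 2 here and the 32 sign vectors give the constant 64.\<close>
  moreover have "?S = (\<Sum>\<delta>\<in>(UNIV :: (5 \<Rightarrow> bool) set). 2 * W * (\<bar>wedge (q 3) (q 1) - wedge (q 3) (q 2)\<bar> + \<bar>wedge (q 3) (q 1) + wedge (q 3) (q 2)\<bar>))"
  proof (subst sum_flip[of _ 1], rule sum.cong[OF refl])
    fix \<delta> :: "5 \<Rightarrow> bool"
    have "\<bar>S \<delta>\<bar> + \<bar>S (\<delta>(1 := \<not> \<delta> 1))\<bar> = \<bar>wedge (q 3) (q 1) - wedge (q 3) (q 2)\<bar> + \<bar>wedge (q 3) (q 1) + wedge (q 3) (q 2)\<bar>"
      by (cases "\<delta> 1"; cases "\<delta> 2"; simp add: S_def abs_mult sgsg) (auto simp: sg_def)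
    then show "(4 * W * \<bar>S \<delta>\<bar> + 4 * W * \<bar>S (\<delta>(1 := \<not> \<delta> 1))\<bar>) / 2 = 2 * W * (\<bar>wedge (q 3) (q 1) - wedge (q 3) (q 2)\<bar> + \<bar>wedge (q 3) (q 1) + wedge (q 3) (q 2)\<bar>)"
      by (simp add: distrib_left[symmetric] mult.assoc)
  qed
  ultimately show ?thesis by (simp add: W_def card_fun algebra_simps)
qed

definition jacobian_bound :: real where "jacobian_bound = 10 / pi\<^sup>2 * (1 + 4 / (5 * pi))"

lemma nn_integral_cauchy_wedge: "(\<integral>\<^sup>+q. ennreal \<bar>wedge q p\<bar> \<partial>cauchy) = ennreal (2 / pi)"
  using nn_integral_cauchy_line[of "line_y p" "line_x p"] by (simp add: wedge_def line_unit)

text \<open>The chain is best read from the bottom: index 3 is integrated out first and produces the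
  two roots of \<open>sqrt_sum_bound\<close>, then index 4 with mean 2 / pi, then index 1 with mean
  2 / pi, while 2 and 5 are reference directions. The constants multiply to 64 * (4 / pi) * (2 / pi)
  = 512 / pi^2.\<close>

lemma nn_integral_sign_det_block:
  assumes s: "\<And>i. s i \<longleftrightarrow> ((i \<in> {1, 2, 3}) = b)"
  shows "ennreal (256 / 5 * jacobian_bound) \<le> (\<integral>\<^sup>+q. ennreal (\<Sum>\<delta>\<in>UNIV. sign_det q s \<delta>) \<partial>Pi\<^sub>M UNIV (\<lambda>_. cauchy))"
proof -
  interpret prob_space cauchy by (rule prob_space_cauchy)
  interpret product_sigma_finite "\<lambda>_::5. cauchy" by standard
  define W where "W p q = \<bar>wedge p q\<bar>" for p q
  define X where "X c a b = \<bar>wedge c a - wedge c b\<bar> + \<bar>wedge c a + wedge c b\<bar>" for a b c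
  have [measurable]: "(\<lambda>x. W (f x) (g x)) \<in> borel_measurable M" if "f \<in> borel_measurable M" "g \<in> borel_measurable M" for f g M
    using that unfolding W_def by measurable
  have [measurable]: "(\<lambda>x. X (h x) (f x) (g x)) \<in> borel_measurable M"
    if "f \<in> borel_measurable M" "g \<in> borel_measurable M" "h \<in> borel_measurable M" for f g h M
    using that unfolding X_def by measurable
  have comp [measurable]: "(\<lambda>q. q i) \<in> borel_measurable (Pi\<^sub>M I (\<lambda>_. cauchy))" if "i \<in> I" for I :: "5 set" and i
    using measurable_component_singleton[OF that, of "\<lambda>_. cauchy"] by (simp cong: measurable_cong_sets)
  have Xint: "ennreal (4 / pi * (1 + 2/5 * W a b)) \<le> (\<integral>\<^sup>+c. ennreal (X c a b) \<partial>cauchy)" for a b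
  proof -
    have "(\<integral>\<^sup>+c. ennreal (X c a b) \<partial>cauchy) =
      (\<integral>\<^sup>+c. ennreal \<bar>line_x c * (line_y a - line_y b) - line_y c * (line_x a - line_x b)\<bar> +
        ennreal \<bar>line_x c * (line_y a + line_y b) - line_y c * (line_x a + line_x b)\<bar> \<partial>cauchy)"
      by (intro nn_integral_cong) (simp add: X_def wedge_def algebra_simps flip: ennreal_plus)
    also have "\<dots> = ennreal (2 / pi * sqrt ((line_x a - line_x b)\<^sup>2 + (line_y a - line_y b)\<^sup>2)) +
        ennreal (2 / pi * sqrt ((line_x a + line_x b)\<^sup>2 + (line_y a + line_y b)\<^sup>2))"
      by (subst nn_integral_add) (simp_all add: nn_integral_cauchy_line)
    also have "\<dots> = ennreal (2 / pi * (sqrt ((line_x a - line_x b)\<^sup>2 + (line_y a - line_y b)\<^sup>2) +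
        sqrt ((line_x a + line_x b)\<^sup>2 + (line_y a + line_y b)\<^sup>2)))"
      by (subst ennreal_plus[symmetric]) (auto simp: distrib_left)
    also have "\<dots> \<ge> ennreal (2 / pi * (2 * (1 + 2/5 * W a b)))"
      unfolding W_def wedge_def
      by (intro ennreal_leI mult_left_mono sqrt_sum_bound) (auto simp: line_unit)
    finally show ?thesis by simp
  qed
  have W4: "(\<integral>\<^sup>+c. ennreal (W c p) \<partial>cauchy) = ennreal (2 / pi)" for p
    by (simp add: W_def nn_integral_cauchy_wedge)
  have U: "(UNIV :: 5 set) = insert 3 (insert 4 (insert 1 {2, 5}))" using UNIV_5 by auto
  have "ennreal (256 / 5 * jacobian_bound) = ennreal (512 / pi\<^sup>2 + 512 / pi\<^sup>2 * (2/5) * (2 / pi))"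
    by (simp add: jacobian_bound_def field_simps)
  also have "\<dots> = (\<integral>\<^sup>+q. ennreal (512 / pi\<^sup>2 + 512 / pi\<^sup>2 * (2/5) * (2 / pi)) \<partial>Pi\<^sub>M {2, 5::5} (\<lambda>_. cauchy))"
  proof -
    interpret P: prob_space "Pi\<^sub>M {2, 5::5} (\<lambda>_. cauchy)" by (intro prob_space_PiM prob_space_cauchy)
    show ?thesis by (simp add: P.emeasure_space_1)
  qed
  also have "\<dots> = (\<integral>\<^sup>+q. (\<integral>\<^sup>+y. ennreal (512 / pi\<^sup>2 * (1 + 2/5 * W y (q 2))) \<partial>cauchy) \<partial>Pi\<^sub>M {2, 5::5} (\<lambda>_. cauchy))"
  proof (rule nn_integral_cong)
    fix q :: "5 \<Rightarrow> real"
    have "(\<integral>\<^sup>+y. ennreal (512 / pi\<^sup>2 * (1 + 2/5 * W y (q 2))) \<partial>cauchy) =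
       (\<integral>\<^sup>+y. ennreal (512 / pi\<^sup>2) + ennreal (512 / pi\<^sup>2 * (2/5)) * ennreal (W y (q 2)) \<partial>cauchy)"
      by (intro nn_integral_cong) (simp add: W_def distrib_left flip: ennreal_mult ennreal_plus)
    also have "\<dots> = ennreal (512 / pi\<^sup>2) + ennreal (512 / pi\<^sup>2 * (2/5)) * ennreal (2 / pi)"
      using emeasure_space_1 by (subst nn_integral_add) (auto simp: nn_integral_cmult W4)
    finally show "ennreal (512 / pi\<^sup>2 + 512 / pi\<^sup>2 * (2/5) * (2 / pi)) =
       (\<integral>\<^sup>+y. ennreal (512 / pi\<^sup>2 * (1 + 2/5 * W y (q 2))) \<partial>cauchy)"
      by (simp flip: ennreal_mult ennreal_plus)
  qed
  also have "\<dots> = (\<integral>\<^sup>+q. ennreal (512 / pi\<^sup>2 * (1 + 2/5 * W (q 1) (q 2))) \<partial>Pi\<^sub>M (insert 1 {2, 5::5}) (\<lambda>_. cauchy))"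
    by (subst product_nn_integral_insert) (auto intro!: measurable_compose[OF _ measurable_ennreal] borel_measurable_times borel_measurable_add)
  also have "\<dots> = (\<integral>\<^sup>+q. (\<integral>\<^sup>+y. ennreal (W y (q 5)) * ennreal (256 / pi * (1 + 2/5 * W (q 1) (q 2))) \<partial>cauchy) \<partial>Pi\<^sub>M (insert 1 {2, 5::5}) (\<lambda>_. cauchy))"
  proof (rule nn_integral_cong)
    fix q :: "5 \<Rightarrow> real"
    have "(\<integral>\<^sup>+y. ennreal (W y (q 5)) * ennreal (256 / pi * (1 + 2/5 * W (q 1) (q 2))) \<partial>cauchy) =
      ennreal (2 / pi) * ennreal (256 / pi * (1 + 2/5 * W (q 1) (q 2)))"
      by (subst nn_integral_multc) (auto simp: W4)
    then show "ennreal (512 / pi\<^sup>2 * (1 + 2/5 * W (q 1) (q 2))) =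
      (\<integral>\<^sup>+y. ennreal (W y (q 5)) * ennreal (256 / pi * (1 + 2/5 * W (q 1) (q 2))) \<partial>cauchy)"
      by (simp add: W_def power2_eq_square flip: ennreal_mult)
  qed
  also have "\<dots> = (\<integral>\<^sup>+q. ennreal (W (q 4) (q 5)) * ennreal (256 / pi * (1 + 2/5 * W (q 1) (q 2))) \<partial>Pi\<^sub>M (insert 4 (insert 1 {2, 5::5})) (\<lambda>_. cauchy))"
    by (subst product_nn_integral_insert) auto
  also have "\<dots> \<le> (\<integral>\<^sup>+q. (\<integral>\<^sup>+y. ennreal (64 * W (q 4) (q 5)) * ennreal (X y (q 1) (q 2)) \<partial>cauchy) \<partial>Pi\<^sub>M (insert 4 (insert 1 {2, 5::5})) (\<lambda>_. cauchy))"
  proof (rule nn_integral_mono)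
    fix q :: "5 \<Rightarrow> real"
    have "ennreal (W (q 4) (q 5)) * ennreal (256 / pi * (1 + 2/5 * W (q 1) (q 2))) =
      ennreal (64 * W (q 4) (q 5)) * ennreal (4 / pi * (1 + 2/5 * W (q 1) (q 2)))"
      by (simp add: W_def flip: ennreal_mult)
    also have "\<dots> \<le> ennreal (64 * W (q 4) (q 5)) * (\<integral>\<^sup>+c. ennreal (X c (q 1) (q 2)) \<partial>cauchy)"
      by (intro mult_left_mono Xint) simp
    also have "\<dots> = (\<integral>\<^sup>+y. ennreal (64 * W (q 4) (q 5)) * ennreal (X y (q 1) (q 2)) \<partial>cauchy)"
      by (subst nn_integral_cmult) auto
    finally show "ennreal (W (q 4) (q 5)) * ennreal (256 / pi * (1 + 2/5 * W (q 1) (q 2))) \<le> \<dots>" .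
  qed
  also have "\<dots> = (\<integral>\<^sup>+q. ennreal (64 * W (q 4) (q 5)) * ennreal (X (q 3) (q 1) (q 2)) \<partial>Pi\<^sub>M (insert 3 (insert 4 (insert 1 {2, 5::5}))) (\<lambda>_. cauchy))"
    by (subst product_nn_integral_insert) auto
  also have "\<dots> \<le> (\<integral>\<^sup>+q. ennreal (\<Sum>\<delta>\<in>UNIV. sign_det q s \<delta>) \<partial>Pi\<^sub>M UNIV (\<lambda>_. cauchy))"
    unfolding U[symmetric]
  proof (rule nn_integral_mono)
    fix q :: "5 \<Rightarrow> real"
    show "ennreal (64 * W (q 4) (q 5)) * ennreal (X (q 3) (q 1) (q 2)) \<le> ennreal (\<Sum>\<delta>\<in>UNIV. sign_det q s \<delta>)"
      using sum_sign_det_ge[OF s, of q]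
      by (subst ennreal_mult[symmetric]) (auto simp: W_def X_def intro!: ennreal_leI)
  qed
  finally show ?thesis .
qed

lemma sign_det_permute:
  assumes p: "bij p"
  shows "sign_det (q \<circ> p) (s \<circ> p) (\<delta> \<circ> p) = sign_det q s \<delta>"
proof -
  have p': "p permutes UNIV" using p by (simp add: bij_iff permutes_def)
  have "sign_det (q \<circ> p) (s \<circ> p) (\<delta> \<circ> p) = \<bar>of_int (sign p) * det (\<chi> i j. jacobian_row (line_x (q i)) (line_y (q i)) (sg (s i) * sg (\<delta> i)) (sg (\<delta> i)) j)\<bar>"
    unfolding sign_det_def
    by (subst det_permute_rows[OF p', symmetric]) simp
  then show ?thesis by (simp add: sign_det_def abs_mult sign_def)
qed

text \<open>The order of the rows does not affect |det|, and the slopes are i.i.d., so the three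
  indices on which \<open>s\<close> has a common value \<open>b\<close> may be renamed 1, 2, 3. With
  two true values the three false ones are used.\<close>

lemma nn_integral_sign_det:
  assumes "card {i. s i} \<in> {2, 3}"
  shows "ennreal (256 / 5 * jacobian_bound) \<le> (\<integral>\<^sup>+q. ennreal (\<Sum>\<delta>\<in>UNIV. sign_det q s \<delta>) \<partial>Pi\<^sub>M UNIV (\<lambda>_. cauchy))"
proof -
  obtain b where b: "card {i. s i = b} = 3"
  proof (cases "card {i. s i} = 3")
    case True
    then show ?thesis using that[of True] by simp
  next
    case False
    then have "card {i. s i} = 2" using assms by simp
    moreover have "{i. s i = False} = - {i. s i}" by auto
    ultimately have "card {i. s i = False} = 3"
      by (simp add: Compl_eq_Diff_UNIV card_Diff_subset)
    then show ?thesis using that by blast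
  qed
  have "\<exists>p::5 \<Rightarrow> 5. bij p \<and> p ` {1, 2, 3} = {i. s i = b}"
  proof -
    have c: "card {1, 2, 3 :: 5} = 3" by simp
    obtain f where f: "bij_betw f {1, 2, 3::5} {i. s i = b}"
      using b c by (metis finite_same_card_bij finite)
    have "card (- {1, 2, 3::5}) = card (- {i. s i = b})"
      using b c by (simp add: Compl_eq_Diff_UNIV card_Diff_subset)
    then obtain g where g: "bij_betw g (- {1, 2, 3::5}) (- {i. s i = b})"
      by (metis finite_same_card_bij finite)
    define p where "p i = (if i \<in> {1, 2, 3} then f i else g i)" for i
    have "bij_betw p ({1, 2, 3} \<union> - {1, 2, 3}) ({i. s i = b} \<union> - {i. s i = b})"
    proof (rule bij_betw_combine)
      show "bij_betw p {1, 2, 3} {i. s i = b}" using f by (rule bij_betw_cong[THEN iffD1, rotated]) (simp add: p_def)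
      show "bij_betw p (- {1, 2, 3}) (- {i. s i = b})" using g by (rule bij_betw_cong[THEN iffD1, rotated]) (simp add: p_def)
    qed auto
    moreover have "p ` {1, 2, 3} = f ` {1, 2, 3}" by (auto simp: p_def)
    ultimately have "bij p \<and> p ` {1, 2, 3} = {i. s i = b}" using f by (simp add: bij_betw_def)
    then show ?thesis by blast
  qed
  then obtain p :: "5 \<Rightarrow> 5" where p: "bij p" "p ` {1, 2, 3} = {i. s i = b}" by blast
  have s: "(s \<circ> p) i \<longleftrightarrow> ((i \<in> {1, 2, 3}) = b)" for i
  proof -
    have "s (p i) = b \<longleftrightarrow> i \<in> {1, 2, 3}"
      using inj_image_mem_iff[OF bij_is_inj[OF p(1)], of i "{1, 2, 3}"] unfolding p(2) by simp
    then show ?thesis by auto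
  qed
  have sum: "(\<Sum>\<delta>\<in>UNIV. sign_det q s \<delta>) = (\<Sum>\<delta>\<in>UNIV. sign_det (q \<circ> p) (s \<circ> p) \<delta>)" for q
  proof (rule sum.reindex_bij_witness[of _ "\<lambda>\<delta>. \<delta> \<circ> inv p" "\<lambda>\<delta>. \<delta> \<circ> p"])
    show "sign_det (q \<circ> p) (s \<circ> p) (\<delta> \<circ> p) = sign_det q s \<delta>" for \<delta>
      by (rule sign_det_permute[OF p(1)])
  qed (auto simp: comp_assoc bij_is_inj[OF p(1)] surj_iff[THEN iffD1, OF bij_is_surj[OF p(1)]])
  have comp [measurable]: "(\<lambda>q. q i) \<in> borel_measurable (Pi\<^sub>M UNIV (\<lambda>_. cauchy))" for i :: 5
    using measurable_component_singleton[of i UNIV "\<lambda>_. cauchy"] by (simp cong: measurable_cong_sets)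
  have [measurable]: "(\<lambda>q. sign_det q s' \<delta>) \<in> borel_measurable (Pi\<^sub>M UNIV (\<lambda>_. cauchy))" for s' \<delta>
    unfolding sign_det_def
    by (intro borel_measurable_abs det_measurable jacobian_row_measurable
        measurable_compose[OF comp line_measurable(1)] measurable_compose[OF comp line_measurable(2)]) auto
  have "distr (Pi\<^sub>M UNIV (\<lambda>_. cauchy)) (Pi\<^sub>M UNIV (\<lambda>_. cauchy)) (\<lambda>\<omega>. \<omega> \<circ> p) = Pi\<^sub>M UNIV (\<lambda>_. cauchy)"
    using distr_PiM_reindex[of UNIV "\<lambda>_. cauchy" p UNIV] prob_space_cauchy bij_is_inj[OF p(1)]
    by (simp add: comp_def restrict_def)
  then have "(\<integral>\<^sup>+q. ennreal (\<Sum>\<delta>\<in>UNIV. sign_det q (s \<circ> p) \<delta>) \<partial>Pi\<^sub>M UNIV (\<lambda>_. cauchy)) =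
    (\<integral>\<^sup>+q. ennreal (\<Sum>\<delta>\<in>UNIV. sign_det q (s \<circ> p) \<delta>) \<partial>distr (Pi\<^sub>M UNIV (\<lambda>_. cauchy)) (Pi\<^sub>M UNIV (\<lambda>_. cauchy)) (\<lambda>\<omega>. \<omega> \<circ> p))"
    by simp
  also have "\<dots> = (\<integral>\<^sup>+q. ennreal (\<Sum>\<delta>\<in>UNIV. sign_det q s \<delta>) \<partial>Pi\<^sub>M UNIV (\<lambda>_. cauchy))"
    unfolding sum
  proof (rule nn_integral_distr)
    show "(\<lambda>\<omega>. \<omega> \<circ> p) \<in> Pi\<^sub>M UNIV (\<lambda>_. cauchy) \<rightarrow>\<^sub>M Pi\<^sub>M UNIV (\<lambda>_. cauchy)"
      unfolding comp_def by (rule measurable_PiM_single') (auto simp: cong: measurable_cong_sets)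
  qed measurable
  finally show ?thesis using nn_integral_sign_det_block[of "s \<circ> p" b, OF s] by simp
qed

lemma card_sign_patterns: "card {s :: 5 \<Rightarrow> bool. card {i. s i} \<in> {2, 3}} = 20"
proof -
  have "card {s :: 5 \<Rightarrow> bool. card {i. s i} \<in> {2, 3}} = card {S :: 5 set. card S \<in> {2, 3}}"
    by (rule bij_betw_same_card[of Collect], rule bij_betw_byWitness[where f' = "\<lambda>S i. i \<in> S"]) auto
  also have "{S :: 5 set. card S \<in> {2, 3}} = {S. S \<subseteq> UNIV \<and> card S = 2} \<union> {S. S \<subseteq> UNIV \<and> card S = 3}"
    by auto
  also have "card \<dots> = (5 choose 2) + (5 choose 3)"
  proof (subst card_Un_disjoint)
    show "card {S. S \<subseteq> (UNIV :: 5 set) \<and> card S = 2} + card {S. S \<subseteq> (UNIV :: 5 set) \<and> card S = 3} =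
      (5 choose 2) + (5 choose 3)"
      by (subst (1 2) n_subsets) simp_all
  qed auto
  also have "\<dots> = 20" by (simp add: eval_nat_numeral)
  finally show ?thesis .
qed

lemma nn_integral_abs_det_jacobian:
  "ennreal jacobian_bound \<le> (\<integral>\<^sup>+q. \<integral>\<^sup>+\<omega>. ennreal \<bar>det (\<chi> i j. jacobian_row (line_x (q i)) (line_y (q i)) (fst (\<omega> i)) (snd (\<omega> i)) j)\<bar>
     \<partial>Pi\<^sub>M UNIV (\<lambda>_. cot_measure \<Otimes>\<^sub>M cot_measure) \<partial>Pi\<^sub>M UNIV (\<lambda>_. cauchy))" (is "_ \<le> ?R")
proof -
  define G where "G = {s :: 5 \<Rightarrow> bool. card {i. s i} \<in> {2, 3}}"
  have comp: "(\<lambda>q. q i) \<in> borel_measurable (Pi\<^sub>M UNIV (\<lambda>_. cauchy))" for i :: 5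
    using measurable_component_singleton[of i UNIV "\<lambda>_. cauchy"] by (simp cong: measurable_cong_sets)
  have [measurable]: "(\<lambda>q. sign_det q s' \<delta>) \<in> borel_measurable (Pi\<^sub>M UNIV (\<lambda>_. cauchy))" for s' \<delta>
    unfolding sign_det_def
    by (intro borel_measurable_abs det_measurable jacobian_row_measurable
        measurable_compose[OF comp line_measurable(1)] measurable_compose[OF comp line_measurable(2)]) auto
  have nn: "0 \<le> sign_det q s \<delta>" for q s \<delta> by (simp add: sign_det_def)
  have b0: "0 \<le> jacobian_bound" by (simp add: jacobian_bound_def)
  \<comment> \<open>20 patterns with weight 4^-5 each: 20 * (256 / 5) / 1024 = 1, which explains the
    factor 256 / 5.\<close>
  have "ennreal jacobian_bound = (\<Sum>s\<in>G. ennreal ((1/4)^5) * ennreal (256 / 5 * jacobian_bound))"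
    using b0 card_sign_patterns by (simp add: G_def power_divide ennreal_of_nat_eq_real_of_nat flip: ennreal_mult ennreal_numeral)
  also have "\<dots> \<le> (\<Sum>s\<in>G. ennreal ((1/4)^5) * (\<integral>\<^sup>+q. ennreal (\<Sum>\<delta>\<in>UNIV. sign_det q s \<delta>) \<partial>Pi\<^sub>M UNIV (\<lambda>_. cauchy)))"
    by (intro sum_mono mult_left_mono nn_integral_sign_det) (auto simp: G_def)
  also have "\<dots> = (\<integral>\<^sup>+q. (\<Sum>s\<in>G. ennreal ((1/4)^5) * ennreal (\<Sum>\<delta>\<in>UNIV. sign_det q s \<delta>)) \<partial>Pi\<^sub>M UNIV (\<lambda>_. cauchy))"
    by (subst nn_integral_sum) (auto simp: nn_integral_cmult)
  also have "\<dots> \<le> ?R"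
  proof (rule nn_integral_mono)
    fix q :: "5 \<Rightarrow> real"
    define D where "D x y = det (\<chi> i j. jacobian_row (line_x (q i)) (line_y (q i)) (x i) (y i) j)" for x y
    have "(\<Sum>s\<in>G. ennreal ((1/4)^5) * ennreal (\<Sum>\<delta>\<in>UNIV. sign_det q s \<delta>)) =
      ennreal (\<Sum>s\<in>G. (1/4)^5 * (\<Sum>\<delta>\<in>UNIV. sign_det q s \<delta>))"
    proof -
      have "0 \<le> (\<Sum>\<delta>\<in>UNIV. sign_det q s \<delta>)" for s by (intro sum_nonneg nn)
      then show ?thesis by (simp flip: ennreal_mult)
    qed
    \<comment> \<open>The terms of the other 12 patterns are nonnegative and only added
      here.\<close>
    also have "\<dots> \<le> ennreal (\<Sum>s\<in>UNIV. (1/4)^5 * (\<Sum>\<delta>\<in>UNIV. sign_det q s \<delta>))"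
      by (intro ennreal_leI sum_mono2) (auto intro!: sum_nonneg mult_nonneg_nonneg nn)
    also have "(\<Sum>s\<in>UNIV. (1/4)^5 * (\<Sum>\<delta>\<in>UNIV. sign_det q s \<delta>)) = (\<Sum>(s, \<delta>)\<in>UNIV. (1/4)^5 * sign_det q s \<delta>)"
      by (simp add: sum_distrib_left sum.cartesian_product)
    \<comment> \<open>The sign of x is recovered from agreement and sign of y as
      \<open>\<sigma> i = (s i = \<delta> i)\<close>.\<close>
    also have "\<dots> = (\<Sum>(\<sigma>, \<tau>)\<in>UNIV. (1/4)^5 * \<bar>D (\<lambda>i. sg (\<sigma> i)) (\<lambda>i. sg (\<tau> i))\<bar>)"
    proof (rule sum.reindex_bij_witness[of _ "\<lambda>(\<sigma>, \<tau>). (\<lambda>i. \<sigma> i = \<tau> i, \<tau>)" "\<lambda>(s, \<delta>). (\<lambda>i. s i = \<delta> i, \<delta>)"])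
      have *: "sg (s i = \<delta> i) = sg (s i) * sg (\<delta> i)" for s \<delta> :: "5 \<Rightarrow> bool" and i by (simp add: sg_def)
      show "(case (case z of (s, \<delta>) \<Rightarrow> (\<lambda>i. s i = \<delta> i, \<delta>)) of (\<sigma>, \<tau>) \<Rightarrow> (1/4)^5 * \<bar>D (\<lambda>i. sg (\<sigma> i)) (\<lambda>i. sg (\<tau> i))\<bar>)
        = (case z of (s, \<delta>) \<Rightarrow> (1/4)^5 * sign_det q s \<delta>)" for z
        by (cases z) (simp add: D_def sign_det_def *)
    qed (auto simp: fun_eq_iff)
    also have "ennreal \<dots> \<le> (\<integral>\<^sup>+\<omega>. ennreal \<bar>D (\<lambda>i. fst (\<omega> i)) (\<lambda>i. snd (\<omega> i))\<bar>
     \<partial>Pi\<^sub>M UNIV (\<lambda>_. cot_measure \<Otimes>\<^sub>M cot_measure))"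
      unfolding D_def by (rule nn_integral_abs_det_quadrants)
    finally show "(\<Sum>s\<in>G. ennreal ((1/4)^5) * ennreal (\<Sum>\<delta>\<in>UNIV. sign_det q s \<delta>)) \<le>
       (\<integral>\<^sup>+\<omega>. ennreal \<bar>det (\<chi> i j. jacobian_row (line_x (q i)) (line_y (q i)) (fst (\<omega> i)) (snd (\<omega> i)) j)\<bar>
     \<partial>Pi\<^sub>M UNIV (\<lambda>_. cot_measure \<Otimes>\<^sub>M cot_measure))"
      by (simp add: D_def)
  qed
  finally show ?thesis .
qed

text \<open>The right side is 80 / pi^4 * (1 + 4 / (5 pi)), about 1.03; with 3.2 in place of pi it
  is still about 0.95.\<close>

lemma jacobian_bound_ge: "0.93 \<le> 8 / pi\<^sup>2 * jacobian_bound"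
proof -
  have pi: "pi \<le> 3.2" using pi_approx(2) by simp
  have "0.93 \<le> 80 / 3.2 ^ 4 * (1 + 4 / (5 * 3.2 :: real))" by (simp add: field_simps)
  also have "\<dots> \<le> 80 / pi ^ 4 * (1 + 4 / (5 * pi))"
    by (intro mult_mono add_left_mono divide_left_mono power_mono pi mult_left_mono) auto
  also have "\<dots> = 8 / pi\<^sup>2 * jacobian_bound"
    by (simp add: jacobian_bound_def eval_nat_numeral)
  finally show ?thesis .
qed

section \<open>The change of variables on small boxes\<close>

definition sym_box :: "real \<Rightarrow> (real^'n) set" where
  "sym_box h = cbox (\<chi> i. - h) (\<chi> i. h)"

lemma mem_sym_box: "x \<in> sym_box h \<longleftrightarrow> (\<forall>i. \<bar>x $ i\<bar> \<le> h)"
  by (auto simp: sym_box_def mem_box_cart abs_le_iff minus_le_iff)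

lemma measure_sym_box: "0 \<le> h \<Longrightarrow> measure lebesgue (sym_box h :: (real^'n) set) = (2 * h) ^ CARD('n)"
proof -
  assume h: "0 \<le> h"
  have "cbox (\<chi> i::'n. - h) (\<chi> i. h) \<noteq> {}"
    using h by (auto simp: set_eq_iff mem_box_cart intro!: exI[of _ 0])
  then show ?thesis by (simp add: sym_box_def content_cbox_cart)
qed

lemma sym_box_subset_ball:
  assumes "0 < r"
  obtains d where "0 < d" "\<And>h. h \<le> d \<Longrightarrow> (sym_box h :: (real^'n) set) \<subseteq> ball 0 r"
proof -
  define d where "d = r / (2 * real CARD('n))"
  have "0 < d" using assms by (simp add: d_def)
  moreover have "x \<in> ball 0 r" if "h \<le> d" "x \<in> sym_box h" for h and x :: "real^'n"
  proof -
    have "norm x \<le> (\<Sum>i\<in>UNIV. \<bar>x $ i\<bar>)" by (rule norm_le_l1_cart)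
    also have "\<dots> \<le> (\<Sum>i\<in>(UNIV::'n set). d)" using that by (intro sum_mono) (meson mem_sym_box order_trans)
    also have "\<dots> < r" using assms by (simp add: d_def)
    finally show ?thesis by simp
  qed
  ultimately show ?thesis using that by blast
qed

lemma continuous_on_det [continuous_intros]:
  fixes A :: "'a::topological_space \<Rightarrow> real^'n^'n"
  assumes "continuous_on S A"
  shows "continuous_on S (\<lambda>x. det (A x))"
  unfolding det_def using assms by (intro continuous_intros)

text \<open>\<open>f\<close> is injective near 0 because its derivative there is invertible and
  depends continuously on the point; so the measure of the image of a small box is the integral of
  the absolute Jacobian. The strict inequality for \<open>c\<close> leaves room to replace density
  and Jacobian by constants on the box.\<close>

lemma eventually_image_sym_box_integral:
  fixes f :: "real^'n::{finite,wellorder} \<Rightarrow> real^'n::_" and J :: "real^'n::_ \<Rightarrow> real^'n::_^'n::_" and \<rho> :: "real^'n::_ \<Rightarrow> real"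
  assumes S: "open S" "0 \<in> S"
    and der: "\<And>x. x \<in> S \<Longrightarrow> (f has_derivative (\<lambda>h. J x *v h)) (at x)"
    and J: "continuous_on S J"
    and \<rho>: "continuous_on UNIV \<rho>" "\<And>x. 0 \<le> \<rho> x"
    and c: "0 \<le> c" "c < \<rho> (f 0) * \<bar>det (J 0)\<bar>"
  shows "\<forall>\<^sub>F h in at_right 0. sym_box h \<subseteq> S \<and>
    ennreal (c * (2 * h) ^ CARD('n::_)) \<le> (\<integral>\<^sup>+y. ennreal (\<rho> y) * indicator (f ` sym_box h) y \<partial>lborel)"
proof -
  have "0 < \<rho> (f 0) * \<bar>det (J 0)\<bar>" using c by linarith
  then have pos: "0 < \<rho> (f 0)" "0 < \<bar>det (J 0)\<bar>"
    using \<rho>(2)[of "f 0"] by (auto simp: zero_less_mult_iff)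
  \<comment> \<open>Both factors are shrunk by the same t < 1, taken close to 1.\<close>
  obtain a b where ab: "0 \<le> a" "a < \<rho> (f 0)" "0 \<le> b" "b < \<bar>det (J 0)\<bar>" "c \<le> a * b"
  proof -
    have "((\<lambda>t. (t * \<rho> (f 0)) * (t * \<bar>det (J 0)\<bar>)) \<longlongrightarrow> (1 * \<rho> (f 0)) * (1 * \<bar>det (J 0)\<bar>)) (at_left 1)"
      by (intro tendsto_intros)
    then have "\<forall>\<^sub>F t in at_left 1. c < (t * \<rho> (f 0)) * (t * \<bar>det (J 0)\<bar>)"
      using c by (auto simp: order_tendsto_iff)
    moreover have "\<forall>\<^sub>F t in at_left (1::real). t \<in> {0<..<1}"
      by (rule eventually_at_left_real) simp
    ultimately have "\<forall>\<^sub>F t in at_left 1. c < (t * \<rho> (f 0)) * (t * \<bar>det (J 0)\<bar>) \<and> t \<in> {0<..<1}"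
      by (rule eventually_conj)
    then obtain t where "c < (t * \<rho> (f 0)) * (t * \<bar>det (J 0)\<bar>)" "t \<in> {0<..<1}"
      using eventually_happens'[of "at_left (1::real)"] by (auto simp: trivial_limit_at_left_real)
    then show ?thesis using pos by (intro that[of "t * \<rho> (f 0)" "t * \<bar>det (J 0)\<bar>"]) auto
  qed
  obtain B where B: "B ** J 0 = mat 1"
    using pos(2) invertible_det_nz[of "J 0"] by (auto simp: invertible_def)
  obtain r0 where r0: "0 < r0" "ball 0 r0 \<subseteq> S" "inj_on f (ball 0 r0)"
  proof (rule has_derivative_locally_injective[of 0 S "\<lambda>v. B *v v" "\<lambda>x h. J x *v h" f])
    show "(\<lambda>v. B *v v) \<circ> (*v) (J 0) = id"
      by (auto simp: fun_eq_iff matrix_vector_mul_assoc B)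
    fix e :: real assume "0 < e"
    \<comment> \<open>Entries bounded by e' give an operator norm of at most n^2 * e' = e /
      2.\<close>
    define e' where "e' = e / (2 * (real CARD('n::_) * real CARD('n::_)))"
    have "0 < e'" using \<open>0 < e\<close> by (simp add: e'_def)
    have "continuous (at 0) J" using J S by (metis at_within_open continuous_on_eq_continuous_within)
    then obtain d where d: "0 < d" "\<And>x. dist x 0 < d \<Longrightarrow> dist (J x) (J 0) < e'"
      using \<open>0 < e'\<close> unfolding continuous_at_eps_delta by meson
    have "onorm (\<lambda>v. J x *v v - J 0 *v v) < e" if "dist 0 x < d" for x
    proof -
      have "norm (J x - J 0) < e'" using d(2)[of x] that by (simp add: dist_norm)
      then have "\<bar>(J x - J 0) $ i $ j\<bar> \<le> e'" for i j
        by (meson component_le_norm_cart Finite_Cartesian_Product.norm_nth_le less_imp_le order_trans)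
      then have "onorm ((*v) (J x - J 0)) \<le> real CARD('n::_) * real CARD('n::_) * e'"
        by (rule onorm_le_matrix_component)
      also have "\<dots> < e" using \<open>0 < e\<close> by (simp add: e'_def)
      also have "(*v) (J x - J 0) = (\<lambda>v. J x *v v - J 0 *v v)"
        by (simp add: fun_eq_iff matrix_vector_mult_diff_rdistrib)
      finally show ?thesis .
    qed
    then show "\<exists>d>0. \<forall>x. dist 0 x < d \<longrightarrow> onorm (\<lambda>v. J x *v v - J 0 *v v) < e"
      using d(1) by blast
  qed (use S der in \<open>auto intro: matrix_vector_mul_bounded_linear\<close>)
  have contf: "continuous_on S f"
    using der by (meson continuous_at_imp_continuous_on has_derivative_continuous)
  have "open (S \<inter> (\<lambda>x. \<bar>det (J x)\<bar>) -` {b<..})"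
    using S J by (intro continuous_open_preimage continuous_intros) auto
  moreover have "open (S \<inter> (\<lambda>x. \<rho> (f x)) -` {a<..})"
    using S contf by (intro continuous_open_preimage continuous_on_compose2[OF \<rho>(1)]) auto
  ultimately have "open (S \<inter> (\<lambda>x. \<bar>det (J x)\<bar>) -` {b<..} \<inter> (S \<inter> (\<lambda>x. \<rho> (f x)) -` {a<..}))"
    by (rule open_Int)
  then obtain r1 where r1: "0 < r1" "ball 0 r1 \<subseteq> S \<inter> (\<lambda>x. \<bar>det (J x)\<bar>) -` {b<..} \<inter> (S \<inter> (\<lambda>x. \<rho> (f x)) -` {a<..})"
    using S ab open_contains_ball[of "S \<inter> (\<lambda>x. \<bar>det (J x)\<bar>) -` {b<..} \<inter> (S \<inter> (\<lambda>x. \<rho> (f x)) -` {a<..})"]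
    by (metis IntI greaterThan_iff vimageI)
  obtain d where d: "0 < d" "\<And>h. h \<le> d \<Longrightarrow> (sym_box h :: (real^'n::_) set) \<subseteq> ball 0 (min r0 r1)"
    using sym_box_subset_ball[of "min r0 r1"] r0(1) r1(1) by auto
  have "sym_box h \<subseteq> S \<and>
    ennreal (c * (2 * h) ^ CARD('n::_)) \<le> (\<integral>\<^sup>+y. ennreal (\<rho> y) * indicator (f ` sym_box h) y \<partial>lborel)"
    if h: "0 < h" "h < d" for h
  proof
    define K where "K = (sym_box h :: (real^'n::_) set)"
    have K: "K \<subseteq> ball 0 r0" "K \<subseteq> ball 0 r1" using d(2)[of h] h by (auto simp: K_def)
    have KS: "K \<subseteq> S" using K r0(2) by blast
    then show "sym_box h \<subseteq> S" by (simp add: K_def)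
    have comp: "compact K" by (simp add: K_def sym_box_def)
    have Kb: "b < \<bar>det (J x)\<bar>" "a < \<rho> (f x)" if "x \<in> K" for x using K(2) r1(2) that by auto
    have cfK: "compact (f ` K)"
      using comp contf KS by (intro compact_continuous_image continuous_on_subset[OF contf]) auto
    then have meas: "f ` K \<in> sets borel" "f ` K \<in> lmeasurable"
      by (simp_all add: borel_closed compact_imp_closed lmeasurable_compact)
    have int: "(\<lambda>x. \<bar>det (J x)\<bar>) integrable_on K"
      unfolding K_def sym_box_def
      by (intro integrable_continuous continuous_intros continuous_on_subset[OF J])
        (use KS in \<open>simp add: K_def sym_box_def\<close>)
    have "measure lebesgue (f ` K) = integral K (\<lambda>x. \<bar>det (matrix (\<lambda>h. J x *v h))\<bar>)"
    proof (rule measure_differentiable_image_eq)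
      show "K \<in> sets lebesgue" using comp by (simp add: lmeasurable_compact fmeasurableD)
      show "(f has_derivative (\<lambda>h. J x *v h)) (at x within K)" if "x \<in> K" for x
        using der[of x] KS that by (auto intro: has_derivative_at_withinI)
      show "inj_on f K" using r0(3) K(1) by (rule inj_on_subset)
      show "(\<lambda>x. \<bar>det (matrix (\<lambda>h. J x *v h))\<bar>) integrable_on K" using int by simp
    qed
    also have "\<dots> \<ge> integral K (\<lambda>x. b)"
      using int Kb(1) by (intro integral_le) (auto simp: K_def sym_box_def less_imp_le intro!: integrable_const)
    finally have m: "b * (2 * h) ^ CARD('n::_) \<le> measure lebesgue (f ` K)"
      using measure_sym_box[of h, where 'n = 'n] h by (simp add: K_def sym_box_def mult.commute)
    have "ennreal (c * (2 * h) ^ CARD('n::_)) \<le> ennreal (a * measure lebesgue (f ` K))"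
    proof (rule ennreal_leI)
      have "c * (2 * h) ^ CARD('n::_) \<le> (a * b) * (2 * h) ^ CARD('n::_)" using ab h by (intro mult_right_mono) auto
      also have "\<dots> \<le> a * measure lebesgue (f ` K)" using m ab by (simp add: mult.assoc mult_left_mono)
      finally show "c * (2 * h) ^ CARD('n::_) \<le> a * measure lebesgue (f ` K)" .
    qed
    also have "\<dots> = ennreal a * emeasure lborel (f ` K)"
      using meas ab emeasure_compact_finite[OF cfK] emeasure_eq_ennreal_measure[of lborel "f ` K"]
      by (simp add: ennreal_mult)
    also have "\<dots> = (\<integral>\<^sup>+y. ennreal a * indicator (f ` K) y \<partial>lborel)"
      using meas by (simp add: nn_integral_cmult_indicator)
    also have "\<dots> \<le> (\<integral>\<^sup>+y. ennreal (\<rho> y) * indicator (f ` K) y \<partial>lborel)"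
      using Kb(2) by (intro nn_integral_mono) (auto split: split_indicator intro!: ennreal_leI order.strict_implies_order[of a])
    finally show "ennreal (c * (2 * h) ^ CARD('n::_)) \<le> (\<integral>\<^sup>+y. ennreal (\<rho> y) * indicator (f ` sym_box h) y \<partial>lborel)"
      by (simp add: K_def)
  qed
  then show ?thesis
    using d(1) unfolding eventually_at_right_field by (intro exI[of _ d]) auto
qed

section \<open>A chart of the essential variety\<close>

text \<open>The gradient is a function, so that its continuity can be required. Closure under the
  arithmetic operations yields some continuous gradient of the chart equations; its value is
  computed at 0 alone.\<close>

definition C1_with :: "('a::euclidean_space \<Rightarrow> real) \<Rightarrow> ('a \<Rightarrow> 'a) \<Rightarrow> bool" where
  "C1_with f g \<longleftrightarrow> (\<forall>x. (f has_derivative (\<lambda>h. g x \<bullet> h)) (at x)) \<and> continuous_on UNIV g"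

definition C1 :: "('a::euclidean_space \<Rightarrow> real) \<Rightarrow> bool" where
  "C1 f \<longleftrightarrow> (\<exists>g. C1_with f g)"

lemma C1_with_continuous: "C1_with f g \<Longrightarrow> continuous_on UNIV f"
  unfolding C1_with_def by (meson continuous_at_imp_continuous_on has_derivative_continuous)

lemma C1_const: "C1 (\<lambda>x. c)"
  unfolding C1_def C1_with_def by (intro exI[of _ "\<lambda>_. 0"]) (auto intro!: derivative_eq_intros)

lemma C1_inner: "C1 (\<lambda>x. v \<bullet> x)"
  unfolding C1_def C1_with_def by (intro exI[of _ "\<lambda>_. v"]) (auto intro!: derivative_eq_intros)

lemma C1_nth: "C1 (\<lambda>x::real^'n. x $ i)"
  using C1_inner[of "axis i (1::real) :: real^'n"] by (simp add: inner_axis')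

lemma C1_add: "C1 f \<Longrightarrow> C1 g \<Longrightarrow> C1 (\<lambda>x. f x + g x)"
  unfolding C1_def
proof (elim exE)
  fix f' g' assume "C1_with f f'" "C1_with g g'"
  then show "\<exists>h. C1_with (\<lambda>x. f x + g x) h"
    unfolding C1_with_def
    by (intro exI[of _ "\<lambda>x. f' x + g' x"])
      (auto simp: inner_add_left intro!: derivative_eq_intros continuous_intros)
qed

lemma C1_mult: "C1 f \<Longrightarrow> C1 g \<Longrightarrow> C1 (\<lambda>x. f x * g x)"
  unfolding C1_def
proof (elim exE)
  fix f' g' assume *: "C1_with f f'" "C1_with g g'"
  then show "\<exists>h. C1_with (\<lambda>x. f x * g x) h"
    using *[THEN C1_with_continuous] unfolding C1_with_def
    by (intro exI[of _ "\<lambda>x. f x *\<^sub>R g' x + g x *\<^sub>R f' x"])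
      (auto simp: inner_add_left algebra_simps intro!: derivative_eq_intros continuous_intros)
qed

lemma C1_compose:
  assumes \<phi>: "\<And>t. (\<phi> has_real_derivative \<phi>' t) (at t)" "continuous_on UNIV \<phi>'" and f: "C1 f"
  shows "C1 (\<lambda>x. \<phi> (f x))"
proof -
  obtain g where g: "C1_with f g" using f by (auto simp: C1_def)
  have "((\<lambda>x. \<phi> (f x)) has_derivative (\<lambda>h. (\<phi>' (f x) *\<^sub>R g x) \<bullet> h)) (at x)" for x
    using has_derivative_compose[of f "\<lambda>h. g x \<bullet> h" x UNIV \<phi> "(*) (\<phi>' (f x))"] g \<phi>(1)[of "f x"]
    by (simp add: C1_with_def has_field_derivative_def)
  moreover have "continuous_on UNIV (\<lambda>x. \<phi>' (f x) *\<^sub>R g x)"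
    using g C1_with_continuous[OF g] unfolding C1_with_def
    by (intro continuous_intros continuous_on_compose2[OF \<phi>(2)]) auto
  ultimately show ?thesis
    unfolding C1_def C1_with_def by (intro exI[of _ "\<lambda>x. \<phi>' (f x) *\<^sub>R g x"] conjI allI)
qed

lemma C1_sin: "C1 f \<Longrightarrow> C1 (\<lambda>x. sin (f x))" and C1_cos: "C1 f \<Longrightarrow> C1 (\<lambda>x. cos (f x))"
  by (rule C1_compose[where \<phi> = sin and \<phi>' = cos] C1_compose[where \<phi> = cos and \<phi>' = "\<lambda>x. - sin x"];
      auto intro!: derivative_eq_intros continuous_intros)+

lemma C1_minus: "C1 f \<Longrightarrow> C1 (\<lambda>x. - f x)"
  using C1_mult[OF C1_const[of "-1"]] by simp

lemma C1_sum: "finite I \<Longrightarrow> (\<And>i. i \<in> I \<Longrightarrow> C1 (f i)) \<Longrightarrow> C1 (\<lambda>x. \<Sum>i\<in>I. f i x)"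
  by (induction I rule: finite_induct) (auto intro: C1_const C1_add)

lemmas C1_intros = C1_const C1_nth C1_add C1_mult C1_sin C1_cos C1_minus C1_sum

section \<open>Rotations and the five-parameter chart\<close>

definition rot_x :: "real \<Rightarrow> real^3^3" where
  "rot_x a = vector [vector [1, 0, 0], vector [0, cos a, - sin a], vector [0, sin a, cos a]]"

definition rot_y :: "real \<Rightarrow> real^3^3" where
  "rot_y a = vector [vector [cos a, 0, sin a], vector [0, 1, 0], vector [- sin a, 0, cos a]]"

definition rot_z :: "real \<Rightarrow> real^3^3" where
  "rot_z a = vector [vector [cos a, - sin a, 0], vector [sin a, cos a, 0], vector [0, 0, 1]]"

definition proj_xy :: "real^3^3" where
  "proj_xy = vector [vector [1, 0, 0], vector [0, 1, 0], vector [0, 0, 0]]"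

text \<open>Parameters 4 and 5 tilt the left kernel, 2 and 3 the right kernel, and 1 turns about the
  third axis. The signs of the angles make all five partial derivatives at 0 equal to minus the
  entries of \<open>jacobian_row\<close>.\<close>

definition left_frame :: "real^5 \<Rightarrow> real^3^3" where
  "left_frame \<xi> = rot_x (- \<xi> $ 4) ** rot_y (- \<xi> $ 5)"

definition right_frame :: "real^5 \<Rightarrow> real^3^3" where
  "right_frame \<xi> = rot_y (- \<xi> $ 2) ** rot_x (\<xi> $ 3)"

definition essential_chart :: "real^5 \<Rightarrow> real^3^3" where
  "essential_chart \<xi> = left_frame \<xi> ** (proj_xy ** rot_z (\<xi> $ 1)) ** right_frame \<xi>"

lemma C1_essential_chart: "C1 (\<lambda>\<xi>. essential_chart \<xi> $ i $ j)"
proof -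
  have mul: "\<forall>i j. C1 (\<lambda>\<xi>. (A \<xi> ** B \<xi>) $ i $ j)" if "\<forall>i j. C1 (\<lambda>\<xi>. A \<xi> $ i $ j)" "\<forall>i j. C1 (\<lambda>\<xi>. B \<xi> $ i $ j)"
    for A B :: "real^5 \<Rightarrow> real^3^3"
    using that by (auto simp: matrix_matrix_mult_def intro!: C1_intros)
  have rot: "\<forall>i j. C1 (\<lambda>\<xi>. rot_x (f \<xi>) $ i $ j)" "\<forall>i j. C1 (\<lambda>\<xi>. rot_y (f \<xi>) $ i $ j)" "\<forall>i j. C1 (\<lambda>\<xi>. rot_z (f \<xi>) $ i $ j)"
    if "C1 f" for f :: "real^5 \<Rightarrow> real"
    using that by (auto simp: forall_3 rot_x_def rot_y_def rot_z_def intro!: C1_intros)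
  have "\<forall>i j. C1 (\<lambda>\<xi>. essential_chart \<xi> $ i $ j)"
    unfolding essential_chart_def left_frame_def right_frame_def
    by (intro mul rot C1_minus C1_nth allI C1_const)
  then show ?thesis by blast
qed

lemma C1_bilinear_chart: "C1 (\<lambda>\<xi>. u \<bullet> (essential_chart \<xi> *v w))"
  unfolding inner_vec_def matrix_vector_mult_def
  by (auto intro!: C1_intros C1_essential_chart)

lemma rot_0 [simp]: "rot_x 0 = mat 1" "rot_y 0 = mat 1" "rot_z 0 = mat 1"
  by (simp_all add: rot_x_def rot_y_def rot_z_def vec_eq_iff forall_3 mat_def)

text \<open>Along a coordinate axis only one of the five rotations differs from the identity, so the
  equation becomes an explicit trigonometric function of \<open>t\<close>. Uniqueness of the
  derivative identifies the component of the gradient.\<close>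

lemma gradient_bilinear_chart:
  assumes ab: "a\<^sup>2 + b\<^sup>2 = 1"
    and N: "C1_with (\<lambda>\<xi>. vector [a, b, x] \<bullet> (essential_chart \<xi> *v vector [- b, a, y])) N"
  shows "N 0 $ j = - jacobian_row a b x y j"
proof -
  define f where "f \<xi> = vector [a, b, x] \<bullet> (essential_chart \<xi> *v vector [- b, a, y])" for \<xi>
  have aabb: "b * b = 1 - a * a" using ab by (simp add: power2_eq_square)
  have "((\<lambda>t. f (t *\<^sub>R axis j 1)) has_real_derivative N 0 \<bullet> axis j 1) (at 0)"
  proof -
    have "((\<lambda>t. t *\<^sub>R (axis j 1 :: real^5)) has_derivative (\<lambda>h. h *\<^sub>R axis j 1)) (at 0)"
      by (auto intro!: derivative_eq_intros)
    moreover have "(f has_derivative (\<lambda>h. N 0 \<bullet> h)) (at (0 *\<^sub>R axis j 1))"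
      using N using f_def[abs_def] by (simp add: C1_with_def)
    ultimately show ?thesis
      using has_derivative_compose[of "\<lambda>t. t *\<^sub>R (axis j 1 :: real^5)" "\<lambda>h. h *\<^sub>R axis j 1" 0 UNIV f "\<lambda>h. N 0 \<bullet> h"]
      by (simp add: has_field_derivative_def mult_commute_abs)
  qed
  moreover have "((\<lambda>t. f (t *\<^sub>R axis j 1)) has_real_derivative - jacobian_row a b x y j) (at 0)"
  proof -
    consider "j = 1" | "j = 2" | "j = 3" | "j = 4" | "j = 5" using exhaust_5 by blast
    then show ?thesis
    proof cases
      case 1
      then have "essential_chart (t *\<^sub>R axis j 1) = proj_xy ** rot_z t" for t
        by (simp add: essential_chart_def left_frame_def right_frame_def axis_def)
      then have "f (t *\<^sub>R axis j 1) = - sin t * (a * a + b * b)" for t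
        by (simp add: f_def rot_z_def proj_xy_def inner_vec_def matrix_vector_mult_def
          matrix_matrix_mult_def sum_3 algebra_simps)
      then show ?thesis using 1 aabb by (auto simp: jacobian_row_def intro!: derivative_eq_intros)
    next
      case 2
      then have "essential_chart (t *\<^sub>R axis j 1) = proj_xy ** rot_y (- t)" for t
        by (simp add: essential_chart_def left_frame_def right_frame_def axis_def)
      then have "f (t *\<^sub>R axis j 1) = a * (- b * cos t - sin t * y) + a * b" for t
        using aabb by (simp add: f_def rot_y_def proj_xy_def inner_vec_def matrix_vector_mult_def
          matrix_matrix_mult_def sum_3 algebra_simps)
      then show ?thesis using 2 by (auto simp: jacobian_row_def intro!: derivative_eq_intros)
    next
      case 3
      then have "essential_chart (t *\<^sub>R axis j 1) = proj_xy ** rot_x t" for t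
        by (simp add: essential_chart_def left_frame_def right_frame_def axis_def)
      then have "f (t *\<^sub>R axis j 1) = - a * b + b * (a * cos t - y * sin t)" for t
        using aabb by (simp add: f_def rot_x_def proj_xy_def inner_vec_def matrix_vector_mult_def
          matrix_matrix_mult_def sum_3 algebra_simps)
      then show ?thesis using 3 by (auto simp: jacobian_row_def intro!: derivative_eq_intros)
    next
      case 4
      then have "essential_chart (t *\<^sub>R axis j 1) = rot_x (- t) ** proj_xy" for t
        by (simp add: essential_chart_def left_frame_def right_frame_def axis_def)
      then have "f (t *\<^sub>R axis j 1) = - a * b + b * (a * cos t) - x * (a * sin t)" for t
        using aabb by (simp add: f_def rot_x_def proj_xy_def inner_vec_def matrix_vector_mult_def
          matrix_matrix_mult_def sum_3 algebra_simps)
      then show ?thesis using 4 by (auto simp: jacobian_row_def intro!: derivative_eq_intros)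
    next
      case 5
      then have "essential_chart (t *\<^sub>R axis j 1) = rot_y (- t) ** proj_xy" for t
        by (simp add: essential_chart_def left_frame_def right_frame_def axis_def)
      then have "f (t *\<^sub>R axis j 1) = - a * b * cos t + b * a - x * (b * sin t)" for t
        using aabb by (simp add: f_def rot_y_def proj_xy_def inner_vec_def matrix_vector_mult_def
          matrix_matrix_mult_def sum_3 algebra_simps)
      then show ?thesis using 5 by (auto simp: jacobian_row_def intro!: derivative_eq_intros)
    qed
  qed
  ultimately have "N 0 \<bullet> axis j 1 = - jacobian_row a b x y j" by (rule DERIV_unique)
  then show ?thesis by (simp add: inner_axis)
qed

text \<open>The coordinates are adapted to the centre of the chart: \<open>left_point q x \<bullet> (proj_xy *v right_point q y p)\<close>
  equals \<open>p\<close>.\<close>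

definition left_point :: "real \<Rightarrow> real \<Rightarrow> real^3" where
  "left_point q x = vector [line_x q, line_y q, x]"

definition right_point :: "real \<Rightarrow> real \<Rightarrow> real \<Rightarrow> real^3" where
  "right_point q y p = vector [p * line_x q - line_y q, p * line_y q + line_x q, y]"

lemma has_derivative_vecI:
  fixes f :: "'a::euclidean_space \<Rightarrow> real^'n"
  assumes "\<And>i. ((\<lambda>x. f x $ i) has_derivative (\<lambda>h. f' h $ i)) (at x)"
  shows "(f has_derivative f') (at x)"
  using assms by (subst has_derivative_componentwise_within) (auto simp: Basis_vec_def inner_axis)

text \<open>Equation i is affine in \<open>p $ i\<close>, namely A p + N = 0, with A = 1 and N = 0
  at the chart centre. Near 0 it is solved by f = - N / A, so the solvable \<open>p\<close> contain
  the image of the box under f. The derivative of f at 0 is minus the gradient of N, which is the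
  matrix of \<open>jacobian_row\<close>.\<close>

lemma eventually_solvable_slice:
  fixes q :: "5 \<Rightarrow> real" and \<omega> :: "5 \<Rightarrow> real \<times> real" and \<rho> :: "real^5 \<Rightarrow> real"
  assumes \<rho>: "continuous_on UNIV \<rho>" "\<And>p. 0 \<le> \<rho> p"
    and c: "0 \<le> c" "c < \<rho> 0 * \<bar>det (\<chi> i j. jacobian_row (line_x (q i)) (line_y (q i)) (fst (\<omega> i)) (snd (\<omega> i)) j)\<bar>"
  shows "\<forall>\<^sub>F h in at_right 0. ennreal (c * (2 * h) ^ 5) \<le>
    (\<integral>\<^sup>+p. ennreal (\<rho> p) * indicator {p. \<exists>\<xi>\<in>sym_box h. \<forall>i.
       left_point (q i) (fst (\<omega> i)) \<bullet> (essential_chart \<xi> *v right_point (q i) (snd (\<omega> i)) (p $ i)) = 0} p \<partial>lborel)"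
proof -
  define u where "u i = left_point (q i) (fst (\<omega> i))" for i
  define w where "w i = (vector [- line_y (q i), line_x (q i), snd (\<omega> i)] :: real^3)" for i
  define o1 where "o1 i = (vector [line_x (q i), line_y (q i), 0] :: real^3)" for i
  define A where "A i \<xi> = u i \<bullet> (essential_chart \<xi> *v o1 i)" for i \<xi>
  define N where "N i \<xi> = u i \<bullet> (essential_chart \<xi> *v w i)" for i \<xi>
  have rp: "right_point (q i) (snd (\<omega> i)) p = p *\<^sub>R o1 i + w i" for i p
    by (simp add: right_point_def o1_def w_def vec_eq_iff forall_3)
  have "\<forall>i. \<exists>g. C1_with (A i) g" "\<forall>i. \<exists>g. C1_with (N i) g"
    using C1_bilinear_chart by (simp_all add: A_def[abs_def] N_def[abs_def] C1_def)
  then obtain A' N' where A': "\<And>i. C1_with (A i) (A' i)" and N': "\<And>i. C1_with (N i) (N' i)"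
    by (auto dest!: choice)
  define S where "S = {\<xi>. \<forall>i. A i \<xi> \<noteq> 0}"
  define f where "f \<xi> = (\<chi> i. - (N i \<xi> / A i \<xi>))" for \<xi>
  define J where "J \<xi> = (\<chi> i. (N i \<xi> / (A i \<xi>)\<^sup>2) *\<^sub>R A' i \<xi> - (1 / A i \<xi>) *\<^sub>R N' i \<xi>)" for \<xi>
  have lu: "line_x (q i) * line_x (q i) + line_y (q i) * line_y (q i) = 1" for i
    using line_unit[of "q i"] by (simp add: power2_eq_square)
  have E0: "essential_chart 0 = proj_xy"
    by (simp add: essential_chart_def left_frame_def right_frame_def)
  have A0: "A i 0 = 1" for i
    using lu[of i] by (simp add: A_def E0 u_def left_point_def o1_def proj_xy_def inner_vec_def matrix_vector_mult_def sum_3)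
  have N0: "N i 0 = 0" for i
    by (simp add: N_def E0 u_def left_point_def w_def proj_xy_def inner_vec_def matrix_vector_mult_def sum_3)
  have S0: "0 \<in> S" by (simp add: S_def A0)
  have cA: "continuous_on UNIV (A i)" and cN: "continuous_on UNIV (N i)" for i
    using A' N' C1_with_continuous by blast+
  have cA': "continuous_on UNIV (A' i)" and cN': "continuous_on UNIV (N' i)" for i
    using A' N' by (auto simp: C1_with_def)
  have "open (\<Inter>i. {\<xi>. A i \<xi> \<noteq> 0})"
    using cA by (intro open_INT ballI open_Collect_neq) auto
  also have "(\<Inter>i. {\<xi>. A i \<xi> \<noteq> 0}) = S" by (auto simp: S_def)
  finally have oS: "open S" .
  have der: "(f has_derivative (\<lambda>h. J \<xi> *v h)) (at \<xi>)" if "\<xi> \<in> S" for \<xi>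
  proof -
    have "((\<lambda>\<xi>. - (N i \<xi> / A i \<xi>)) has_derivative (\<lambda>h. ((N i \<xi> / (A i \<xi>)\<^sup>2) *\<^sub>R A' i \<xi> - (1 / A i \<xi>) *\<^sub>R N' i \<xi>) \<bullet> h)) (at \<xi>)" for i
    proof -
      have ne: "A i \<xi> \<noteq> 0" using that by (simp add: S_def)
      have "((\<lambda>\<xi>. N i \<xi> / A i \<xi>) has_derivative (\<lambda>h. ((N' i \<xi> \<bullet> h) * A i \<xi> - N i \<xi> * (A' i \<xi> \<bullet> h)) / (A i \<xi> * A i \<xi>))) (at \<xi>)"
        using N'[of i] A'[of i] ne unfolding C1_with_def by (intro has_derivative_divide') auto
      then have "((\<lambda>\<xi>. - (N i \<xi> / A i \<xi>)) has_derivative (\<lambda>h. - (((N' i \<xi> \<bullet> h) * A i \<xi> - N i \<xi> * (A' i \<xi> \<bullet> h)) / (A i \<xi> * A i \<xi>)))) (at \<xi>)"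
        by (rule has_derivative_minus)
      moreover have "- ((a * x - n * b) / (x * x)) = n / x\<^sup>2 * b - (1 / x) * a" if "x \<noteq> 0" for a b n x :: real
        using that by (simp add: field_simps power2_eq_square)
      ultimately show ?thesis
        using ne by (simp add: inner_diff_left mult.commute)
    qed
    then show ?thesis
      by (intro has_derivative_vecI) (simp add: f_def J_def matrix_vector_mul_component)
  qed
  have cJ: "continuous_on S J"
    unfolding J_def
    by (intro continuous_on_vec_lambda continuous_intros continuous_on_subset[OF cA] continuous_on_subset[OF cN]
        continuous_on_subset[OF cA'] continuous_on_subset[OF cN']) (auto simp: S_def)
  have J0: "J 0 = (\<chi> i j. jacobian_row (line_x (q i)) (line_y (q i)) (fst (\<omega> i)) (snd (\<omega> i)) j)"
  proof -
    have "N' i 0 $ j = - jacobian_row (line_x (q i)) (line_y (q i)) (fst (\<omega> i)) (snd (\<omega> i)) j" for i j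
    proof (rule gradient_bilinear_chart[OF line_unit])
      have "N i = (\<lambda>\<xi>. vector [line_x (q i), line_y (q i), fst (\<omega> i)] \<bullet>
          (essential_chart \<xi> *v vector [- line_y (q i), line_x (q i), snd (\<omega> i)]))"
        by (simp add: N_def[abs_def] u_def left_point_def w_def)
      then show "C1_with (\<lambda>\<xi>. vector [line_x (q i), line_y (q i), fst (\<omega> i)] \<bullet>
          (essential_chart \<xi> *v vector [- line_y (q i), line_x (q i), snd (\<omega> i)])) (N' i)"
        using N'[of i] by simp
    qed
    then show ?thesis by (simp add: J_def A0 N0 vec_eq_iff)
  qed
  have f0: "f 0 = 0" by (simp add: f_def N0 vec_eq_iff)
  have "\<forall>\<^sub>F h in at_right 0. sym_box h \<subseteq> S \<and>
      ennreal (c * (2 * h) ^ CARD(5)) \<le> (\<integral>\<^sup>+y. ennreal (\<rho> y) * indicator (f ` sym_box h) y \<partial>lborel)"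
    by (rule eventually_image_sym_box_integral[OF oS S0 der cJ \<rho> c(1)]) (use c(2) in \<open>simp_all add: f0 J0\<close>)
  then show ?thesis
  proof eventually_elim
    case (elim h)
    have "f ` sym_box h \<subseteq> {p. \<exists>\<xi>\<in>sym_box h. \<forall>i. left_point (q i) (fst (\<omega> i)) \<bullet> (essential_chart \<xi> *v right_point (q i) (snd (\<omega> i)) (p $ i)) = 0}"
    proof safe
      fix \<xi> :: "real^5" assume \<xi>: "\<xi> \<in> sym_box h"
      then have ne: "A i \<xi> \<noteq> 0" for i using elim by (auto simp: S_def)
      have bil: "u i \<bullet> (essential_chart \<xi> *v (p *\<^sub>R o1 i + w i)) = p * A i \<xi> + N i \<xi>" for i p
        by (simp add: A_def N_def matrix_vector_right_distrib matrix_vector_mult_scaleR inner_add_right)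
      have "\<forall>i. left_point (q i) (fst (\<omega> i)) \<bullet> (essential_chart \<xi> *v right_point (q i) (snd (\<omega> i)) (f \<xi> $ i)) = 0"
      proof
        fix i
        have "u i \<bullet> (essential_chart \<xi> *v (f \<xi> $ i *\<^sub>R o1 i + w i)) = f \<xi> $ i * A i \<xi> + N i \<xi>" by (rule bil)
        also have "\<dots> = 0" using ne by (simp add: f_def)
        finally show "left_point (q i) (fst (\<omega> i)) \<bullet> (essential_chart \<xi> *v right_point (q i) (snd (\<omega> i)) (f \<xi> $ i)) = 0"
          by (simp only: rp u_def)
      qed
      then show "\<exists>\<xi>'\<in>sym_box h. \<forall>i. left_point (q i) (fst (\<omega> i)) \<bullet> (essential_chart \<xi>' *v right_point (q i) (snd (\<omega> i)) (f \<xi> $ i)) = 0"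
        using \<xi> by blast
    qed
    then have le: "(\<integral>\<^sup>+y. ennreal (\<rho> y) * indicator (f ` sym_box h) y \<partial>lborel) \<le>
      (\<integral>\<^sup>+p. ennreal (\<rho> p) * indicator {p. \<exists>\<xi>\<in>sym_box h. \<forall>i. left_point (q i) (fst (\<omega> i)) \<bullet> (essential_chart \<xi> *v right_point (q i) (snd (\<omega> i)) (p $ i)) = 0} p \<partial>lborel)"
      by (intro nn_integral_mono mult_left_mono) (auto simp: indicator_def)
    have "ennreal (c * (2 * h) ^ 5) \<le> (\<integral>\<^sup>+y. ennreal (\<rho> y) * indicator (f ` sym_box h) y \<partial>lborel)"
      using elim by simp
    then show ?case using le by (rule order_trans)
  qed
qed

section \<open>Haar measure on the orthogonal group\<close>

lemma O3_iff: "U \<in> O3 \<longleftrightarrow> transpose U ** U = mat 1 \<and> U ** transpose U = mat 1"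
  by (simp add: O3_def orthogonal_matrix_def)

lemma O3_transpose: "U \<in> O3 \<Longrightarrow> transpose U \<in> O3"
  by (simp add: O3_iff)

lemma O3_mult: "U \<in> O3 \<Longrightarrow> V \<in> O3 \<Longrightarrow> U ** V \<in> O3"
  by (simp add: O3_def orthogonal_matrix_mul)

lemma O3_det: "U \<in> O3 \<Longrightarrow> \<bar>det U\<bar> = 1"
  using det_orthogonal_matrix[of U] by (auto simp: O3_def)

lemma continuous_on_matrix_mult [continuous_intros]:
  fixes A B :: "'a::topological_space \<Rightarrow> real^'n^'n"
  assumes "continuous_on S A" "continuous_on S B"
  shows "continuous_on S (\<lambda>x. A x ** B x)"
  unfolding matrix_matrix_mult_def using assms by (intro continuous_intros continuous_on_vec_lambda)

lemma continuous_on_matrix_vector_mult [continuous_intros]: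
  fixes A :: "'a::topological_space \<Rightarrow> real^'m^'n"
  assumes "continuous_on S A" "continuous_on S v"
  shows "continuous_on S (\<lambda>x. A x *v v x)"
  unfolding matrix_vector_mult_def using assms by (intro continuous_intros continuous_on_vec_lambda)

lemma continuous_on_transpose [continuous_intros]:
  fixes A :: "'a::topological_space \<Rightarrow> real^'m^'n"
  assumes "continuous_on S A"
  shows "continuous_on S (\<lambda>x. transpose (A x))"
  unfolding transpose_def using assms by (intro continuous_intros continuous_on_vec_lambda)

lemma borel_measurable_matrix_mult [measurable]:
  fixes f g :: "'a \<Rightarrow> real^'n^'n"
  assumes "f \<in> borel_measurable M" "g \<in> borel_measurable M"
  shows "(\<lambda>x. f x ** g x) \<in> borel_measurable M"
  using assms by (rule borel_measurable_continuous_Pair) (intro continuous_intros)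

lemma borel_measurable_matrix_vector_mult [measurable]:
  fixes f :: "'a \<Rightarrow> real^'m^'n" and g :: "'a \<Rightarrow> real^'m"
  assumes "f \<in> borel_measurable M" "g \<in> borel_measurable M"
  shows "(\<lambda>x. f x *v g x) \<in> borel_measurable M"
  using assms by (rule borel_measurable_continuous_Pair) (intro continuous_intros)

lemma borel_measurable_transpose [measurable]:
  fixes f :: "'a \<Rightarrow> real^'m^'n"
  assumes "f \<in> borel_measurable M"
  shows "(\<lambda>x. transpose (f x)) \<in> borel_measurable M"
  by (rule measurable_compose[OF assms], rule borel_measurable_continuous_onI) (intro continuous_intros)

locale haar_O3 =
  fixes \<mu> :: "(real^3^3) measure"
  assumes haar: "normalized_haar_O3 \<mu>"
begin

sublocale prob_space \<mu>
  using haar by (simp add: normalized_haar_O3_def)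

lemma sets_haar [measurable_cong]: "sets \<mu> = sets (restrict_space borel O3)"
  using haar by (simp add: normalized_haar_O3_def)

lemma space_haar [simp]: "space \<mu> = O3"
  using sets_eq_imp_space_eq[OF sets_haar] by (simp add: space_restrict_space)

lemma borel_measurable_haar: "f \<in> measurable borel N \<Longrightarrow> f \<in> measurable \<mu> N"
  using measurable_restrict_space1[of f borel N O3] measurable_cong_sets[OF sets_haar refl, of N] by blast

lemma id_measurable_haar [measurable]: "(\<lambda>U. U) \<in> measurable \<mu> borel"
  by (rule borel_measurable_haar) simp

lemma haar_left:
  assumes [measurable]: "f \<in> borel_measurable borel" and Q: "Q \<in> O3"
  shows "(\<integral>\<^sup>+U. f (Q ** U) \<partial>\<mu>) = (\<integral>\<^sup>+U. f U \<partial>\<mu>)"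
proof -
  have m: "(\<lambda>U. Q ** U) \<in> measurable \<mu> \<mu>"
    unfolding measurable_cong_sets[OF refl sets_haar]
    by (rule measurable_restrict_space2) (auto intro: O3_mult[OF Q])
  have "(\<integral>\<^sup>+U. f U \<partial>\<mu>) = (\<integral>\<^sup>+U. f U \<partial>distr \<mu> \<mu> (\<lambda>U. Q ** U))"
    using haar Q by (simp add: normalized_haar_O3_def)
  also have "\<dots> = (\<integral>\<^sup>+U. f (Q ** U) \<partial>\<mu>)"
    by (rule nn_integral_distr[OF m]) (simp add: borel_measurable_haar)
  finally show ?thesis by simp
qed

text \<open>Both sides equal the double integral of \<open>f (V\<^sup>T U)\<close>.\<close>

lemma haar_transpose:
  assumes [measurable]: "f \<in> borel_measurable borel"
  shows "(\<integral>\<^sup>+U. f (transpose U) \<partial>\<mu>) = (\<integral>\<^sup>+U. f U \<partial>\<mu>)"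
proof -
  interpret P: pair_sigma_finite \<mu> \<mu> by standard
  have "(\<integral>\<^sup>+U. f U \<partial>\<mu>) = (\<integral>\<^sup>+V. \<integral>\<^sup>+U. f (transpose V ** U) \<partial>\<mu> \<partial>\<mu>)"
  proof -
    have "(\<integral>\<^sup>+V. \<integral>\<^sup>+U. f (transpose V ** U) \<partial>\<mu> \<partial>\<mu>) = (\<integral>\<^sup>+V. (\<integral>\<^sup>+U. f U \<partial>\<mu>) \<partial>\<mu>)"
      by (intro nn_integral_cong haar_left O3_transpose) auto
    then show ?thesis by (simp add: emeasure_space_1[simplified])
  qed
  also have "\<dots> = (\<integral>\<^sup>+U. \<integral>\<^sup>+V. f (transpose V ** U) \<partial>\<mu> \<partial>\<mu>)"
    by (rule P.Fubini') measurable
  also have "\<dots> = (\<integral>\<^sup>+U. \<integral>\<^sup>+V. f (transpose (transpose U ** V)) \<partial>\<mu> \<partial>\<mu>)"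
    by (simp add: matrix_transpose_mul)
  also have "\<dots> = (\<integral>\<^sup>+U. (\<integral>\<^sup>+V. f (transpose V) \<partial>\<mu>) \<partial>\<mu>)"
    by (intro nn_integral_cong haar_left[where f = "\<lambda>V. f (transpose V)"] O3_transpose) auto
  also have "\<dots> = (\<integral>\<^sup>+V. f (transpose V) \<partial>\<mu>)"
    by (simp add: emeasure_space_1[simplified])
  finally show ?thesis by simp
qed

text \<open>Transposition preserves the measure and exchanges right and left translations.\<close>

lemma haar_right:
  assumes [measurable]: "f \<in> borel_measurable borel" and Q: "Q \<in> O3"
  shows "(\<integral>\<^sup>+U. f (U ** Q) \<partial>\<mu>) = (\<integral>\<^sup>+U. f U \<partial>\<mu>)"
proof -
  have "(\<integral>\<^sup>+U. f (U ** Q) \<partial>\<mu>) = (\<integral>\<^sup>+U. f (transpose U ** Q) \<partial>\<mu>)"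
    by (rule haar_transpose[symmetric, of "\<lambda>U. f (U ** Q)"]) measurable
  also have "\<dots> = (\<integral>\<^sup>+U. f (transpose (transpose Q ** U)) \<partial>\<mu>)"
    by (simp add: matrix_transpose_mul)
  also have "\<dots> = (\<integral>\<^sup>+U. f (transpose U) \<partial>\<mu>)"
    by (rule haar_left[of "\<lambda>U. f (transpose U)"]) (use O3_transpose[OF Q] in auto)
  also have "\<dots> = (\<integral>\<^sup>+U. f U \<partial>\<mu>)"
    by (rule haar_transpose) measurable
  finally show ?thesis .
qed

end

definition pivot :: "real^3 \<Rightarrow> real" where
  "pivot w = (if w $ 1 \<noteq> 0 then w $ 1 else if w $ 2 \<noteq> 0 then w $ 2 else w $ 3)"

text \<open>The representative of a projective point whose first nonzero coordinate is 1. It turns laws on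
  the projective plane, where no coordinates are available, into laws on \<open>real^3\<close>.\<close>

definition nrm :: "real^3 \<Rightarrow> real^3" where "nrm w = (1 / pivot w) *\<^sub>R w"

lemma nth_measurable [measurable]: "(\<lambda>w::real^'n. w $ i) \<in> borel_measurable borel"
  by (rule borel_measurable_continuous_onI) (intro continuous_intros)

lemma nrm_measurable [measurable]: "nrm \<in> borel_measurable borel"
  unfolding nrm_def pivot_def by measurable

lemma pivot_nonzero: "w \<noteq> 0 \<Longrightarrow> pivot w \<noteq> 0"
  by (auto simp: pivot_def vec_eq_iff forall_3)

lemma nrm_scaleR: "c \<noteq> 0 \<Longrightarrow> nrm (c *\<^sub>R w) = nrm w"
  by (auto simp: nrm_def pivot_def)

lemma nrm_eq_scaleR: "w \<noteq> 0 \<Longrightarrow> \<exists>c. c \<noteq> 0 \<and> nrm w = c *\<^sub>R w"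
  using pivot_nonzero[of w] by (intro exI[of _ "1 / pivot w"]) (auto simp: nrm_def)

lemma O3_exists_axis:
  assumes "w \<noteq> (0::real^3)"
  obtains Q where "Q \<in> O3" "w = norm w *\<^sub>R (Q *v axis 3 1)"
proof -
  obtain A where "rotation_matrix A" "A *v axis 3 1 = (1 / norm w) *\<^sub>R w"
    using rotation_matrix_exists_basis[of "(1 / norm w) *\<^sub>R w" 3] assms by auto
  then show ?thesis using assms by (intro that[of A]) (auto simp: rotation_matrix_def O3_def)
qed

lemma O3_mult_nonzero: "U \<in> O3 \<Longrightarrow> w \<noteq> 0 \<Longrightarrow> U *v w \<noteq> 0"
  using orthogonal_mult_eq_0 by blast

context haar_O3
begin

definition direction_law :: "(real^3) measure" where
  "direction_law = distr \<mu> borel (\<lambda>U. nrm (U *v axis 3 1))"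

text \<open>An orthogonal matrix carries axis 3 to the direction of \<open>w\<close>, and right
  invariance removes it.\<close>

lemma direction_law_eq:
  assumes "w \<noteq> 0"
  shows "direction_law = distr \<mu> borel (\<lambda>U. nrm (U *v w))"
proof (rule measure_eqI)
  fix A assume "A \<in> sets direction_law"
  then have [measurable]: "A \<in> sets borel" by (simp add: direction_law_def)
  obtain Q where Q: "Q \<in> O3" "w = norm w *\<^sub>R (Q *v axis 3 1)" using O3_exists_axis[OF assms] .
  have e: "emeasure (distr \<mu> borel (\<lambda>U. nrm (U *v v))) A = (\<integral>\<^sup>+U. indicator A (nrm (U *v v)) \<partial>\<mu>)" for v
    by (subst nn_integral_indicator[symmetric], simp, subst nn_integral_distr) auto
  have "nrm (U *v w) = nrm ((U ** Q) *v axis 3 1)" for U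
    by (subst Q(2)) (use assms in \<open>simp add: matrix_vector_mult_scaleR nrm_scaleR matrix_vector_mul_assoc\<close>)
  then show "emeasure direction_law A = emeasure (distr \<mu> borel (\<lambda>U. nrm (U *v w))) A"
    unfolding direction_law_def e
    using haar_right[of "\<lambda>U. indicator A (nrm (U *v axis 3 1))" Q] Q(1) by simp
qed (simp add: direction_law_def)

lemma prob_space_direction_law: "prob_space direction_law"
  unfolding direction_law_def by (rule prob_space_distr) measurable

lemma sets_direction_law [simp, measurable_cong]: "sets direction_law = sets borel"
  by (simp add: direction_law_def)

text \<open>Averaging over U replaces x by U x without changing the integral; after the integrals
  are exchanged, the inner one is \<open>direction_law\<close> for every x other than 0. Any
  invariant law with a convenient density can thus be used to compute with uniform
  directions.\<close>

lemma direction_law_unique: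
  assumes "prob_space \<nu>" and s [simp, measurable_cong]: "sets \<nu> = sets borel" and "emeasure \<nu> {0} = 0"
    and inv: "\<And>Q f. Q \<in> O3 \<Longrightarrow> f \<in> borel_measurable borel \<Longrightarrow> (\<integral>\<^sup>+x. f (Q *v x) \<partial>\<nu>) = (\<integral>\<^sup>+x. f x \<partial>\<nu>)"
  shows "distr \<nu> borel nrm = direction_law"
proof (rule measure_eqI)
  fix A assume "A \<in> sets (distr \<nu> borel nrm)"
  then have [measurable]: "A \<in> sets borel" by simp
  interpret N: prob_space \<nu> by fact
  interpret P: pair_sigma_finite \<nu> \<mu> by standard
  have "emeasure (distr \<nu> borel nrm) A = (\<integral>\<^sup>+x. indicator A (nrm x) \<partial>\<nu>)"
    by (subst nn_integral_indicator[symmetric], simp, subst nn_integral_distr) auto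
  also have "\<dots> = (\<integral>\<^sup>+U. (\<integral>\<^sup>+x. indicator A (nrm x) \<partial>\<nu>) \<partial>\<mu>)"
    by (simp add: emeasure_space_1[simplified])
  also have "\<dots> = (\<integral>\<^sup>+U. (\<integral>\<^sup>+x. indicator A (nrm (U *v x)) \<partial>\<nu>) \<partial>\<mu>)"
    by (intro nn_integral_cong inv[symmetric, where f = "\<lambda>x. indicator A (nrm x)"]) auto
  also have "\<dots> = (\<integral>\<^sup>+x. (\<integral>\<^sup>+U. indicator A (nrm (U *v x)) \<partial>\<mu>) \<partial>\<nu>)"
    by (rule P.Fubini') measurable
  also have "\<dots> = (\<integral>\<^sup>+x. emeasure direction_law A \<partial>\<nu>)"
  proof (rule nn_integral_cong_AE)
    have "{0} \<in> null_sets \<nu>" using assms(3) by (simp add: null_sets_def)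
    then have "AE x in \<nu>. x \<noteq> 0" by (rule AE_I') auto
    then show "AE x in \<nu>. (\<integral>\<^sup>+U. indicator A (nrm (U *v x)) \<partial>\<mu>) = emeasure direction_law A"
    proof eventually_elim
      case (elim x)
      show ?case
        unfolding direction_law_eq[OF elim]
        by (subst nn_integral_indicator[symmetric], simp, subst nn_integral_distr) auto
    qed
  qed
  also have "\<dots> = emeasure direction_law A"
    using N.emeasure_space_1 by simp
  finally show "emeasure (distr \<nu> borel nrm) A = emeasure direction_law A" .
qed simp

end

section \<open>The uniform direction in affine coordinates\<close>

lemma vector_3_measurable [measurable]:
  "f \<in> borel_measurable M \<Longrightarrow> g \<in> borel_measurable M \<Longrightarrow> h \<in> borel_measurable M \<Longrightarrow>
   (\<lambda>x. vector [f x, g x, h x] :: real^3) \<in> borel_measurable M"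
proof (subst borel_measurable_euclidean_space, rule ballI)
  fix b :: "real^3" assume *: "f \<in> borel_measurable M" "g \<in> borel_measurable M" "h \<in> borel_measurable M" "b \<in> Basis"
  then obtain i where "b = axis i 1" by (auto simp: Basis_vec_def)
  moreover have "(\<lambda>x. (vector [f x, g x, h x] :: real^3) $ i) \<in> borel_measurable M"
    using exhaust_3[of i] * by auto
  ultimately show "(\<lambda>x. vector [f x, g x, h x] \<bullet> b) \<in> borel_measurable M"
    by (simp add: inner_axis)
qed

text \<open>The second coordinate is placed outermost because \<open>nn_integral_ball_chart\<close>
  fixes it in each slice and rescales the other two.\<close>

lemma lborel_vec3:
  "distr (lborel :: (real \<times> real \<times> real) measure) borel (\<lambda>p. vector [fst (snd p), fst p, snd (snd p)]) = (lborel :: (real^3) measure)"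
proof (rule lborel_eqI[symmetric])
  let ?v = "\<lambda>p::real \<times> real \<times> real. vector [fst (snd p), fst p, snd (snd p)] :: real^3"
  have m: "?v \<in> borel_measurable lborel"
    by (intro vector_3_measurable) (auto intro!: borel_measurable_continuous_onI continuous_intros)
  fix l u :: "real^3" assume le: "\<And>b. b \<in> Basis \<Longrightarrow> l \<bullet> b \<le> u \<bullet> b"
  have le': "l $ i \<le> u $ i" for i
    using le[of "axis i 1"] by (simp add: axis_in_Basis_iff inner_axis)
  have im: "?v -` box l u = {l $ 2<..<u $ 2} \<times> {l $ 1<..<u $ 1} \<times> {l $ 3<..<u $ 3}"
    by (auto simp: mem_box_cart forall_3)
  have "emeasure (distr lborel borel ?v) (box l u) = emeasure lborel ({l $ 2<..<u $ 2} \<times> {l $ 1<..<u $ 1} \<times> {l $ 3<..<u $ 3})"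
    by (subst emeasure_distr[OF m]) (simp_all add: im)
  also have "\<dots> = ennreal ((u $ 2 - l $ 2) * ((u $ 1 - l $ 1) * (u $ 3 - l $ 3)))"
  proof -
    have "emeasure (lborel :: (real \<times> real) measure) ({l $ 1<..<u $ 1} \<times> {l $ 3<..<u $ 3}) =
      ennreal (u $ 1 - l $ 1) * ennreal (u $ 3 - l $ 3)"
      using le' by (simp add: lborel_prod[symmetric] lborel.emeasure_pair_measure_Times)
    moreover have "emeasure (lborel :: (real \<times> real \<times> real) measure) ({l $ 2<..<u $ 2} \<times> {l $ 1<..<u $ 1} \<times> {l $ 3<..<u $ 3}) =
      ennreal (u $ 2 - l $ 2) * emeasure (lborel :: (real \<times> real) measure) ({l $ 1<..<u $ 1} \<times> {l $ 3<..<u $ 3})"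
      using le' by (subst lborel_prod[symmetric], subst lborel.emeasure_pair_measure_Times)
        (auto intro!: borel_open open_Times)
    ultimately show ?thesis
      using le' by (simp add: ennreal_mult)
  qed
  also have "(u $ 2 - l $ 2) * ((u $ 1 - l $ 1) * (u $ 3 - l $ 3)) = (\<Prod>b\<in>Basis. (u - l) \<bullet> b)"
  proof -
    have B: "(Basis :: (real^3) set) = (\<lambda>i. axis i 1) ` UNIV" by (auto simp: Basis_vec_def)
    have "(\<Prod>b\<in>Basis. (u - l) \<bullet> b) = (\<Prod>i\<in>UNIV. (u - l) $ i)"
      unfolding B by (subst prod.reindex) (auto simp: inj_on_def axis_eq_axis inner_axis)
    also have "(\<Prod>i\<in>(UNIV :: 3 set). (u - l) $ i) = (u $ 1 - l $ 1) * ((u $ 2 - l $ 2) * (u $ 3 - l $ 3))"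
      unfolding UNIV_3 by simp
    finally show ?thesis by (simp only: mult.left_commute)
  qed
  finally show "emeasure (distr lborel borel ?v) (box l u) = ennreal (\<Prod>b\<in>Basis. (u - l) \<bullet> b)" .
qed simp

lemma nn_integral_lborel_vec3:
  fixes f :: "real^3 \<Rightarrow> ennreal"
  assumes [measurable]: "f \<in> borel_measurable borel"
  shows "(\<integral>\<^sup>+x. f x \<partial>lborel) = (\<integral>\<^sup>+b. \<integral>\<^sup>+a. \<integral>\<^sup>+c. f (vector [a, b, c]) \<partial>lborel \<partial>lborel \<partial>lborel)"
proof -
  have m: "(\<lambda>p::real \<times> real \<times> real. vector [fst (snd p), fst p, snd (snd p)] :: real^3) \<in> borel_measurable borel"
    by (intro vector_3_measurable) (auto intro!: borel_measurable_continuous_onI continuous_intros)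
  have m': "(\<lambda>r::real \<times> real. vector [fst r, b, snd r] :: real^3) \<in> borel_measurable borel" for b
    by (intro vector_3_measurable) (auto intro!: borel_measurable_continuous_onI continuous_intros)
  note fm = measurable_compose[OF m assms] measurable_compose[OF m' assms]
  have "(\<integral>\<^sup>+x. f x \<partial>lborel) = (\<integral>\<^sup>+p. f (vector [fst (snd p), fst p, snd (snd p)]) \<partial>(lborel :: (real \<times> real \<times> real) measure))"
    using m by (simp add: lborel_vec3[symmetric] nn_integral_distr)
  also have "\<dots> = (\<integral>\<^sup>+b. \<integral>\<^sup>+r. f (vector [fst r, b, snd r]) \<partial>lborel \<partial>lborel)"
    using lborel.nn_integral_fst[of "\<lambda>p. f (vector [fst (snd p), fst p, snd (snd p)])" lborel] fm
    by (simp add: lborel_prod)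
  also have "\<dots> = (\<integral>\<^sup>+b. \<integral>\<^sup>+a. \<integral>\<^sup>+c. f (vector [a, b, c]) \<partial>lborel \<partial>lborel \<partial>lborel)"
    using lborel.nn_integral_fst[of "\<lambda>r. f (vector [fst r, _, snd r])" lborel] fm
    by (simp add: lborel_prod)
  finally show ?thesis .
qed

lemma lborel_orthogonal_invariant:
  fixes f :: "real^3 \<Rightarrow> ennreal"
  assumes Q: "Q \<in> O3" and [measurable]: "f \<in> borel_measurable borel"
  shows "(\<integral>\<^sup>+x. f (Q *v x) \<partial>lborel) = (\<integral>\<^sup>+x. f x \<partial>lborel)"
proof -
  have "(lborel :: (real^3) measure) = distr lborel borel (\<lambda>x. Q *v x)"
  proof (rule lborel_eqI)
    fix l u :: "real^3" assume le: "\<And>b. b \<in> Basis \<Longrightarrow> l \<bullet> b \<le> u \<bullet> b"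
    obtain P where T: "P ** Q = mat 1" "Q ** P = mat 1" "\<bar>det P\<bar> = 1"
      using Q O3_det[OF O3_transpose[OF Q]] by (auto simp: O3_iff)
    have im: "(\<lambda>x. Q *v x) -` box l u = (\<lambda>x. P *v x) ` box l u"
    proof (intro set_eqI iffI)
      fix x assume "x \<in> (\<lambda>x. Q *v x) -` box l u"
      then show "x \<in> (\<lambda>x. P *v x) ` box l u"
        by (intro image_eqI[of _ _ "Q *v x"]) (simp_all add: matrix_vector_mul_assoc T)
    qed (auto simp: matrix_vector_mul_assoc T)
    have lm: "(\<lambda>x. P *v x) ` box l u \<in> lmeasurable \<and>
        measure lebesgue ((\<lambda>x. P *v x) ` box l u) = measure lebesgue (box l u)"
      using measurable_linear_image[of "\<lambda>x. P *v x" "box l u"]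
        measure_linear_image[of "\<lambda>x. P *v x" "box l u"] T(3)
      by (simp add: matrix_vector_mul_linear)
    have "emeasure (distr lborel borel (\<lambda>x. Q *v x)) (box l u) = emeasure lebesgue ((\<lambda>x. P *v x) ` box l u)"
    proof -
      have "(\<lambda>x. Q *v x) -` box l u \<in> sets borel"
        by (rule measurable_sets_borel[OF borel_measurable_matrix_vector_mult]) auto
      then show ?thesis by (subst emeasure_distr) (auto simp: im)
    qed
    also have "\<dots> = emeasure lebesgue (box l u)"
      using lm by (simp add: emeasure_eq_measure2)
    finally show "emeasure (distr lborel borel (\<lambda>x. Q *v x)) (box l u) = ennreal (\<Prod>b\<in>Basis. (u - l) \<bullet> b)"
      using le by (simp add: emeasure_lborel_box)
  qed simp
  then have "(\<integral>\<^sup>+x. f x \<partial>lborel) = (\<integral>\<^sup>+x. f x \<partial>distr lborel borel (\<lambda>x. Q *v x))" by simp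
  also have "\<dots> = (\<integral>\<^sup>+x. f (Q *v x) \<partial>lborel)" by (rule nn_integral_distr) auto
  finally show ?thesis by simp
qed

text \<open>The uniform law on the unit ball: invariant under O(3) and absolutely continuous, so
  uniform directions can be computed in coordinates without a surface measure.\<close>

definition ball_measure :: "(real^3) measure" where
  "ball_measure = density lborel (\<lambda>x. ennreal (3 / (4 * pi)) * indicator (ball 0 1) x)"

lemma sets_ball_measure [simp, measurable_cong]: "sets ball_measure = sets borel"
  by (simp add: ball_measure_def)

lemma nn_integral_ball_measure:
  assumes [measurable]: "f \<in> borel_measurable borel"
  shows "(\<integral>\<^sup>+x. f x \<partial>ball_measure) = ennreal (3 / (4 * pi)) * (\<integral>\<^sup>+x. indicator (ball 0 1) x * f x \<partial>lborel)"
proof -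
  have [measurable]: "ball (0::real^3) 1 \<in> sets borel" by simp
  show ?thesis
    unfolding ball_measure_def
    by (subst nn_integral_density, measurable)
      (subst nn_integral_cmult[symmetric], measurable, simp add: mult.assoc)
qed

lemma emeasure_unit_ball_3: "emeasure lborel (ball (0::real^3) 1) = ennreal (4 / 3 * pi)"
  using emeasure_ball[of 1 "0::real^3"] by (simp add: unit_ball_vol_3)

lemma prob_space_ball_measure: "prob_space ball_measure"
proof
  have "emeasure ball_measure (space ball_measure) = (\<integral>\<^sup>+x. 1 \<partial>ball_measure)" by simp
  also have "\<dots> = ennreal (3 / (4 * pi)) * ennreal (4 / 3 * pi)"
    by (subst nn_integral_ball_measure) (simp_all add: emeasure_unit_ball_3)
  also have "\<dots> = 1" by (simp flip: ennreal_mult)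
  finally show "emeasure ball_measure (space ball_measure) = 1" .
qed

lemma ball_measure_invariant:
  assumes Q: "Q \<in> O3" and [measurable]: "f \<in> borel_measurable borel"
  shows "(\<integral>\<^sup>+x. f (Q *v x) \<partial>ball_measure) = (\<integral>\<^sup>+x. f x \<partial>ball_measure)"
proof -
  have "norm (Q *v x) = norm x" for x
    using Q orthogonal_transformation_matrix[of "(*v) Q"]
    by (simp add: O3_def orthogonal_transformation)
  then have "(\<integral>\<^sup>+x. indicator (ball 0 1) x * f (Q *v x) \<partial>lborel) = (\<integral>\<^sup>+x. indicator (ball 0 1) (Q *v x) * f (Q *v x) \<partial>lborel)"
    by (simp add: indicator_def)
  also have "\<dots> = (\<integral>\<^sup>+x. indicator (ball 0 1) x * f x \<partial>lborel)"
    using Q by (rule lborel_orthogonal_invariant) (intro borel_measurable_times_ennreal borel_measurable_indicator, auto)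
  finally show ?thesis by (simp add: nn_integral_ball_measure)
qed

lemma nn_integral_power2_symmetric:
  assumes "0 < R"
  shows "(\<integral>\<^sup>+b. ennreal (b\<^sup>2) * indicator {-R<..<R} b \<partial>lborel) = ennreal (2 / 3 * R ^ 3)"
proof -
  have "(\<integral>\<^sup>+b. ennreal (b\<^sup>2) * indicator {-R<..<R} b \<partial>lborel) = (\<integral>\<^sup>+b. ennreal (b\<^sup>2) * indicator {-R..R} b \<partial>lborel)"
    by (rule nn_integral_cong_AE, rule AE_mp[OF AE_lborel_singleton[of R]], rule AE_mp[OF AE_lborel_singleton[of "-R"]], rule AE_I2)
      (auto split: split_indicator)
  also have "\<dots> = ennreal (R ^ 3 / 3 - (- R) ^ 3 / 3)"
    using assms by (intro nn_integral_FTC_Icc[of _ "-R" R "\<lambda>x. x ^ 3 / 3"]) (auto intro!: derivative_eq_intros)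
  finally show ?thesis by (simp add: power3_eq_cube mult.assoc)
qed

text \<open>The density of a uniform line through the origin in the affine chart
  \<open>(p, 1, y)\<close>, that is, of the central projection of the sphere to a plane.\<close>

definition chart_density :: "real \<Rightarrow> real \<Rightarrow> real" where
  "chart_density p y = 1 / (2 * pi * sqrt (1 + p\<^sup>2 + y\<^sup>2) ^ 3)"

lemma chart_density_nonneg [simp]: "0 \<le> chart_density p y"
  by (simp add: chart_density_def)

lemma chart_density_measurable [measurable]:
  assumes [measurable]: "f \<in> borel_measurable M" "g \<in> borel_measurable M"
  shows "(\<lambda>x. chart_density (f x) (g x)) \<in> borel_measurable M"
  unfolding chart_density_def by measurable

text \<open>Substitute x = b (p, 1, y), with Jacobian b^2. As \<open>f\<close> ignores b,
  integrating over |b| < R = 1 / sqrt (1 + p^2 + y^2) leaves 2/3 R^3, and the factor 3 / (4 pi)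
  turns this into \<open>chart_density\<close>.\<close>

lemma nn_integral_ball_chart:
  fixes f :: "real^3 \<Rightarrow> ennreal"
  assumes [measurable]: "f \<in> borel_measurable borel"
    and scale: "\<And>c w. c \<noteq> 0 \<Longrightarrow> f (c *\<^sub>R w) = f w"
  shows "(\<integral>\<^sup>+x. f x \<partial>ball_measure) = (\<integral>\<^sup>+y. \<integral>\<^sup>+p. ennreal (chart_density p y) * f (vector [p, 1, y]) \<partial>lborel \<partial>lborel)"
proof -
  define I where "I b p y = (indicator {z. b\<^sup>2 * z < 1} (1 + p\<^sup>2 + y\<^sup>2) :: ennreal)" for b p y :: real
  have [measurable]: "(\<lambda>x. I (u x) (v x) (w x)) \<in> borel_measurable M"
    if [measurable]: "u \<in> borel_measurable M" "v \<in> borel_measurable M" "w \<in> borel_measurable M" for u v w and M :: "'b measure"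
  proof -
    have "(\<lambda>x. I (u x) (v x) (w x)) = (\<lambda>x. if (u x)\<^sup>2 * (1 + (v x)\<^sup>2 + (w x)\<^sup>2) < 1 then 1 else 0)"
      by (auto simp: I_def indicator_def)
    then show ?thesis by simp
  qed
  define g where "g w = indicator (ball 0 1) w * f w" for w
  have gm [measurable]: "g \<in> borel_measurable borel"
    unfolding g_def by (intro borel_measurable_times_ennreal borel_measurable_indicator) auto
  have slice: "(\<integral>\<^sup>+a. \<integral>\<^sup>+c. g (vector [a, b, c]) \<partial>lborel \<partial>lborel) =
      (\<integral>\<^sup>+p. \<integral>\<^sup>+y. ennreal (b\<^sup>2) * (I b p y * f (vector [p, 1, y])) \<partial>lborel \<partial>lborel)" if b: "b \<noteq> 0" for b
  proof -
    have inner: "(\<integral>\<^sup>+c. g (vector [a, b, c]) \<partial>lborel) = ennreal \<bar>b\<bar> * (\<integral>\<^sup>+y. g (vector [a, b, b * y]) \<partial>lborel)" for a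
      using nn_integral_real_affine[of "\<lambda>c. g (vector [a, b, c])" b 0] b by simp
    have "(\<integral>\<^sup>+a. \<integral>\<^sup>+c. g (vector [a, b, c]) \<partial>lborel \<partial>lborel) =
      ennreal \<bar>b\<bar> * (\<integral>\<^sup>+p. \<integral>\<^sup>+c. g (vector [b * p, b, c]) \<partial>lborel \<partial>lborel)"
      using nn_integral_real_affine[of "\<lambda>a. \<integral>\<^sup>+c. g (vector [a, b, c]) \<partial>lborel" b 0] b by simp
    also have "\<dots> = (\<integral>\<^sup>+p. \<integral>\<^sup>+y. ennreal \<bar>b\<bar> * (ennreal \<bar>b\<bar> * g (vector [b * p, b, b * y])) \<partial>lborel \<partial>lborel)"
      unfolding inner by (simp add: nn_integral_cmult)
    also have "\<dots> = (\<integral>\<^sup>+p. \<integral>\<^sup>+y. ennreal (b\<^sup>2) * (I b p y * f (vector [p, 1, y])) \<partial>lborel \<partial>lborel)"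
    proof (intro nn_integral_cong)
      fix p y :: real
      have v: "vector [b * p, b, b * y] = b *\<^sub>R (vector [p, 1, y] :: real^3)"
        by (simp add: vec_eq_iff forall_3)
      have "(norm (vector [b * p, b, b * y] :: real^3))\<^sup>2 = b\<^sup>2 * (1 + p\<^sup>2 + y\<^sup>2)"
        by (simp only: power2_norm_eq_inner) (simp add: inner_vec_def sum_3 power2_eq_square algebra_simps)
      then have "norm (vector [b * p, b, b * y] :: real^3) < 1 \<longleftrightarrow> b\<^sup>2 * (1 + p\<^sup>2 + y\<^sup>2) < 1"
        by (metis abs_norm_cancel abs_square_less_1)
      then have "indicator (ball 0 1) (vector [b * p, b, b * y] :: real^3) = I b p y"
        by (simp add: I_def indicator_def)
      then show "ennreal \<bar>b\<bar> * (ennreal \<bar>b\<bar> * g (vector [b * p, b, b * y])) =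
          ennreal (b\<^sup>2) * (I b p y * f (vector [p, 1, y]))"
        using scale[OF b, of "vector [p, 1, y]"]
        by (simp add: g_def v mult.assoc[symmetric] power2_eq_square flip: ennreal_mult)
    qed
    finally show ?thesis .
  qed
  have "(\<integral>\<^sup>+x. indicator (ball 0 1) x * f x \<partial>lborel) =
    (\<integral>\<^sup>+b. \<integral>\<^sup>+a. \<integral>\<^sup>+c. g (vector [a, b, c]) \<partial>lborel \<partial>lborel \<partial>lborel)"
    using nn_integral_lborel_vec3[OF gm] by (simp only: g_def)
  also have "\<dots> = (\<integral>\<^sup>+b. \<integral>\<^sup>+p. \<integral>\<^sup>+y. ennreal (b\<^sup>2) * (I b p y * f (vector [p, 1, y])) \<partial>lborel \<partial>lborel \<partial>lborel)"
    by (rule nn_integral_cong_AE, rule AE_mp[OF AE_lborel_singleton[of 0]], rule AE_I2) (auto simp: slice)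
  also have "\<dots> = (\<integral>\<^sup>+p. \<integral>\<^sup>+b. \<integral>\<^sup>+y. ennreal (b\<^sup>2) * (I b p y * f (vector [p, 1, y])) \<partial>lborel \<partial>lborel \<partial>lborel)"
    by (rule lborel_pair.Fubini') measurable
  also have "\<dots> = (\<integral>\<^sup>+p. \<integral>\<^sup>+y. \<integral>\<^sup>+b. ennreal (b\<^sup>2) * (I b p y * f (vector [p, 1, y])) \<partial>lborel \<partial>lborel \<partial>lborel)"
    by (intro nn_integral_cong lborel_pair.Fubini') measurable
  also have "\<dots> = (\<integral>\<^sup>+y. \<integral>\<^sup>+p. \<integral>\<^sup>+b. ennreal (b\<^sup>2) * (I b p y * f (vector [p, 1, y])) \<partial>lborel \<partial>lborel \<partial>lborel)"
    by (rule lborel_pair.Fubini') measurable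
  also have "\<dots> = (\<integral>\<^sup>+y. \<integral>\<^sup>+p. ennreal (4 / 3 * pi) * (ennreal (chart_density p y) * f (vector [p, 1, y])) \<partial>lborel \<partial>lborel)"
  proof (intro nn_integral_cong)
    fix p y :: real
    define R where "R = 1 / sqrt (1 + p\<^sup>2 + y\<^sup>2)"
    have s: "0 < 1 + p\<^sup>2 + y\<^sup>2" by (simp add: add_pos_nonneg)
    then have R: "0 < R" "R\<^sup>2 = 1 / (1 + p\<^sup>2 + y\<^sup>2)" by (simp_all add: R_def power_divide)
    have I: "I b p y = indicator {-R<..<R} b" for b
    proof -
      have "b\<^sup>2 * (1 + p\<^sup>2 + y\<^sup>2) < 1 \<longleftrightarrow> b\<^sup>2 < R\<^sup>2" using s by (simp add: R(2) pos_less_divide_eq)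
      also have "\<dots> \<longleftrightarrow> \<bar>b\<bar> < R" using R(1) by (metis abs_of_pos real_sqrt_abs real_sqrt_less_iff)
      finally show ?thesis by (auto simp: I_def indicator_def abs_less_iff)
    qed
    have "(\<integral>\<^sup>+b. ennreal (b\<^sup>2) * (I b p y * f (vector [p, 1, y])) \<partial>lborel) =
      (\<integral>\<^sup>+b. ennreal (b\<^sup>2) * indicator {-R<..<R} b \<partial>lborel) * f (vector [p, 1, y])"
      by (simp add: I mult.assoc[symmetric] nn_integral_multc)
    also have "\<dots> = ennreal (4 / 3 * pi * chart_density p y) * f (vector [p, 1, y])"
      using R(1) by (simp add: nn_integral_power2_symmetric R_def chart_density_def power_divide)
    also have "ennreal (4 / 3 * pi * chart_density p y) = ennreal (4 / 3 * pi) * ennreal (chart_density p y)"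
      by (rule ennreal_mult) auto
    finally show "(\<integral>\<^sup>+b. ennreal (b\<^sup>2) * (I b p y * f (vector [p, 1, y])) \<partial>lborel) =
       ennreal (4 / 3 * pi) * (ennreal (chart_density p y) * f (vector [p, 1, y]))"
      by (simp only: mult.assoc)
  qed
  also have "\<dots> = ennreal (4 / 3 * pi) * (\<integral>\<^sup>+y. \<integral>\<^sup>+p. ennreal (chart_density p y) * f (vector [p, 1, y]) \<partial>lborel \<partial>lborel)"
    by (simp add: nn_integral_cmult)
  finally have "(\<integral>\<^sup>+x. indicator (ball 0 1) x * f x \<partial>lborel) =
    ennreal (4 / 3 * pi) * (\<integral>\<^sup>+y. \<integral>\<^sup>+p. ennreal (chart_density p y) * f (vector [p, 1, y]) \<partial>lborel \<partial>lborel)" .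
  then show ?thesis
    by (simp add: nn_integral_ball_measure mult.assoc[symmetric] flip: ennreal_mult)
qed

text \<open>The quotient of \<open>chart_density\<close> by \<open>cot_density\<close>. It is not a
  conditional density: its integral over \<open>p\<close> is 2 / pi * sqrt (1 + y^2). The split is
  made so that \<open>y\<close> is integrated against \<open>cot_measure\<close> and the weight at
  \<open>p = 0\<close> is 1 / pi for every \<open>y\<close>.\<close>

definition slice_density :: "real \<Rightarrow> real \<Rightarrow> real" where
  "slice_density y p = (sqrt (1 + y\<^sup>2) / sqrt (1 + p\<^sup>2 + y\<^sup>2)) ^ 3 / pi"

lemma slice_density_nonneg [simp]: "0 \<le> slice_density y p"
  by (simp add: slice_density_def)

lemma slice_density_0 [simp]: "slice_density y 0 = 1 / pi"
  by (simp add: slice_density_def)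

lemma slice_density_measurable [measurable]:
  assumes [measurable]: "f \<in> borel_measurable M" "g \<in> borel_measurable M"
  shows "(\<lambda>x. slice_density (f x) (g x)) \<in> borel_measurable M"
  unfolding slice_density_def by measurable

lemma chart_density_slice: "chart_density p y = cot_density y * slice_density y p"
  by (simp add: chart_density_def cot_density_def slice_density_def power_divide)

lemma left_point_measurable [measurable]:
  assumes [measurable]: "f \<in> borel_measurable M" "g \<in> borel_measurable M"
  shows "(\<lambda>z. left_point (f z) (g z)) \<in> borel_measurable M"
  unfolding left_point_def line_x_def line_y_def by measurable

lemma right_point_measurable [measurable]:
  assumes [measurable]: "f \<in> borel_measurable M" "g \<in> borel_measurable M" "h \<in> borel_measurable M"
  shows "(\<lambda>z. right_point (f z) (g z) (h z)) \<in> borel_measurable M"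
  unfolding right_point_def line_x_def line_y_def by measurable

context haar_O3
begin

lemma direction_law_ball: "distr ball_measure borel nrm = direction_law"
proof (rule direction_law_unique)
  have "emeasure ball_measure {0} = (\<integral>\<^sup>+x. indicator {0} x \<partial>ball_measure)" by simp
  also have "\<dots> = 0"
  proof -
    have "(\<integral>\<^sup>+x. indicator (ball 0 1) x * indicator {0::real^3} x \<partial>lborel) = (\<integral>\<^sup>+x. indicator {0::real^3} x \<partial>lborel)"
      by (intro nn_integral_cong) (auto split: split_indicator)
    then show ?thesis by (subst nn_integral_ball_measure) auto
  qed
  finally show "emeasure ball_measure {0} = 0" .
qed (auto simp: prob_space_ball_measure ball_measure_invariant)

lemma nn_integral_direction_law_chart:
  assumes [measurable]: "f \<in> borel_measurable borel" and P: "P \<in> O3"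
  shows "(\<integral>\<^sup>+x. f x \<partial>direction_law) =
    (\<integral>\<^sup>+y. \<integral>\<^sup>+p. ennreal (chart_density p y) * f (nrm (P *v vector [p, 1, y])) \<partial>lborel \<partial>lborel)"
proof -
  have "(\<integral>\<^sup>+x. f x \<partial>direction_law) = (\<integral>\<^sup>+x. f (nrm x) \<partial>ball_measure)"
    unfolding direction_law_ball[symmetric] by (rule nn_integral_distr) auto
  also have "\<dots> = (\<integral>\<^sup>+x. f (nrm (P *v x)) \<partial>ball_measure)"
    by (rule ball_measure_invariant[OF P, symmetric]) measurable
  also have "\<dots> = (\<integral>\<^sup>+y. \<integral>\<^sup>+p. ennreal (chart_density p y) * f (nrm (P *v vector [p, 1, y])) \<partial>lborel \<partial>lborel)"
    by (rule nn_integral_ball_chart) (auto simp: matrix_vector_mult_scaleR nrm_scaleR)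
  finally show ?thesis .
qed

text \<open>The matrix P turns (p, 1, y) into \<open>right_point q y p\<close>, so by invariance the
  right side has the same value for every \<open>q\<close>. This permits reusing the slope of the
  left point for the right one.\<close>

lemma nn_integral_direction_law_right:
  assumes [measurable]: "f \<in> borel_measurable borel"
  shows "(\<integral>\<^sup>+x. f x \<partial>direction_law) =
    (\<integral>\<^sup>+y. \<integral>\<^sup>+p. ennreal (slice_density y p) * f (nrm (right_point q y p)) \<partial>lborel \<partial>cot_measure)"
proof -
  define P :: "real^3^3" where "P = vector [vector [line_x q, - line_y q, 0], vector [line_y q, line_x q, 0], vector [0, 0, 1]]"
  have u: "line_x q * line_x q + line_y q * line_y q = 1" using line_unit[of q] by (simp add: power2_eq_square)
  have P: "P \<in> O3"
    using u by (simp add: O3_iff P_def matrix_matrix_mult_def transpose_def mat_def vec_eq_iff forall_3 sum_3 algebra_simps)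
  have Pv: "P *v vector [p, 1, y] = right_point q y p" for p y
    by (simp add: P_def right_point_def matrix_vector_mult_def vec_eq_iff forall_3 sum_3 algebra_simps)
  show ?thesis
    unfolding nn_integral_direction_law_chart[OF assms P] Pv cot_measure_def
    by (subst nn_integral_density)
      (auto simp: chart_density_slice ennreal_mult mult.assoc nn_integral_cmult)
qed

text \<open>In the chart (1, q, y) put y = s x with s = sqrt (1 + q^2). Then 1 + q^2 + y^2 = s^2 (1
  + x^2), and the density splits into a Cauchy density in q and a cotangent density in x.\<close>

lemma nn_integral_direction_law_left:
  assumes [measurable]: "f \<in> borel_measurable borel"
  shows "(\<integral>\<^sup>+x. f x \<partial>direction_law) = (\<integral>\<^sup>+q. \<integral>\<^sup>+x. f (nrm (left_point q x)) \<partial>cot_measure \<partial>cauchy)"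
proof -
  define P :: "real^3^3" where "P = vector [vector [0, 1, 0], vector [1, 0, 0], vector [0, 0, 1]]"
  have P: "P \<in> O3"
    by (simp add: O3_iff P_def matrix_matrix_mult_def transpose_def mat_def vec_eq_iff forall_3 sum_3)
  have Pv: "P *v vector [p, 1, y] = vector [1, p, y]" for p y :: real
    by (simp add: P_def matrix_vector_mult_def vec_eq_iff forall_3 sum_3)
  have "(\<integral>\<^sup>+x. f x \<partial>direction_law) = (\<integral>\<^sup>+y. \<integral>\<^sup>+q. ennreal (chart_density q y) * f (nrm (vector [1, q, y])) \<partial>lborel \<partial>lborel)"
    unfolding nn_integral_direction_law_chart[OF assms P] Pv ..
  also have "\<dots> = (\<integral>\<^sup>+q. \<integral>\<^sup>+y. ennreal (chart_density q y) * f (nrm (vector [1, q, y])) \<partial>lborel \<partial>lborel)"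
    by (rule lborel_pair.Fubini') measurable
  also have "\<dots> = (\<integral>\<^sup>+q. ennreal (1 / (pi * (1 + q\<^sup>2))) * (\<integral>\<^sup>+x. ennreal (cot_density x) * f (nrm (left_point q x)) \<partial>lborel) \<partial>lborel)"
  proof (rule nn_integral_cong)
    fix q :: real
    define s where "s = sqrt (1 + q\<^sup>2)"
    have s: "0 < s" "s * s = 1 + q\<^sup>2" by (simp_all add: s_def add_nonneg_nonneg)
    have "(\<integral>\<^sup>+y. ennreal (chart_density q y) * f (nrm (vector [1, q, y])) \<partial>lborel) =
      ennreal s * (\<integral>\<^sup>+x. ennreal (chart_density q (s * x)) * f (nrm (vector [1, q, s * x])) \<partial>lborel)"
      using nn_integral_real_affine[of "\<lambda>y. ennreal (chart_density q y) * f (nrm (vector [1, q, y]))" s 0] s by simp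
    also have "\<dots> = (\<integral>\<^sup>+x. ennreal s * (ennreal (chart_density q (s * x)) * f (nrm (vector [1, q, s * x]))) \<partial>lborel)"
      by (rule nn_integral_cmult[symmetric]) measurable
    also have "\<dots> = (\<integral>\<^sup>+x. ennreal (1 / (pi * (1 + q\<^sup>2))) * (ennreal (cot_density x) * f (nrm (left_point q x))) \<partial>lborel)"
    proof (rule nn_integral_cong)
      fix x :: real
      have "vector [1, q, s * x] = s *\<^sub>R left_point q x"
        using s(1) by (simp add: left_point_def line_x_def line_y_def vec_eq_iff forall_3 s_def[symmetric])
      then have n: "nrm (vector [1, q, s * x]) = nrm (left_point q x)"
        using s(1) by (simp add: nrm_scaleR)
      have "1 + q\<^sup>2 + (s * x)\<^sup>2 = (s * s) * (1 + x\<^sup>2)"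
        unfolding power_mult_distrib power2_eq_square[of s] s(2) by (simp add: algebra_simps)
      then have "sqrt (1 + q\<^sup>2 + (s * x)\<^sup>2) = s * sqrt (1 + x\<^sup>2)"
        using s(1) by (simp add: real_sqrt_mult)
      then have "s * chart_density q (s * x) = 1 / (pi * (1 + q\<^sup>2)) * cot_density x"
        unfolding chart_density_def cot_density_def s(2)[symmetric] using s(1)
        by (simp add: power_mult_distrib power3_eq_cube)
      then have "ennreal s * ennreal (chart_density q (s * x)) = ennreal (1 / (pi * (1 + q\<^sup>2))) * ennreal (cot_density x)"
        using s(1) by (simp add: ennreal_mult[symmetric] del: ennreal_mult)
      then show "ennreal s * (ennreal (chart_density q (s * x)) * f (nrm (vector [1, q, s * x]))) =
          ennreal (1 / (pi * (1 + q\<^sup>2))) * (ennreal (cot_density x) * f (nrm (left_point q x)))"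
        by (simp only: n mult.assoc[symmetric])
    qed
    also have "\<dots> = ennreal (1 / (pi * (1 + q\<^sup>2))) * (\<integral>\<^sup>+x. ennreal (cot_density x) * f (nrm (left_point q x)) \<partial>lborel)"
      by (rule nn_integral_cmult) measurable
    finally show "(\<integral>\<^sup>+y. ennreal (chart_density q y) * f (nrm (vector [1, q, y])) \<partial>lborel) = \<dots>" .
  qed
  also have "\<dots> = (\<integral>\<^sup>+q. \<integral>\<^sup>+x. f (nrm (left_point q x)) \<partial>cot_measure \<partial>cauchy)"
    unfolding cauchy_def cot_measure_def
    by (simp add: nn_integral_density)
  finally show ?thesis .
qed

text \<open>In the chart with third coordinate 1 the cap is the square [-T, T]^2, of area 4 T^2, and
  the density is at most 1 / (2 pi).\<close>

lemma emeasure_direction_law_cap: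
  assumes "0 \<le> T"
  shows "emeasure direction_law {w. \<bar>w $ 1\<bar> \<le> T * \<bar>w $ 3\<bar> \<and> \<bar>w $ 2\<bar> \<le> T * \<bar>w $ 3\<bar>} \<le> ennreal (2 * T\<^sup>2 / pi)"
proof -
  define C :: "(real^3) set" where "C = {w. \<bar>w $ 1\<bar> \<le> T * \<bar>w $ 3\<bar> \<and> \<bar>w $ 2\<bar> \<le> T * \<bar>w $ 3\<bar>}"
  have [measurable]: "C \<in> sets borel" unfolding C_def by measurable
  define P :: "real^3^3" where "P = vector [vector [1, 0, 0], vector [0, 0, 1], vector [0, 1, 0]]"
  have P: "P \<in> O3"
    by (simp add: O3_iff P_def matrix_matrix_mult_def transpose_def mat_def vec_eq_iff forall_3 sum_3)
  have Pv: "P *v vector [p, 1, y] = vector [p, y, 1]" for p y :: real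
    by (simp add: P_def matrix_vector_mult_def vec_eq_iff forall_3 sum_3)
  have C: "c *\<^sub>R w \<in> C \<longleftrightarrow> w \<in> C" if "c \<noteq> 0" for c w
  proof -
    have "\<bar>c\<bar> * \<bar>a\<bar> \<le> T * (\<bar>c\<bar> * \<bar>b\<bar>) \<longleftrightarrow> \<bar>a\<bar> \<le> T * \<bar>b\<bar>" for a b :: real
      using that mult_le_cancel_left_pos[of "\<bar>c\<bar>" "\<bar>a\<bar>" "T * \<bar>b\<bar>"] by (simp add: mult.left_commute)
    then show ?thesis by (simp add: C_def abs_mult)
  qed
  have nC: "nrm w \<in> C \<longleftrightarrow> w \<in> C" if "w \<noteq> 0" for w
    using nrm_eq_scaleR[OF that] C by auto
  have "emeasure direction_law C = (\<integral>\<^sup>+x. indicator C x \<partial>direction_law)" by simp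
  also have "\<dots> = (\<integral>\<^sup>+y. \<integral>\<^sup>+p. ennreal (chart_density p y) * indicator C (nrm (vector [p, y, 1])) \<partial>lborel \<partial>lborel)"
    by (subst nn_integral_direction_law_chart[OF _ P]) (auto simp: Pv)
  also have "\<dots> \<le> (\<integral>\<^sup>+y. \<integral>\<^sup>+p. (ennreal (1 / (2 * pi)) * indicator {-T..T} y) * indicator {-T..T} p \<partial>lborel \<partial>lborel)"
  proof (intro nn_integral_mono)
    fix y p :: real
    have "1 \<le> sqrt (1 + p\<^sup>2 + y\<^sup>2)" by simp
    then have "chart_density p y \<le> 1 / (2 * pi)"
      unfolding chart_density_def
      by (intro divide_left_mono mult_pos_pos zero_less_power) (auto simp: one_le_power intro: less_le_trans[OF zero_less_one])
    moreover have "vector [p, y, 1] \<noteq> (0::real^3)" by (simp add: vec_eq_iff forall_3)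
    then have "nrm (vector [p, y, 1]) \<in> C \<longleftrightarrow> p \<in> {-T..T} \<and> y \<in> {-T..T}"
      by (subst nC) (auto simp: C_def abs_le_iff)
    ultimately show "ennreal (chart_density p y) * indicator C (nrm (vector [p, y, 1])) \<le> (ennreal (1 / (2 * pi)) * indicator {-T..T} y) * indicator {-T..T} p"
      by (auto simp: indicator_def intro: ennreal_leI)
  qed
  also have "\<dots> = ennreal (2 * T\<^sup>2 / pi)"
  proof -
    have "(\<integral>\<^sup>+y. \<integral>\<^sup>+p. (ennreal (1 / (2 * pi)) * indicator {-T..T} y) * indicator {-T..T} p \<partial>lborel \<partial>lborel) =
      (\<integral>\<^sup>+y. (ennreal (1 / (2 * pi)) * ennreal (2 * T)) * indicator {-T..T} y \<partial>lborel)"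
    proof (rule nn_integral_cong)
      fix y :: real
      show "(\<integral>\<^sup>+p. (ennreal (1 / (2 * pi)) * indicator {-T..T} y) * indicator {-T..T} p \<partial>lborel) =
        (ennreal (1 / (2 * pi)) * ennreal (2 * T)) * indicator {-T..T} y"
        using assms by (subst nn_integral_cmult_indicator) (auto simp: mult_ac)
    qed
    also have "\<dots> = (ennreal (1 / (2 * pi)) * ennreal (2 * T)) * ennreal (2 * T)"
      using assms by (subst nn_integral_cmult_indicator) auto
    also have "\<dots> = ennreal (2 * T\<^sup>2 / pi)"
      using assms by (simp add: power2_eq_square flip: ennreal_mult)
    finally show ?thesis .
  qed
  finally show ?thesis by (simp add: C_def)
qed

end

section \<open>The invariant mass of the chart\<close>

lemma inner_matrix_trace: "A \<bullet> B = trace (transpose A ** B)" for A B :: "real^'n^'n"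
  unfolding trace_def inner_vec_def matrix_matrix_mult_def transpose_def
  by (simp, rule sum.swap)

lemma scaleR_matrix_mult_left: "(c *\<^sub>R A) ** B = c *\<^sub>R (A ** B)" for A B :: "real^'n^'n"
  by (simp add: vec_eq_iff matrix_matrix_mult_def sum_distrib_left mult.assoc)

lemma scaleR_matrix_mult_right: "A ** (c *\<^sub>R B) = c *\<^sub>R (A ** B)" for A B :: "real^'n^'n"
  by (simp add: vec_eq_iff matrix_matrix_mult_def sum_distrib_left mult.left_commute)

lemma inner_orthogonal_left:
  fixes A B U :: "real^'n^'n"
  assumes "transpose U ** U = mat 1"
  shows "(U ** A) \<bullet> (U ** B) = A \<bullet> B"
proof -
  have "transpose (U ** A) ** (U ** B) = transpose A ** ((transpose U ** U) ** B)"
    by (simp only: matrix_transpose_mul matrix_mul_assoc)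
  then show ?thesis by (simp add: inner_matrix_trace assms)
qed

lemma inner_transpose: "transpose A \<bullet> transpose B = A \<bullet> B" for A B :: "real^'n^'n"
  unfolding inner_vec_def transpose_def by (simp, rule sum.swap)

lemma inner_orthogonal_right:
  fixes A B V :: "real^'n^'n"
  assumes "V ** transpose V = mat 1"
  shows "(A ** V) \<bullet> (B ** V) = A \<bullet> B"
  using inner_orthogonal_left[of "transpose V" "transpose A" "transpose B"] assms
  by (simp add: matrix_transpose_mul[symmetric] inner_transpose)

lemma rot_in_O3: "rot_x a \<in> O3" "rot_y a \<in> O3" "rot_z a \<in> O3"
  by (simp_all add: O3_iff rot_x_def rot_y_def rot_z_def matrix_matrix_mult_def transpose_def mat_def
      vec_eq_iff forall_3 sum_3 flip: power2_eq_square)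

lemma frames_in_O3: "left_frame \<xi> \<in> O3" "right_frame \<xi> \<in> O3"
  by (simp_all add: left_frame_def right_frame_def O3_mult rot_in_O3)

lemma proj_xy_nonzero: "U \<in> O3 \<Longrightarrow> V \<in> O3 \<Longrightarrow> U ** proj_xy ** V \<noteq> 0"
proof
  assume U: "U \<in> O3" and V: "V \<in> O3" and "U ** proj_xy ** V = 0"
  then have "transpose U ** (U ** proj_xy ** V) ** transpose V = 0" by simp
  moreover have "transpose U ** (U ** proj_xy ** V) ** transpose V = (transpose U ** U) ** proj_xy ** (V ** transpose V)"
    by (simp only: matrix_mul_assoc)
  ultimately have "proj_xy = 0" using U V by (simp add: O3_iff)
  then show False by (simp add: proj_xy_def vec_eq_iff forall_3)
qed

lemma cross_matrix_axis_3: "cross_matrix (axis 3 1) = proj_xy ** rot_z (pi / 2)"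
proof -
  have "cross_matrix (axis 3 1) *v x = (proj_xy ** rot_z (pi / 2)) *v x" for x
    unfolding Defs.cross_matrix_mult
    by (simp add: cross3_def proj_xy_def rot_z_def matrix_matrix_mult_def matrix_vector_mult_def
        vec_eq_iff forall_3 sum_3 axis_def)
  then show ?thesis by (simp add: matrix_eq)
qed

lemma cross_matrix_rotation:
  assumes "rotation_matrix A"
  shows "cross_matrix (A *v t) ** A = A ** cross_matrix t"
  unfolding matrix_eq
  by (simp add: matrix_vector_mul_assoc[symmetric] Defs.cross_matrix_mult cross_rotation_matrix[OF assms])

text \<open>If the rotation A takes axis 3 to the direction of t, the cross matrix of t is |t| A K
  A^T with K that of axis 3; and K is \<open>proj_xy\<close> times a quarter turn, which joins the
  right factor.\<close>

lemma essential_cone_decompose: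
  assumes "E \<in> essential_cone" "E \<noteq> 0"
  obtains r W Z where "r \<noteq> 0" "W \<in> O3" "Z \<in> O3" "E = r *\<^sub>R (W ** proj_xy ** Z)"
proof -
  obtain t R where E: "E = cross_matrix t ** R" and R: "rotation_matrix R"
    using assms(1) by (auto simp: essential_cone_def)
  have t: "t \<noteq> 0"
  proof
    assume "t = 0"
    then have "cross_matrix t = 0" by (simp add: matrix_eq Defs.cross_matrix_mult)
    then show False using E assms(2) by simp
  qed
  obtain A where A: "rotation_matrix A" "A *v axis 3 1 = (1 / norm t) *\<^sub>R t"
    using rotation_matrix_exists_basis[of "(1 / norm t) *\<^sub>R t" 3] t by auto
  have AO: "A \<in> O3" and RO: "R \<in> O3" using A R by (auto simp: O3_def rotation_matrix_def)
  have "t = norm t *\<^sub>R (A *v axis 3 1)" using A t by simp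
  then have "cross_matrix t = norm t *\<^sub>R cross_matrix (A *v axis 3 1)"
    by (metis (no_types, lifting) matrix_eq Defs.cross_matrix_mult cross_mult_left scaleR_matrix_vector_assoc)
  also have "cross_matrix (A *v axis 3 1) = cross_matrix (A *v axis 3 1) ** (A ** transpose A)"
    using AO by (simp add: O3_iff)
  also have "\<dots> = A ** cross_matrix (axis 3 1) ** transpose A"
    by (simp add: matrix_mul_assoc cross_matrix_rotation[OF A(1)])
  finally have "E = norm t *\<^sub>R (A ** proj_xy ** (rot_z (pi / 2) ** transpose A ** R))"
    unfolding E cross_matrix_axis_3 by (simp add: matrix_mul_assoc scaleR_matrix_mult_left)
  then show ?thesis
    using that[of "norm t" A "rot_z (pi / 2) ** transpose A ** R"] t AO RO
    by (simp add: O3_mult O3_transpose rot_in_O3)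
qed

text \<open>A converse of \<open>essential_cone_decompose\<close>. A factor of determinant -1 is
  corrected by D = diag (1, 1, -1), which \<open>proj_xy\<close> absorbs on either side.\<close>

lemma essential_cone_compose:
  assumes W: "W \<in> O3" and Z: "Z \<in> O3"
  shows "W ** proj_xy ** Z \<in> essential_cone"
proof -
  define D :: "real^3^3" where "D = vector [vector [1, 0, 0], vector [0, 1, 0], vector [0, 0, -1]]"
  have D: "D \<in> O3" "det D = -1" "D ** proj_xy = proj_xy" "proj_xy ** D = proj_xy"
    by (simp_all add: D_def O3_iff proj_xy_def matrix_matrix_mult_def transpose_def mat_def
      vec_eq_iff forall_3 sum_3 det_3)
  obtain W' where W': "rotation_matrix W'" "W' ** proj_xy = W ** proj_xy"
  proof (cases "det W = 1")
    case False
    then have "det W = -1" using O3_det[OF W] by (simp add: abs_if split: if_splits)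
    then show ?thesis
      using that[of "W ** D"] D W O3_mult[OF W D(1)]
      by (simp add: rotation_matrix_def O3_def det_mul matrix_mul_assoc[symmetric])
  qed (use W that in \<open>auto simp: rotation_matrix_def O3_def\<close>)
  obtain Z' where Z': "rotation_matrix Z'" "proj_xy ** Z' = proj_xy ** Z"
  proof (cases "det Z = 1")
    case False
    then have "det Z = -1" using O3_det[OF Z] by (simp add: abs_if split: if_splits)
    then show ?thesis
      using that[of "D ** Z"] D Z O3_mult[OF D(1) Z]
      by (simp add: rotation_matrix_def O3_def det_mul matrix_mul_assoc)
  qed (use Z that in \<open>auto simp: rotation_matrix_def O3_def\<close>)
  have rz: "rot_z (pi / 2) ** rot_z (- (pi / 2)) = mat 1" "det (rot_z a) = 1" for a
    by (simp_all add: rot_z_def matrix_matrix_mult_def mat_def vec_eq_iff forall_3 sum_3 det_3 flip: power2_eq_square)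
  have "W ** proj_xy ** Z = W' ** proj_xy ** Z"
    using W'(2) by simp
  also have "\<dots> = W' ** (proj_xy ** Z')"
    using Z'(2) by (simp add: matrix_mul_assoc)
  also have "\<dots> = W' ** (proj_xy ** (rot_z (pi / 2) ** rot_z (- (pi / 2)))) ** Z'"
    by (simp add: rz matrix_mul_assoc)
  also have "\<dots> = (W' ** cross_matrix (axis 3 1)) ** (rot_z (- (pi / 2)) ** Z')"
    by (simp add: cross_matrix_axis_3 matrix_mul_assoc)
  also have "\<dots> = cross_matrix (W' *v axis 3 1) ** (W' ** (rot_z (- (pi / 2)) ** Z'))"
    by (simp add: cross_matrix_rotation[OF W'(1), symmetric] matrix_mul_assoc)
  finally have "W ** proj_xy ** Z = cross_matrix (W' *v axis 3 1) ** (W' ** (rot_z (- (pi / 2)) ** Z'))" .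
  moreover have "rotation_matrix (W' ** (rot_z (- (pi / 2)) ** Z'))"
    using W' Z' rot_in_O3(3)[of "- (pi / 2)"]
    by (simp add: rotation_matrix_def det_mul rz orthogonal_matrix_mul O3_def)
  ultimately show ?thesis unfolding essential_cone_def by blast
qed

section \<open>Kernels of the chart matrices\<close>

definition kernel_cap :: "real \<Rightarrow> (real^3) set" where
  "kernel_cap T = {w. \<bar>w $ 1\<bar> \<le> T * \<bar>w $ 3\<bar> \<and> \<bar>w $ 2\<bar> \<le> T * \<bar>w $ 3\<bar>}"

lemma kernel_cap_scaleR: "w \<in> kernel_cap T \<Longrightarrow> c *\<^sub>R w \<in> kernel_cap T"
proof -
  have "\<bar>c\<bar> * \<bar>a\<bar> \<le> T * (\<bar>c\<bar> * \<bar>b\<bar>)" if "\<bar>a\<bar> \<le> T * \<bar>b\<bar>" for a b :: real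
    using mult_left_mono[OF that, of "\<bar>c\<bar>"] by (simp add: mult.left_commute)
  then show "w \<in> kernel_cap T \<Longrightarrow> c *\<^sub>R w \<in> kernel_cap T" by (simp add: kernel_cap_def abs_mult)
qed

lemma left_frame_axis: "left_frame \<xi> *v axis 3 1 = vector [- sin (\<xi> $ 5), sin (\<xi> $ 4) * cos (\<xi> $ 5), cos (\<xi> $ 4) * cos (\<xi> $ 5)]"
  by (simp add: left_frame_def rot_x_def rot_y_def matrix_matrix_mult_def matrix_vector_mult_def
      vec_eq_iff forall_3 sum_3 axis_def)

lemma right_frame_axis: "transpose (right_frame \<xi>) *v axis 3 1 = vector [sin (\<xi> $ 2), sin (\<xi> $ 3) * cos (\<xi> $ 2), cos (\<xi> $ 3) * cos (\<xi> $ 2)]"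
  by (simp add: right_frame_def rot_x_def rot_y_def matrix_transpose_mul transpose_def matrix_matrix_mult_def
      matrix_vector_mult_def vector_matrix_mult_def vec_eq_iff forall_3 sum_3 axis_def)

text \<open>Dividing by the third coordinate gives tan a / cos b and tan b, both at most tan h / cos
  h in absolute value.\<close>

lemma spherical_mem_kernel_cap:
  assumes h: "0 < h" "h < pi / 2" and a: "\<bar>a\<bar> \<le> h" and b: "\<bar>b\<bar> \<le> h"
  shows "vector [sin a, sin b * cos a, cos b * cos a] \<in> kernel_cap (tan h / cos h)"
proof -
  have cos: "0 < cos x" "cos h \<le> cos x" "\<bar>tan x\<bar> \<le> tan h" if "\<bar>x\<bar> \<le> h" for x
  proof -
    show "0 < cos x" using that h by (intro cos_gt_zero_pi) auto
    show "cos h \<le> cos x" using cos_monotone_0_pi_le[of "\<bar>x\<bar>" h] that h by simp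
    show "\<bar>tan x\<bar> \<le> tan h"
      using that h tan_mono_le[of x h] tan_mono_le[of "- x" h] by (auto simp: abs_le_iff)
  qed
  have ch: "0 < cos h" "cos h \<le> 1" "0 \<le> tan h" using cos[of h] h tan_pos_pi2_le[of h] by auto
  have 1: "\<bar>sin a\<bar> \<le> tan h / cos h * (cos b * cos a)"
  proof -
    have "\<bar>sin a\<bar> = \<bar>tan a\<bar> * cos a" using cos[OF a] by (simp add: tan_def abs_divide)
    also have "\<dots> \<le> (tan h * (cos b / cos h)) * cos a"
    proof (rule mult_right_mono)
      have "1 \<le> cos b / cos h" using cos[OF b] ch by simp
      then show "\<bar>tan a\<bar> \<le> tan h * (cos b / cos h)" using cos(3)[OF a] ch(3) mult_left_mono[of 1 "cos b / cos h" "tan h"] by simp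
    qed (use cos[OF a] in simp)
    finally show ?thesis by simp
  qed
  have 2: "\<bar>sin b * cos a\<bar> \<le> tan h / cos h * (cos b * cos a)"
  proof -
    have "\<bar>sin b * cos a\<bar> = \<bar>tan b\<bar> * (cos b * cos a)" using cos[OF b] cos[OF a] by (simp add: tan_def abs_divide abs_mult)
    also have "\<dots> \<le> tan h / cos h * (cos b * cos a)"
    proof (rule mult_right_mono)
      have "tan h \<le> tan h / cos h" using ch by (simp add: pos_le_divide_eq mult_left_le)
      then show "\<bar>tan b\<bar> \<le> tan h / cos h" using cos(3)[OF b] by simp
    qed (use cos[OF b] cos[OF a] in simp)
    finally show ?thesis .
  qed
  show ?thesis using 1 2 cos[OF a] cos[OF b] by (simp add: kernel_cap_def abs_mult)
qed

text \<open>The third coordinates are r and s times positive numbers, which forces r = s; then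
  \<open>sin\<close> is injective on [-h, h].\<close>

lemma spherical_inj:
  assumes h: "h < pi / 2" and a: "\<bar>a\<bar> \<le> h" "\<bar>a'\<bar> \<le> h" and b: "\<bar>b\<bar> \<le> h" "\<bar>b'\<bar> \<le> h"
    and eq: "r *\<^sub>R vector [sin a, sin b * cos a, cos b * cos a] = (s *\<^sub>R vector [sin a', sin b' * cos a', cos b' * cos a'] :: real^3)"
    and rs: "\<bar>r\<bar> = 1" "\<bar>s\<bar> = 1"
  shows "a = a'" "b = b'"
proof -
  have pos: "0 < cos x" if "\<bar>x\<bar> \<le> h" for x using that h by (intro cos_gt_zero_pi) auto
  have inj: "x = y" if "sin x = sin y" "\<bar>x\<bar> \<le> h" "\<bar>y\<bar> \<le> h" for x y
    using sin_inj_pi[of x y] that h by auto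
  have e: "r * sin a = s * sin a'" "r * (sin b * cos a) = s * (sin b' * cos a')" "r * (cos b * cos a) = s * (cos b' * cos a')"
    using eq by (simp_all add: vec_eq_iff forall_3)
  have "r = s"
  proof -
    have "0 < cos b * cos a" "0 < cos b' * cos a'" using pos a b by auto
    then show ?thesis using e(3) rs
      by (smt (verit) mult_minus_left zero_less_mult_iff mult_cancel_right1)
  qed
  then have e': "sin a = sin a'" "sin b * cos a = sin b' * cos a'" using e rs by auto
  show "a = a'" using inj[OF e'(1)] a by simp
  then show "b = b'" using e'(2) pos[OF a(1)] inj[of b b'] b by simp
qed

text \<open>Keeps \<open>transpose A *v x\<close> intact, the form in which orthogonality is used
  below.\<close>

declare transpose_matrix_vector [simp del]

lemma proj_xy_kernel: "proj_xy *v w = 0 \<Longrightarrow> w = (w $ 3) *\<^sub>R axis 3 1"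
  by (simp add: proj_xy_def matrix_vector_mult_def vec_eq_iff forall_3 sum_3 axis_def)

lemma O3_mult_cancel: "U \<in> O3 \<Longrightarrow> transpose U *v (U *v x) = x" "U \<in> O3 \<Longrightarrow> U *v (transpose U *v x) = x"
  by (simp_all add: matrix_vector_mul_assoc O3_iff)

text \<open>\<open>rot_z\<close> commutes with \<open>proj_xy\<close> and, like the left frame, is
  invertible; so only the right frame moves the kernel.\<close>

lemma essential_chart_kernel:
  assumes "essential_chart \<xi> *v v = 0"
  shows "\<exists>r. v = r *\<^sub>R (transpose (right_frame \<xi>) *v axis 3 1)"
proof -
  define w where "w = right_frame \<xi> *v v"
  have "left_frame \<xi> *v (proj_xy *v (rot_z (\<xi> $ 1) *v w)) = 0"
    using assms by (simp add: essential_chart_def w_def matrix_vector_mul_assoc matrix_mul_assoc)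
  then have "proj_xy *v (rot_z (\<xi> $ 1) *v w) = 0"
    using orthogonal_mult_eq_0[OF frames_in_O3(1)] by blast
  moreover have "proj_xy *v (rot_z c *v w) = rot_z c *v (proj_xy *v w)" for c
    by (simp add: proj_xy_def rot_z_def matrix_vector_mult_def vec_eq_iff forall_3 sum_3)
  ultimately have "proj_xy *v w = 0"
    using orthogonal_mult_eq_0[OF rot_in_O3(3)] by metis
  then have "w = (w $ 3) *\<^sub>R axis 3 1" by (rule proj_xy_kernel)
  then have "transpose (right_frame \<xi>) *v w = (w $ 3) *\<^sub>R (transpose (right_frame \<xi>) *v axis 3 1)"
    by (metis matrix_vector_mult_scaleR)
  then show ?thesis
    unfolding w_def O3_mult_cancel(1)[OF frames_in_O3(2)] by blast
qed

lemma transpose_proj_xy: "transpose proj_xy = proj_xy"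
  by (simp add: proj_xy_def transpose_def vec_eq_iff forall_3)

lemma essential_chart_cokernel:
  assumes "transpose (essential_chart \<xi>) *v u = 0"
  shows "\<exists>r. u = r *\<^sub>R (left_frame \<xi> *v axis 3 1)"
proof -
  define w where "w = transpose (left_frame \<xi>) *v u"
  have "transpose (right_frame \<xi>) *v (transpose (rot_z (\<xi> $ 1)) *v (proj_xy *v w)) = 0"
    using assms
    by (simp add: essential_chart_def w_def matrix_vector_mul_assoc matrix_mul_assoc matrix_transpose_mul transpose_proj_xy)
  then have "proj_xy *v w = 0"
    using orthogonal_mult_eq_0[OF O3_transpose[OF frames_in_O3(2)]] orthogonal_mult_eq_0[OF O3_transpose[OF rot_in_O3(3)]]
    by blast
  then have "w = (w $ 3) *\<^sub>R axis 3 1" by (rule proj_xy_kernel)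
  then have "left_frame \<xi> *v w = (w $ 3) *\<^sub>R (left_frame \<xi> *v axis 3 1)"
    by (metis matrix_vector_mult_scaleR)
  then show ?thesis
    unfolding w_def O3_mult_cancel(2)[OF frames_in_O3(1)] by blast
qed

text \<open>Both signs occur because a projective point determines a matrix of given Frobenius norm
  only up to sign.\<close>

definition chart_set :: "real \<Rightarrow> (real^3^3) set" where
  "chart_set h = (\<lambda>(s, \<xi>). s *\<^sub>R essential_chart \<xi>) ` ({-1, 1} \<times> sym_box h)"

lemma chart_setE:
  assumes "M \<in> chart_set h"
  obtains s \<xi> where "\<bar>s\<bar> = 1" "\<xi> \<in> sym_box h" "M = s *\<^sub>R essential_chart \<xi>"
proof -
  obtain p where p: "p \<in> {-1, 1} \<times> sym_box h" "M = (\<lambda>(s, \<xi>). s *\<^sub>R essential_chart \<xi>) p"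
    using assms unfolding chart_set_def by blast
  then show ?thesis by (intro that[of "fst p" "snd p"]) (auto simp only: case_prod_beta mem_Times_iff insert_iff abs_minus_cancel abs_one empty_iff)
qed

text \<open>Elements of O(2) about the third axis: turns by k pi / n, with a reflection if
  \<open>j\<close> is false. A turn by pi merely changes the sign of \<open>proj_xy\<close>, hence k
  runs over values below n.\<close>

definition sector_rot :: "nat \<Rightarrow> nat \<Rightarrow> bool \<Rightarrow> real^3^3" where
  "sector_rot n k j = rot_z (real k * pi / real n) ** vector [vector [1, 0, 0], vector [0, sg j, 0], vector [0, 0, 1]]"

lemma sector_rot_in_O3: "sector_rot n k j \<in> O3"
  unfolding sector_rot_def
  by (intro O3_mult rot_in_O3)
    (simp add: O3_iff matrix_matrix_mult_def transpose_def mat_def vec_eq_iff forall_3 sum_3 sg_def)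

lemma inner_proj_rot_z: "(proj_xy ** rot_z a) \<bullet> (proj_xy ** rot_z b) = 2 * cos (a - b)"
  by (simp add: inner_vec_def sum_3 proj_xy_def rot_z_def matrix_matrix_mult_def cos_diff)

text \<open>Rotations and reflections of the plane are orthogonal for the Frobenius product, which
  gives the value 0.\<close>

lemma inner_proj_sector_rot:
  "(proj_xy ** sector_rot n k j) \<bullet> (proj_xy ** sector_rot n k' j') =
    (if j = j' then 2 * cos ((real k - real k') * pi / real n) else 0)"
  by (auto simp: inner_vec_def sum_3 proj_xy_def rot_z_def sector_rot_def matrix_matrix_mult_def
      cos_diff sg_def left_diff_distrib diff_divide_distrib algebra_simps)

context
  fixes h :: real and n :: nat
  assumes n: "2 \<le> n" and h: "0 < h" "2 * h * real n < pi"
begin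

lemma h_less: "h < pi / 2"
proof -
  have "2 * h * 2 \<le> 2 * h * real n" using n h by (intro mult_left_mono) auto
  then show ?thesis using h by linarith
qed

text \<open>Factors that preserve the third axis leave the kernels in place, so U and V carry axis 3
  to the left and the right kernel of the chart matrix. All vectors involved are unit vectors, hence
  |r| = 1.\<close>

lemma sector_kernels:
  assumes U: "U \<in> O3" and V: "V \<in> O3" and s: "\<bar>s\<bar> = 1"
    and eq: "U ** (proj_xy ** sector_rot n k j) ** transpose V = s *\<^sub>R essential_chart \<xi>"
  shows "\<exists>r. \<bar>r\<bar> = 1 \<and> U *v axis 3 1 = r *\<^sub>R (left_frame \<xi> *v axis 3 1)"
    and "\<exists>r. \<bar>r\<bar> = 1 \<and> V *v axis 3 1 = r *\<^sub>R (transpose (right_frame \<xi>) *v axis 3 1)"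
proof -
  have norm: "norm (Q *v x) = norm x" if "Q \<in> O3" for Q x
    using that orthogonal_transformation_matrix[of "(*v) Q"] by (simp add: O3_def orthogonal_transformation)
  have s0: "s \<noteq> 0" using s by auto
  have r1: "\<bar>r\<bar> = 1" if "Q \<in> O3" "P \<in> O3" "Q *v axis 3 1 = r *\<^sub>R (P *v axis 3 1)" for Q P r
    using arg_cong[OF that(3), of norm] norm[OF that(1), of "axis 3 1"] norm[OF that(2), of "axis 3 1"] by simp
  have z: "(proj_xy ** sector_rot n k j) *v axis 3 1 = 0"
    by (simp add: proj_xy_def sector_rot_def rot_z_def matrix_matrix_mult_def matrix_vector_mult_def vec_eq_iff
        forall_3 sum_3 axis_def)
  have "(U ** (proj_xy ** sector_rot n k j) ** transpose V) *v (V *v axis 3 1) =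
      U *v ((proj_xy ** sector_rot n k j) *v (transpose V *v (V *v axis 3 1)))"
    by (simp only: matrix_vector_mul_assoc matrix_mul_assoc)
  also have "\<dots> = 0" by (simp add: O3_mult_cancel(1)[OF V] z)
  finally have "s *\<^sub>R (essential_chart \<xi> *v (V *v axis 3 1)) = 0"
    unfolding eq by (simp add: scaleR_matrix_vector_assoc[symmetric])
  then have "essential_chart \<xi> *v (V *v axis 3 1) = 0" using s0 by simp
  from essential_chart_kernel[OF this]
  show "\<exists>r. \<bar>r\<bar> = 1 \<and> V *v axis 3 1 = r *\<^sub>R (transpose (right_frame \<xi>) *v axis 3 1)"
    using r1[OF V O3_transpose[OF frames_in_O3(2)]] by blast
  have "transpose (U ** (proj_xy ** sector_rot n k j) ** transpose V) *v (U *v axis 3 1) =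
      V *v (transpose (sector_rot n k j) *v (proj_xy *v (transpose U *v (U *v axis 3 1))))"
    by (simp only: matrix_vector_mul_assoc matrix_mul_assoc matrix_transpose_mul transpose_transpose transpose_proj_xy)
  also have "\<dots> = 0"
  proof -
    have "proj_xy *v axis 3 1 = 0"
      by (simp add: proj_xy_def matrix_vector_mult_def vec_eq_iff forall_3 sum_3 axis_def)
    then show ?thesis by (simp add: O3_mult_cancel(1)[OF U])
  qed
  finally have "transpose (s *\<^sub>R essential_chart \<xi>) *v (U *v axis 3 1) = 0" unfolding eq .
  moreover have "transpose (s *\<^sub>R essential_chart \<xi>) = s *\<^sub>R transpose (essential_chart \<xi>)"
    by (simp add: transpose_def vec_eq_iff)
  ultimately have "transpose (essential_chart \<xi>) *v (U *v axis 3 1) = 0"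
    using s0 by (simp add: scaleR_matrix_vector_assoc[symmetric])
  from essential_chart_cokernel[OF this]
  show "\<exists>r. \<bar>r\<bar> = 1 \<and> U *v axis 3 1 = r *\<^sub>R (left_frame \<xi> *v axis 3 1)"
    using r1[OF U frames_in_O3(1)] by blast
qed

lemma sector_kernel_cap:
  assumes U: "U \<in> O3" and V: "V \<in> O3"
    and mem: "U ** (proj_xy ** sector_rot n k j) ** transpose V \<in> chart_set h"
  shows "U *v axis 3 1 \<in> kernel_cap (tan h / cos h)" "V *v axis 3 1 \<in> kernel_cap (tan h / cos h)"
proof -
  obtain s \<xi> where s: "\<bar>s\<bar> = 1" and \<xi>: "\<xi> \<in> sym_box h"
    and eq: "U ** (proj_xy ** sector_rot n k j) ** transpose V = s *\<^sub>R essential_chart \<xi>"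
    by (rule chart_setE[OF mem])
  have b: "\<bar>\<xi> $ i\<bar> \<le> h" for i using \<xi> by (simp add: mem_sym_box)
  obtain r where "U *v axis 3 1 = r *\<^sub>R (left_frame \<xi> *v axis 3 1)"
    using sector_kernels(1)[OF U V s eq] by blast
  then show "U *v axis 3 1 \<in> kernel_cap (tan h / cos h)"
    using spherical_mem_kernel_cap[OF h(1) h_less, of "- \<xi> $ 5" "\<xi> $ 4"] b
    by (auto simp: left_frame_axis intro!: kernel_cap_scaleR)
  obtain r' where "V *v axis 3 1 = r' *\<^sub>R (transpose (right_frame \<xi>) *v axis 3 1)"
    using sector_kernels(2)[OF U V s eq] by blast
  then show "V *v axis 3 1 \<in> kernel_cap (tan h / cos h)"
    using spherical_mem_kernel_cap[OF h(1) h_less, of "\<xi> $ 2" "\<xi> $ 3"] b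
    by (auto simp: right_frame_axis intro!: kernel_cap_scaleR)
qed

text \<open>Frobenius inner products separate the sectors: two matrices in the chart with the same
  frames have inner product \<open>\<plusminus>2 cos (c - c')\<close> with \<open>\<bar>c - c'\<bar> \<le> 2 h < pi / n\<close>.\<close>

lemma sector_unique:
  assumes U: "U \<in> O3" and V: "V \<in> O3" and k: "k < n" "k' < n"
    and mem: "U ** (proj_xy ** sector_rot n k j) ** transpose V \<in> chart_set h"
      "U ** (proj_xy ** sector_rot n k' j') ** transpose V \<in> chart_set h"
  shows "k = k' \<and> j = j'"
proof -
  obtain s \<xi> where s: "\<bar>s\<bar> = 1" and \<xi>: "\<xi> \<in> sym_box h"
    and eq: "U ** (proj_xy ** sector_rot n k j) ** transpose V = s *\<^sub>R essential_chart \<xi>"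
    by (rule chart_setE[OF mem(1)])
  obtain s' \<xi>' where s': "\<bar>s'\<bar> = 1" and \<xi>': "\<xi>' \<in> sym_box h"
    and eq': "U ** (proj_xy ** sector_rot n k' j') ** transpose V = s' *\<^sub>R essential_chart \<xi>'"
    by (rule chart_setE[OF mem(2)])
  have b: "\<bar>\<xi> $ i\<bar> \<le> h" "\<bar>\<xi>' $ i\<bar> \<le> h" for i using \<xi> \<xi>' by (simp_all add: mem_sym_box)
  obtain r r' where r: "\<bar>r\<bar> = 1" "U *v axis 3 1 = r *\<^sub>R (left_frame \<xi> *v axis 3 1)"
    and r': "\<bar>r'\<bar> = 1" "U *v axis 3 1 = r' *\<^sub>R (left_frame \<xi>' *v axis 3 1)"
    using sector_kernels(1)[OF U V s eq] sector_kernels(1)[OF U V s' eq'] by blast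
  \<comment> \<open>A kernel direction determines its two angles, and thereby the frame, although
    its sign is unknown.\<close>
  have "r *\<^sub>R vector [sin (- \<xi> $ 5), sin (\<xi> $ 4) * cos (- \<xi> $ 5), cos (\<xi> $ 4) * cos (- \<xi> $ 5)] =
    (r' *\<^sub>R vector [sin (- \<xi>' $ 5), sin (\<xi>' $ 4) * cos (- \<xi>' $ 5), cos (\<xi>' $ 4) * cos (- \<xi>' $ 5)] :: real^3)"
    using r(2) r'(2) by (simp add: left_frame_axis)
  from spherical_inj[OF h_less _ _ _ _ this r(1) r'(1)] b
  have L: "left_frame \<xi> = left_frame \<xi>'" by (simp add: left_frame_def)
  obtain t t' where t: "\<bar>t\<bar> = 1" "V *v axis 3 1 = t *\<^sub>R (transpose (right_frame \<xi>) *v axis 3 1)"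
    and t': "\<bar>t'\<bar> = 1" "V *v axis 3 1 = t' *\<^sub>R (transpose (right_frame \<xi>') *v axis 3 1)"
    using sector_kernels(2)[OF U V s eq] sector_kernels(2)[OF U V s' eq'] by blast
  have "t *\<^sub>R vector [sin (\<xi> $ 2), sin (\<xi> $ 3) * cos (\<xi> $ 2), cos (\<xi> $ 3) * cos (\<xi> $ 2)] =
    (t' *\<^sub>R vector [sin (\<xi>' $ 2), sin (\<xi>' $ 3) * cos (\<xi>' $ 2), cos (\<xi>' $ 3) * cos (\<xi>' $ 2)] :: real^3)"
    using t(2) t'(2) by (simp add: right_frame_axis)
  from spherical_inj[OF h_less _ _ _ _ this t(1) t'(1)] b
  have R: "right_frame \<xi> = right_frame \<xi>'" by (simp add: right_frame_def)
  have inn: "(X ** A ** Y) \<bullet> (X ** B ** Y) = A \<bullet> B" if "X \<in> O3" "Y \<in> O3" for X Y A B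
    using that by (simp add: inner_orthogonal_left inner_orthogonal_right O3_iff)
  have "(proj_xy ** sector_rot n k j) \<bullet> (proj_xy ** sector_rot n k' j') =
      (s *\<^sub>R essential_chart \<xi>) \<bullet> (s' *\<^sub>R essential_chart \<xi>')"
    unfolding eq[symmetric] eq'[symmetric] using inn[OF U O3_transpose[OF V]] by simp
  also have "\<dots> = s * s' * (2 * cos (\<xi> $ 1 - \<xi>' $ 1))"
    unfolding essential_chart_def L R using inn[OF frames_in_O3] by (simp add: inner_proj_rot_z)
  finally have "\<bar>(proj_xy ** sector_rot n k j) \<bullet> (proj_xy ** sector_rot n k' j')\<bar> = 2 * \<bar>cos (\<xi> $ 1 - \<xi>' $ 1)\<bar>"
    using s s' by (simp add: abs_mult)
  moreover have "cos (pi / n) < \<bar>cos (\<xi> $ 1 - \<xi>' $ 1)\<bar>"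
  proof -
    have hn: "2 * h < pi / n" using h(2) n by (simp add: pos_less_divide_eq)
    have c: "\<bar>\<xi> $ 1 - \<xi>' $ 1\<bar> \<le> 2 * h" using b(1)[of 1] b(2)[of 1] by linarith
    have pn: "pi / n \<le> pi" using n by (simp add: pos_divide_le_eq)
    have "cos (pi / n) < cos \<bar>\<xi> $ 1 - \<xi>' $ 1\<bar>"
      using hn c pn by (intro cos_monotone_0_pi) auto
    then show ?thesis by simp
  qed
  ultimately have big: "2 * cos (pi / n) < \<bar>(proj_xy ** sector_rot n k j) \<bullet> (proj_xy ** sector_rot n k' j')\<bar>" by simp
  \<comment> \<open>Here \<open>2 \<le> n\<close> enters: as cos (pi / n) is nonnegative, the
    product just bounded from below is nonzero, which excludes different \<open>j\<close> and
    \<open>j'\<close>.\<close>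
  have cp: "0 \<le> cos (pi / n)"
  proof (rule cos_ge_zero)
    show "pi / n \<le> pi / 2" using n by (intro divide_left_mono) auto
  qed (auto intro: order_trans[of _ 0])
  have jj: "j = j'" using big cp by (auto simp: inner_proj_sector_rot split: if_splits)
  \<comment> \<open>Otherwise the angle between the sectors lies in [pi / n, pi - pi / n], where
    |cos| is at most cos (pi / n).\<close>
  have "k = k'"
  proof (rule ccontr)
    assume "k \<noteq> k'"
    define d where "d = \<bar>(real k - real k') * pi / n\<bar>"
    have "1 \<le> \<bar>real k - real k'\<bar>" "\<bar>real k - real k'\<bar> \<le> n - 1" using \<open>k \<noteq> k'\<close> k by linarith+
    then have "1 * (pi / n) \<le> \<bar>real k - real k'\<bar> * (pi / n)" "\<bar>real k - real k'\<bar> * (pi / n) \<le> (n - 1) * (pi / n)"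
      by (intro mult_right_mono; simp)+
    moreover have "(real n - 1) * (pi / n) = pi - pi / n" using n by (simp add: field_simps)
    ultimately have d: "pi / n \<le> d" "d \<le> pi - pi / n"
      using n by (simp_all add: d_def abs_mult of_nat_diff)
    have "cos d \<le> cos (pi / n)" using d n by (intro cos_monotone_0_pi_le) (auto intro: order_trans[OF d(2)])
    moreover have "cos (pi - pi / n) \<le> cos d" using d by (intro cos_monotone_0_pi_le) (auto intro: order_trans[OF _ d(1)])
    ultimately have "\<bar>cos d\<bar> \<le> cos (pi / n)" by simp
    moreover have "cos d = cos ((real k - real k') * pi / n)" unfolding d_def by (rule cos_abs_real)
    ultimately show False using big jj by (simp add: inner_proj_sector_rot abs_mult)
  qed
  then show ?thesis using jj by simp
qed

end

section \<open>The mass of the chart set\<close>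

lemma continuous_on_matrix_entries:
  fixes A :: "'a::topological_space \<Rightarrow> real^'n^'m"
  assumes "\<And>i j. continuous_on S (\<lambda>x. A x $ i $ j)"
  shows "continuous_on S A"
proof -
  have "continuous_on S (\<lambda>x. \<chi> i j. A x $ i $ j)"
    by (intro continuous_on_vec_lambda assms)
  then show ?thesis by simp
qed

lemma continuous_on_essential_chart: "continuous_on S essential_chart"
proof (rule continuous_on_matrix_entries)
  show "continuous_on S (\<lambda>\<xi>. essential_chart \<xi> $ i $ j)" for i j
    using C1_essential_chart[of i j] C1_with_continuous unfolding C1_def by (blast intro: continuous_on_subset)
qed

lemma chart_set_borel [measurable]: "chart_set h \<in> sets borel"
proof -
  have "compact (chart_set h)"
    unfolding chart_set_def case_prod_beta
    by (intro compact_continuous_image continuous_intros compact_Times continuous_on_compose2[OF continuous_on_essential_chart[of UNIV]])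
      (auto simp: sym_box_def)
  then show ?thesis by (simp add: borel_closed compact_imp_closed)
qed

lemma kernel_cap_borel [measurable]: "kernel_cap T \<in> sets borel"
  unfolding kernel_cap_def by measurable

context haar_O3
begin

definition chart_mass :: "real \<Rightarrow> ennreal" where
  "chart_mass h = (\<integral>\<^sup>+U. \<integral>\<^sup>+V. indicator (chart_set h) (U ** proj_xy ** transpose V) \<partial>\<mu> \<partial>\<mu>)"

text \<open>W is absorbed into U and the transpose of Z into V, each time by right
  invariance.\<close>

lemma chart_mass_translate:
  assumes W: "W \<in> O3" and Z: "Z \<in> O3"
  shows "(\<integral>\<^sup>+U. \<integral>\<^sup>+V. indicator (chart_set h) (U ** (W ** proj_xy ** Z) ** transpose V) \<partial>\<mu> \<partial>\<mu>) = chart_mass h"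
proof -
  have "(\<integral>\<^sup>+U. \<integral>\<^sup>+V. indicator (chart_set h) (U ** (W ** proj_xy ** Z) ** transpose V) \<partial>\<mu> \<partial>\<mu>) =
    (\<integral>\<^sup>+U. \<integral>\<^sup>+V. indicator (chart_set h) ((U ** W) ** proj_xy ** transpose (V ** transpose Z)) \<partial>\<mu> \<partial>\<mu>)"
    by (simp add: matrix_transpose_mul matrix_mul_assoc)
  also have "\<dots> = (\<integral>\<^sup>+U. \<integral>\<^sup>+V. indicator (chart_set h) ((U ** W) ** proj_xy ** transpose V) \<partial>\<mu> \<partial>\<mu>)"
    by (intro nn_integral_cong haar_right[where f = "\<lambda>V. indicator (chart_set h) (_ ** proj_xy ** transpose V)"] O3_transpose Z)
      measurable
  also have "\<dots> = chart_mass h"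
    unfolding chart_mass_def
    by (rule haar_right[where f = "\<lambda>U. \<integral>\<^sup>+V. indicator (chart_set h) (U ** proj_xy ** transpose V) \<partial>\<mu>", OF _ W]) measurable
  finally show ?thesis .
qed

text \<open>The 2 n events indexed by the sectors have equal probability and exclude each other by
  \<open>sector_unique\<close>. Each of them puts the images of axis 3 under U and V into the caps,
  and these two cap events are independent.\<close>

lemma chart_mass_le:
  assumes n: "2 \<le> n" and h: "0 < h" "2 * h * real n < pi"
  shows "of_nat (2 * n) * chart_mass h \<le> ennreal ((2 * (tan h / cos h)\<^sup>2 / pi)\<^sup>2)"
proof -
  define T where "T = tan h / cos h"
  define C where "C = kernel_cap T"
  have h2: "h < pi / 2" by (rule h_less[OF n h])
  have T0: "0 \<le> T" unfolding T_def using h h2 by (intro divide_nonneg_nonneg tan_pos_pi2_le cos_ge_zero) auto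
  have [measurable]: "C \<in> sets borel" by (simp add: C_def)
  have cap: "(\<integral>\<^sup>+U. indicator C (U *v axis 3 1) \<partial>\<mu>) \<le> ennreal (2 * T\<^sup>2 / pi)"
  proof -
    have "(\<integral>\<^sup>+U. indicator C (U *v axis 3 1) \<partial>\<mu>) \<le> (\<integral>\<^sup>+U. indicator C (nrm (U *v axis 3 1)) \<partial>\<mu>)"
    proof (rule nn_integral_mono)
      fix U :: "real^3^3"
      have "nrm w \<in> C" if "w \<in> C" for w
        using that kernel_cap_scaleR by (auto simp: C_def nrm_def)
      then show "(indicator C (U *v axis 3 1) :: ennreal) \<le> indicator C (nrm (U *v axis 3 1))"
        by (simp add: indicator_def)
    qed
    also have "\<dots> = emeasure direction_law C"
      unfolding direction_law_def
      by (subst nn_integral_indicator[symmetric], simp, subst nn_integral_distr) auto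
    also have "\<dots> \<le> ennreal (2 * T\<^sup>2 / pi)"
      unfolding C_def kernel_cap_def by (rule emeasure_direction_law_cap[OF T0])
    finally show ?thesis .
  qed
  define S where "S k j U V = (indicator (chart_set h) (U ** (proj_xy ** sector_rot n k j) ** transpose V) :: ennreal)" for k j U V
  have [measurable]: "(\<lambda>x. S k j (f x) (g x)) \<in> borel_measurable M"
    if "f \<in> borel_measurable M" "g \<in> borel_measurable M" for k j f g and M :: "'b measure"
    unfolding S_def using that by measurable
  have S_int: "(\<integral>\<^sup>+U. \<integral>\<^sup>+V. S k j U V \<partial>\<mu> \<partial>\<mu>) = chart_mass h" for k j
    unfolding S_def
    using chart_mass_translate[of "mat 1" "sector_rot n k j"] sector_rot_in_O3 by (simp add: O3_iff)
  have "of_nat (2 * n) * chart_mass h = (\<Sum>p\<in>{..<n} \<times> (UNIV :: bool set). chart_mass h)"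
    by (simp add: card_cartesian_product mult.commute)
  also have "\<dots> = (\<Sum>p\<in>{..<n} \<times> UNIV. \<integral>\<^sup>+U. \<integral>\<^sup>+V. S (fst p) (snd p) U V \<partial>\<mu> \<partial>\<mu>)"
    by (simp add: S_int)
  also have "\<dots> = (\<integral>\<^sup>+U. (\<Sum>p\<in>{..<n} \<times> UNIV. \<integral>\<^sup>+V. S (fst p) (snd p) U V \<partial>\<mu>) \<partial>\<mu>)"
    by (rule nn_integral_sum[symmetric]) measurable
  also have "\<dots> = (\<integral>\<^sup>+U. \<integral>\<^sup>+V. (\<Sum>p\<in>{..<n} \<times> UNIV. S (fst p) (snd p) U V) \<partial>\<mu> \<partial>\<mu>)"
    by (intro nn_integral_cong nn_integral_sum[symmetric]) measurable
  also have "\<dots> \<le> (\<integral>\<^sup>+U. \<integral>\<^sup>+V. indicator C (U *v axis 3 1) * indicator C (V *v axis 3 1) \<partial>\<mu> \<partial>\<mu>)"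
  proof (intro nn_integral_mono)
    fix U V assume UV: "U \<in> space \<mu>" "V \<in> space \<mu>"
    then have U: "U \<in> O3" and V: "V \<in> O3" by simp_all
    show "(\<Sum>p\<in>{..<n} \<times> UNIV. S (fst p) (snd p) U V) \<le> indicator C (U *v axis 3 1) * indicator C (V *v axis 3 1)"
    proof (cases "\<exists>p\<in>{..<n} \<times> UNIV. U ** (proj_xy ** sector_rot n (fst p) (snd p)) ** transpose V \<in> chart_set h")
      case True
      then obtain p where p: "p \<in> {..<n} \<times> UNIV" "U ** (proj_xy ** sector_rot n (fst p) (snd p)) ** transpose V \<in> chart_set h" by blast
      have "S (fst p') (snd p') U V = 0" if "p' \<in> {..<n} \<times> UNIV - {p}" for p'
        using sector_unique[OF n h U V _ _ p(2), of "fst p'" "snd p'"] that p(1)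
        by (auto simp: S_def indicator_def prod_eq_iff)
      then have "(\<Sum>p\<in>{..<n} \<times> UNIV. S (fst p) (snd p) U V) = S (fst p) (snd p) U V"
        using p(1) by (subst sum.remove[of _ p]) auto
      also have "\<dots> \<le> 1" by (simp add: S_def indicator_def)
      also have "1 = indicator C (U *v axis 3 1) * (indicator C (V *v axis 3 1) :: ennreal)"
        using sector_kernel_cap[OF n h U V p(2)] by (simp add: C_def T_def)
      finally show ?thesis .
    next
      case False
      then have eq: "(\<Sum>p\<in>{..<n} \<times> UNIV. S (fst p) (snd p) U V) = 0"
        by (intro sum.neutral) (auto simp: S_def indicator_def)
      show ?thesis by (simp only: eq zero_le)
    qed
  qed
  also have "\<dots> = (\<integral>\<^sup>+U. indicator C (U *v axis 3 1) \<partial>\<mu>) * (\<integral>\<^sup>+U. indicator C (U *v axis 3 1) \<partial>\<mu>)"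
    by (subst nn_integral_cmult, measurable, subst nn_integral_multc, measurable)
  also have "\<dots> \<le> ennreal (2 * T\<^sup>2 / pi) * ennreal (2 * T\<^sup>2 / pi)"
    by (intro mult_mono cap) auto
  also have "\<dots> = ennreal ((2 * T\<^sup>2 / pi)\<^sup>2)"
    by (simp add: power2_eq_square flip: ennreal_mult)
  finally show ?thesis by (simp add: T_def)
qed

end

section \<open>Averaging over the group\<close>

lemma proportional_refl: "x \<noteq> 0 \<Longrightarrow> proportional x x"
  unfolding proportional_def by (metis scaleR_one)

lemma abs_projective_eq_iff:
  assumes "x \<noteq> 0" "y \<noteq> 0"
  shows "abs_projective x = abs_projective y \<longleftrightarrow> proportional x y"
  using Quotient3_rel[OF Quotient3_projective, of x y] assms proportional_refl by blast

lemma inner_transpose_mult: "x \<bullet> (transpose A *v z) = (A *v x) \<bullet> z" for A :: "real^'n^'m"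
proof -
  have "x \<bullet> (transpose A *v z) = (z v* A) \<bullet> x"
    by (simp only: transpose_matrix_vector inner_commute)
  also have "\<dots> = z \<bullet> (A *v x)" by (rule dot_lmul_matrix)
  finally show ?thesis by (simp only: inner_commute)
qed

lemma proportional_rep_abs: "x \<noteq> 0 \<Longrightarrow> proportional (rep_projective (abs_projective x)) x"
  by (rule rep_abs_rsp_left[OF Quotient3_projective proportional_refl])

lemma bilinear_vanishes_abs:
  assumes "A \<noteq> 0"
  shows "bilinear_vanishes a (abs_projective A) b \<longleftrightarrow> rep_projective a \<bullet> (A *v rep_projective b) = 0"
proof -
  obtain c where c: "c \<noteq> 0" "A = c *\<^sub>R rep_projective (abs_projective A)"
    using proportional_rep_abs[OF assms] assms unfolding proportional_def by (metis scaleR_zero_left)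
  have "bilinear_vanishes a (abs_projective A) b \<longleftrightarrow>
      rep_projective a \<bullet> (rep_projective (abs_projective A) *v rep_projective b) = 0"
    by (simp add: bilinear_vanishes_def)
  also have "\<dots> \<longleftrightarrow> rep_projective a \<bullet> ((c *\<^sub>R rep_projective (abs_projective A)) *v rep_projective b) = 0"
    using c(1) by (simp add: scaleR_matrix_vector_assoc[symmetric])
  finally show ?thesis using c(2) by simp
qed

definition solvable :: "real \<Rightarrow> ((real^3^5) \<times> (real^3^5)) set" where
  "solvable h = {(x, y). \<exists>\<xi>\<in>sym_box h. \<forall>i. x $ i \<bullet> (essential_chart \<xi> *v y $ i) = 0}"

text \<open>The existential over \<open>\<xi>\<close> is a projection along a compact box, and such
  projections keep closed sets closed. This makes \<open>solvable h\<close> a Borel set.\<close>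

lemma closed_solvable: "closed (solvable h)"
proof -
  define S where "S = {p :: (real^5) \<times> ((real^3^5) \<times> (real^3^5)). \<forall>i. fst (snd p) $ i \<bullet> (essential_chart (fst p) *v snd (snd p) $ i) = 0}"
  have "S = (\<Inter>i. {p. fst (snd p) $ i \<bullet> (essential_chart (fst p) *v snd (snd p) $ i) = 0})"
    by (auto simp: S_def)
  moreover have "closed {p :: (real^5) \<times> ((real^3^5) \<times> (real^3^5)). fst (snd p) $ i \<bullet> (essential_chart (fst p) *v snd (snd p) $ i) = 0}" for i
    by (intro closed_Collect_eq continuous_intros continuous_on_compose2[OF continuous_on_essential_chart[of UNIV]]) auto
  ultimately have "closed S" by (simp add: closed_INT)
  then have "closed {y. \<exists>x. x \<in> sym_box h \<and> (x, y) \<in> S}"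
    by (intro closed_compact_projection) (simp_all add: sym_box_def)
  also have "{y. \<exists>x. x \<in> sym_box h \<and> (x, y) \<in> S} = solvable h"
    by (simp add: solvable_def S_def set_eq_iff Bex_def)
  finally show ?thesis .
qed

lemma solvable_borel [measurable]: "solvable h \<in> sets borel"
  by (rule borel_closed[OF closed_solvable])

lemma solvable_scaleR:
  assumes "\<And>i. c i \<noteq> 0" "\<And>i. d i \<noteq> 0"
  shows "(\<chi> i. c i *\<^sub>R x i, \<chi> i. d i *\<^sub>R y i) \<in> solvable h \<longleftrightarrow> (\<chi> i. x i, \<chi> i. y i) \<in> solvable h"
  using assms by (simp add: solvable_def matrix_vector_mult_scaleR)

lemma solvable_nrm:
  assumes "\<And>i. x i \<noteq> 0" "\<And>i. y i \<noteq> 0"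
  shows "(\<chi> i. nrm (x i), \<chi> i. nrm (y i)) \<in> solvable h \<longleftrightarrow> (\<chi> i. x i, \<chi> i. y i) \<in> solvable h"
proof -
  have "\<forall>i. \<exists>c. c \<noteq> 0 \<and> nrm (x i) = c *\<^sub>R x i" "\<forall>i. \<exists>c. c \<noteq> 0 \<and> nrm (y i) = c *\<^sub>R y i"
    using nrm_eq_scaleR assms by blast+
  then obtain c d where cd: "\<forall>i. c i \<noteq> 0 \<and> nrm (x i) = c i *\<^sub>R x i" "\<forall>i. d i \<noteq> 0 \<and> nrm (y i) = d i *\<^sub>R y i"
    by (auto dest!: choice)
  show ?thesis using solvable_scaleR[of c d x y h] cd by simp
qed

lemma vec_lambda_measurable [measurable]:
  fixes f :: "'n::finite \<Rightarrow> 'a \<Rightarrow> 'b::euclidean_space"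
  assumes "\<And>i. f i \<in> borel_measurable M"
  shows "(\<lambda>x. \<chi> i. f i x) \<in> borel_measurable M"
proof (subst borel_measurable_euclidean_space, rule ballI)
  fix b :: "'b^'n" assume "b \<in> Basis"
  then obtain i u where "b = axis i u" "u \<in> Basis" by (auto simp: Basis_vec_def)
  then show "(\<lambda>x. (\<chi> i. f i x) \<bullet> b) \<in> borel_measurable M"
    using assms by (simp add: inner_axis)
qed

context haar_O3
begin

text \<open>If the moved data admit a solution in the box, pulling it back by U and V gives a point
  of the intersection for the original data. So the indicator is at most a sum over these points,
  and by transitivity each of them contributes \<open>chart_mass h\<close> on average, wherever it
  lies.\<close>

lemma count_chart_mass:
  fixes u v :: "nat \<Rightarrow> (real^3) projective" and b :: "5 \<Rightarrow> nat"
  assumes b: "bij_betw b UNIV {1..5}" and c: "0 < c" "chart_mass h \<le> ennreal c"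
  shows "(\<integral>\<^sup>+U. \<integral>\<^sup>+V. indicator (solvable h) (\<chi> i. U *v rep_projective (u (b i)), \<chi> i. V *v rep_projective (v (b i))) \<partial>\<mu> \<partial>\<mu>)
    \<le> emeasure (count_space UNIV) (essential_variety \<inter> linear_space u v) * ennreal c" (is "?L \<le> emeasure _ ?F * _")
proof (cases "finite ?F")
  \<comment> \<open>An infinite intersection makes the right side infinite, as \<open>c\<close> is
    positive.\<close>
  case False
  then show ?thesis using c(1) by (simp add: emeasure_count_space_infinite ennreal_top_mult)
next
  case True
  have "\<forall>p\<in>?F. \<exists>W Z. W \<in> O3 \<and> Z \<in> O3 \<and> p = abs_projective (W ** proj_xy ** Z)"
  proof
    fix p assume "p \<in> ?F"
    then obtain E where E: "E \<in> essential_cone" "E \<noteq> 0" "p = abs_projective E"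
      by (auto simp: essential_variety_def)
    obtain r W Z where *: "r \<noteq> 0" "W \<in> O3" "Z \<in> O3" "E = r *\<^sub>R (W ** proj_xy ** Z)"
      by (rule essential_cone_decompose[OF E(1,2)])
    have nz: "W ** proj_xy ** Z \<noteq> 0" by (rule proj_xy_nonzero[OF *(2,3)])
    then have "proportional (W ** proj_xy ** Z) E"
      using E(2) *(4) unfolding proportional_def by blast
    then have "abs_projective (W ** proj_xy ** Z) = p"
      using abs_projective_eq_iff[OF nz E(2)] E(3) by simp
    then show "\<exists>W Z. W \<in> O3 \<and> Z \<in> O3 \<and> p = abs_projective (W ** proj_xy ** Z)"
      using *(2,3) by blast
  qed
  then obtain W where "\<forall>p\<in>?F. \<exists>Z. W p \<in> O3 \<and> Z \<in> O3 \<and> p = abs_projective (W p ** proj_xy ** Z)"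
    by (rule bchoice[THEN exE])
  then obtain Z where "\<forall>p\<in>?F. W p \<in> O3 \<and> Z p \<in> O3 \<and> p = abs_projective (W p ** proj_xy ** Z p)"
    by (rule bchoice[THEN exE])
  then have WZ: "\<And>p. p \<in> ?F \<Longrightarrow> W p \<in> O3 \<and> Z p \<in> O3 \<and> p = abs_projective (W p ** proj_xy ** Z p)"
    by blast
  have self: "(W ** proj_xy ** Z) \<bullet> (W ** proj_xy ** Z) = proj_xy \<bullet> proj_xy" if "W \<in> O3" "Z \<in> O3" for W Z
    using that by (simp add: inner_orthogonal_left inner_orthogonal_right O3_iff)
  have "?L \<le> (\<integral>\<^sup>+U. \<integral>\<^sup>+V. (\<Sum>p\<in>?F. indicator (chart_set h) (U ** (W p ** proj_xy ** Z p) ** transpose V)) \<partial>\<mu> \<partial>\<mu>)"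
  proof (intro nn_integral_mono)
    fix U V assume "U \<in> space \<mu>" "V \<in> space \<mu>"
    then have U: "U \<in> O3" and V: "V \<in> O3" by simp_all
    show "indicator (solvable h) (\<chi> i. U *v rep_projective (u (b i)), \<chi> i. V *v rep_projective (v (b i))) \<le>
      (\<Sum>p\<in>?F. indicator (chart_set h) (U ** (W p ** proj_xy ** Z p) ** transpose V) :: ennreal)"
    proof (cases "(\<chi> i. U *v rep_projective (u (b i)), \<chi> i. V *v rep_projective (v (b i))) \<in> solvable h")
      case True
      then obtain \<xi> where \<xi>: "\<xi> \<in> sym_box h"
        and eq: "\<And>i. (U *v rep_projective (u (b i))) \<bullet> (essential_chart \<xi> *v (V *v rep_projective (v (b i)))) = 0"
        by (auto simp: solvable_def)
      define X where "X = transpose U ** left_frame \<xi>"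
      define Y where "Y = rot_z (\<xi> $ 1) ** right_frame \<xi> ** V"
      have XY: "X \<in> O3" "Y \<in> O3" unfolding X_def Y_def by (intro O3_mult O3_transpose frames_in_O3 rot_in_O3 U V)+
      define Q where "Q = X ** proj_xy ** Y"
      have Q: "Q = transpose U ** essential_chart \<xi> ** V"
        by (simp add: Q_def X_def Y_def essential_chart_def matrix_mul_assoc)
      have Q0: "Q \<noteq> 0" unfolding Q_def by (rule proj_xy_nonzero[OF XY])
      have UQV: "U ** Q ** transpose V = essential_chart \<xi>"
      proof -
        have "U ** Q ** transpose V = (U ** transpose U) ** essential_chart \<xi> ** (V ** transpose V)"
          unfolding Q by (simp only: matrix_mul_assoc)
        then show ?thesis using U V by (simp add: O3_iff)
      qed
      define p where "p = abs_projective Q"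
      have "bilinear_vanishes (u k) p (v k)" if "k \<in> {1..5}" for k
      proof -
        have "k \<in> range b" using b that by (simp add: bij_betw_def)
        then obtain i where i: "k = b i" by blast
        have "rep_projective (u k) \<bullet> (Q *v rep_projective (v k)) =
          (U *v rep_projective (u k)) \<bullet> (essential_chart \<xi> *v (V *v rep_projective (v k)))"
          unfolding Q by (simp only: matrix_vector_mul_assoc[symmetric] inner_transpose_mult)
        then show ?thesis
          unfolding p_def bilinear_vanishes_abs[OF Q0] using eq[of i] i by simp
      qed
      moreover have "p \<in> essential_variety"
        unfolding p_def essential_variety_def using essential_cone_compose[OF XY] Q0 by (auto simp: Q_def)
      ultimately have pF: "p \<in> ?F" by (simp add: linear_space_def)
      have "proportional Q (W p ** proj_xy ** Z p)"
      proof -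
        have "W p ** proj_xy ** Z p \<noteq> 0"
          by (rule proj_xy_nonzero) (use WZ[OF pF] in blast)+
        moreover have "abs_projective Q = abs_projective (W p ** proj_xy ** Z p)"
          by (rule trans[OF p_def[symmetric]]) (use WZ[OF pF] in blast)
        ultimately show ?thesis using abs_projective_eq_iff[OF Q0] by blast
      qed
      then obtain s where s: "W p ** proj_xy ** Z p = s *\<^sub>R Q" by (auto simp: proportional_def)
      \<comment> \<open>Equal Frobenius norms leave only s = 1 and s = -1, the two signs built into
        \<open>chart_set\<close>.\<close>
      have "(s *\<^sub>R Q) \<bullet> (s *\<^sub>R Q) = proj_xy \<bullet> proj_xy"
        unfolding s[symmetric] by (rule self) (use WZ[OF pF] in blast)+
      also have "\<dots> = Q \<bullet> Q" unfolding Q_def by (rule self[OF XY, symmetric])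
      finally have "s * s * (Q \<bullet> Q) = Q \<bullet> Q" by simp
      moreover have "Q \<bullet> Q \<noteq> 0" using Q0 by simp
      ultimately have "s * s = 1" by simp
      then have s1: "s \<in> {-1, 1}" by (auto simp: square_eq_1_iff)
      have "U ** (W p ** proj_xy ** Z p) ** transpose V = s *\<^sub>R essential_chart \<xi>"
        unfolding s scaleR_matrix_mult_right scaleR_matrix_mult_left UQV ..
      then have "U ** (W p ** proj_xy ** Z p) ** transpose V \<in> chart_set h"
        unfolding chart_set_def using s1 \<xi> by (intro image_eqI[of _ _ "(s, \<xi>)"]) auto
      then have "(1::ennreal) \<le> indicator (chart_set h) (U ** (W p ** proj_xy ** Z p) ** transpose V)" by simp
      also have "\<dots> \<le> (\<Sum>p\<in>?F. indicator (chart_set h) (U ** (W p ** proj_xy ** Z p) ** transpose V))"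
        using pF \<open>finite ?F\<close> by (intro member_le_sum) auto
      finally show ?thesis using True by simp
    qed simp
  qed
  also have "\<dots> = (\<integral>\<^sup>+U. (\<Sum>p\<in>?F. \<integral>\<^sup>+V. indicator (chart_set h) (U ** (W p ** proj_xy ** Z p) ** transpose V) \<partial>\<mu>) \<partial>\<mu>)"
    by (intro nn_integral_cong nn_integral_sum) measurable
  also have "\<dots> = (\<Sum>p\<in>?F. \<integral>\<^sup>+U. \<integral>\<^sup>+V. indicator (chart_set h) (U ** (W p ** proj_xy ** Z p) ** transpose V) \<partial>\<mu> \<partial>\<mu>)"
    by (intro nn_integral_sum) measurable
  also have "\<dots> = (\<Sum>p\<in>?F. chart_mass h)"
    using WZ by (intro sum.cong chart_mass_translate) auto
  also have "\<dots> \<le> emeasure (count_space UNIV) ?F * ennreal c"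
    using True c(2) by (simp add: mult_left_mono)
  finally show ?thesis .
qed

end

section \<open>The joint law of the data\<close>

lemma nn_integral_vec_prod:
  fixes g :: "'n::finite \<Rightarrow> real \<Rightarrow> ennreal"
  assumes [measurable]: "\<And>i. g i \<in> borel_measurable borel"
  shows "(\<integral>\<^sup>+p. (\<Prod>i\<in>UNIV. g i (p $ i)) \<partial>lborel) = (\<Prod>i\<in>UNIV. \<integral>\<^sup>+t. g i t \<partial>lborel)"
proof -
  define ix where "ix b = (SOME i. b = axis i (1::real))" for b :: "real^'n"
  have ix: "ix (axis i 1) = i" for i
    unfolding ix_def by (rule some1_equality) (auto simp: axis_eq_axis)
  have B: "(Basis :: (real^'n) set) = (\<lambda>i. axis i 1) ` UNIV" by (auto simp: Basis_vec_def)
  have inj: "inj (\<lambda>i::'n. axis i (1::real))" by (auto simp: inj_on_def axis_eq_axis)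
  have "(\<integral>\<^sup>+p. (\<Prod>b\<in>Basis. g (ix b) (p \<bullet> b)) \<partial>lborel) = (\<Prod>b\<in>(Basis :: (real^'n) set). \<integral>\<^sup>+t. g (ix b) t \<partial>lborel)"
    by (rule nn_integral_lborel_prod) auto
  then show ?thesis
    unfolding B by (simp add: prod.reindex[OF inj] ix inner_axis)
qed

text \<open>\<open>rep_projective\<close> is an arbitrary choice, but on the open set where
  coordinate i is nonzero the vector divided by this coordinate depends only on the class, and
  continuously. The normalisation is assembled from three such pieces.\<close>

lemma nrm_rep_measurable: "(\<lambda>a. nrm (rep_projective a)) \<in> borel_measurable (borel :: (real^3) projective measure)"
proof -
  have rep: "P (rep_projective (abs_projective x)) \<longleftrightarrow> P x"
    if "x \<noteq> 0" and P: "\<And>c w. c \<noteq> 0 \<Longrightarrow> P (c *\<^sub>R w) = P w" for P and x :: "real^3"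
    using proportional_rep_abs[OF that(1)] that(1) P unfolding proportional_def by (metis scaleR_zero_left)
  define g where "g i a = (if rep_projective a $ i \<noteq> 0 then (1 / rep_projective a $ i) *\<^sub>R rep_projective a else 0)" for i :: 3 and a
  have op: "open {a :: (real^3) projective. rep_projective a $ i \<noteq> 0 \<and> (1 / rep_projective a $ i) *\<^sub>R rep_projective a \<in> S}"
    if S: "open S" for i :: 3 and S
  proof -
    have "{x :: real^3. x \<noteq> 0 \<and> rep_projective (abs_projective x) $ i \<noteq> 0 \<and>
        (1 / rep_projective (abs_projective x) $ i) *\<^sub>R rep_projective (abs_projective x) \<in> S} =
      {x. x $ i \<noteq> 0} \<inter> (\<lambda>x. (1 / x $ i) *\<^sub>R x) -` S"
    proof (rule set_eqI)
      fix x :: "real^3"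
      show "x \<in> {x. x \<noteq> 0 \<and> rep_projective (abs_projective x) $ i \<noteq> 0 \<and>
          (1 / rep_projective (abs_projective x) $ i) *\<^sub>R rep_projective (abs_projective x) \<in> S} \<longleftrightarrow>
        x \<in> {x. x $ i \<noteq> 0} \<inter> (\<lambda>x. (1 / x $ i) *\<^sub>R x) -` S"
      proof (cases "x = 0")
        case False
        then show ?thesis using rep[OF False, of "\<lambda>w. w $ i \<noteq> 0 \<and> (1 / w $ i) *\<^sub>R w \<in> S"] by simp
      qed simp
    qed
    moreover have "open ({x :: real^3. x $ i \<noteq> 0} \<inter> (\<lambda>x. (1 / x $ i) *\<^sub>R x) -` S)"
      by (intro continuous_open_preimage S open_Collect_neq continuous_intros) auto
    ultimately show ?thesis by (simp add: open_projective_def)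
  qed
  have piece: "{a :: (real^3) projective. rep_projective a $ i \<noteq> 0} \<in> sets borel" for i :: 3
    using op[of UNIV i] by (simp add: borel_open)
  have gm: "g i \<in> borel_measurable borel" for i
  proof (rule borel_measurableI)
    fix S :: "(real^3) set" assume S: "open S"
    have "g i -` S \<inter> space borel = {a. rep_projective a $ i \<noteq> 0 \<and> (1 / rep_projective a $ i) *\<^sub>R rep_projective a \<in> S} \<union>
      (if 0 \<in> S then - {a. rep_projective a $ i \<noteq> 0} else {})"
      by (auto simp: g_def split: if_splits)
    moreover have "\<dots> \<in> sets borel"
      using borel_open[OF op[OF S, of i]] piece[of i] by (auto intro!: sets.Un borel_comp)
    ultimately show "g i -` S \<inter> space borel \<in> sets borel" by simp
  qed
  have "(\<lambda>a. nrm (rep_projective a)) = (\<lambda>a. if rep_projective a $ 1 \<noteq> 0 then g 1 a else if rep_projective a $ 2 \<noteq> 0 then g 2 a else g 3 a)"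
    using pivot_nonzero[OF rep_projective_nonzero] by (auto simp: fun_eq_iff nrm_def pivot_def g_def)
  moreover have "\<dots> \<in> borel_measurable borel"
    by (intro measurable_If gm) (use piece[of 1] piece[of 2] in simp_all)
  ultimately show ?thesis by simp
qed

lemma nrm_mult_rep_abs:
  assumes "x \<noteq> 0"
  shows "nrm (U *v rep_projective (abs_projective x)) = nrm (U *v x)"
proof -
  obtain c where "c \<noteq> 0" "x = c *\<^sub>R rep_projective (abs_projective x)"
    using proportional_rep_abs[OF assms] assms unfolding proportional_def by (metis scaleR_zero_left)
  then show ?thesis using nrm_scaleR[of c "U *v rep_projective (abs_projective x)"] by (metis matrix_vector_mult_scaleR)
qed

lemma nrm_mult_rep_measurable: "(\<lambda>a. nrm (U *v rep_projective a)) \<in> borel_measurable (borel :: (real^3) projective measure)"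
proof -
  have "nrm (U *v rep_projective a) = nrm (U *v nrm (rep_projective a))" for a :: "(real^3) projective"
  proof -
    obtain c where "c \<noteq> 0" "nrm (rep_projective a) = c *\<^sub>R rep_projective a"
      using nrm_eq_scaleR[OF rep_projective_nonzero] by blast
    then show ?thesis by (simp add: matrix_vector_mult_scaleR nrm_scaleR)
  qed
  then show ?thesis
    using measurable_compose[OF nrm_rep_measurable, of "\<lambda>w. nrm (U *v w)" borel] by simp
qed

text \<open>Both points of pair i use the slope \<open>q i\<close>, as the adapted coordinates
  require. That this creates no dependence between them is \<open>concrete_law_eq\<close>.\<close>

definition normalized_points :: "(5 \<Rightarrow> real) \<Rightarrow> (5 \<Rightarrow> real \<times> real) \<Rightarrow> real^5 \<Rightarrow> 5 + 5 \<Rightarrow> real^3" where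
  "normalized_points q w p k = (case k of
     Inl i \<Rightarrow> nrm (left_point (q i) (fst (w i))) | Inr i \<Rightarrow> nrm (right_point (q i) (snd (w i)) (p $ i)))"

abbreviation "slopes \<equiv> Pi\<^sub>M (UNIV :: 5 set) (\<lambda>_. cauchy)"
abbreviation "cots \<equiv> Pi\<^sub>M (UNIV :: 5 set) (\<lambda>_. cot_measure \<Otimes>\<^sub>M cot_measure)"

lemma slope_measurable [measurable]: "(\<lambda>q. q i) \<in> borel_measurable slopes"
  using measurable_component_singleton[of i UNIV "\<lambda>_. cauchy"] by (simp cong: measurable_cong_sets)

lemma cot_measurable [measurable]:
  "(\<lambda>w. fst (w i)) \<in> borel_measurable cots" "(\<lambda>w. snd (w i)) \<in> borel_measurable cots"
proof -
  have m: "(\<lambda>w. w i) \<in> measurable cots (cot_measure \<Otimes>\<^sub>M cot_measure)"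
    by (rule measurable_component_singleton) simp
  show "(\<lambda>w. fst (w i)) \<in> borel_measurable cots" "(\<lambda>w. snd (w i)) \<in> borel_measurable cots"
    using measurable_compose[OF m measurable_fst] measurable_compose[OF m measurable_snd]
    by (simp_all cong: measurable_cong_sets)
qed

lemma nth_measurable_lborel [measurable]: "(\<lambda>p::real^5. p $ i) \<in> borel_measurable lborel"
  using nth_measurable[of i] by simp

definition slice_weight :: "(5 \<Rightarrow> real \<times> real) \<Rightarrow> real^5 \<Rightarrow> real" where
  "slice_weight w p = (\<Prod>i\<in>UNIV. slice_density (snd (w i)) (p $ i))"

lemma normalized_points_measurable:
  "(\<lambda>z. normalized_points (fst z) (fst (snd z)) (snd (snd z))) \<in>
    measurable (slopes \<Otimes>\<^sub>M cots \<Otimes>\<^sub>M lborel) (Pi\<^sub>M UNIV (\<lambda>_. borel))"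
proof (rule measurable_PiM_single')
  fix k :: "5 + 5"
  show "(\<lambda>z. normalized_points (fst z) (fst (snd z)) (snd (snd z)) k) \<in> borel_measurable (slopes \<Otimes>\<^sub>M cots \<Otimes>\<^sub>M lborel)"
    by (cases k) (simp_all add: normalized_points_def)
qed auto

lemma slice_weight_measurable:
  "(\<lambda>z. slice_weight (fst (snd z)) (snd (snd z))) \<in> borel_measurable (slopes \<Otimes>\<^sub>M cots \<Otimes>\<^sub>M lborel)"
  unfolding slice_weight_def by measurable

context haar_O3
begin

definition concrete_law :: "(5 + 5 \<Rightarrow> real^3) measure" where
  "concrete_law = distr (density (slopes \<Otimes>\<^sub>M cots \<Otimes>\<^sub>M lborel)
      (\<lambda>z. ennreal (slice_weight (fst (snd z)) (snd (snd z)))))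
    (Pi\<^sub>M UNIV (\<lambda>_. borel)) (\<lambda>z. normalized_points (fst z) (fst (snd z)) (snd (snd z)))"

lemma nn_integral_concrete_law:
  assumes F: "F \<in> borel_measurable (Pi\<^sub>M UNIV (\<lambda>_. borel))"
  shows "(\<integral>\<^sup>+f. F f \<partial>concrete_law) =
    (\<integral>\<^sup>+q. \<integral>\<^sup>+w. \<integral>\<^sup>+p. ennreal (slice_weight w p) * F (normalized_points q w p) \<partial>lborel \<partial>cots \<partial>slopes)"
proof -
  interpret c: prob_space cot_measure by (rule prob_space_cot_measure)
  interpret cc: pair_prob_space cot_measure cot_measure by standard
  interpret q: prob_space slopes by (intro prob_space_PiM prob_space_cauchy)
  interpret w: prob_space cots by (intro prob_space_PiM cc.prob_space_axioms)
  interpret wp: pair_sigma_finite cots "lborel :: (real^5) measure" by standard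
  note [measurable] = measurable_compose[OF normalized_points_measurable F] slice_weight_measurable
  have "(\<integral>\<^sup>+f. F f \<partial>concrete_law) =
    (\<integral>\<^sup>+z. ennreal (slice_weight (fst (snd z)) (snd (snd z))) * F (normalized_points (fst z) (fst (snd z)) (snd (snd z)))
      \<partial>(slopes \<Otimes>\<^sub>M cots \<Otimes>\<^sub>M lborel))"
    unfolding concrete_law_def
    using normalized_points_measurable F
    by (subst nn_integral_distr) (simp_all add: nn_integral_density)
  also have "\<dots> = (\<integral>\<^sup>+q. \<integral>\<^sup>+y. ennreal (slice_weight (fst y) (snd y)) * F (normalized_points q (fst y) (snd y)) \<partial>(cots \<Otimes>\<^sub>M lborel) \<partial>slopes)"
    by (subst wp.nn_integral_fst[symmetric]) simp_all
  also have "\<dots> = (\<integral>\<^sup>+q. \<integral>\<^sup>+w. \<integral>\<^sup>+p. ennreal (slice_weight w p) * F (normalized_points q w p) \<partial>lborel \<partial>cots \<partial>slopes)"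
  proof (rule nn_integral_cong)
    fix q assume "q \<in> space slopes"
    then have "(\<lambda>y. (q, y)) \<in> measurable (cots \<Otimes>\<^sub>M lborel) (slopes \<Otimes>\<^sub>M cots \<Otimes>\<^sub>M (lborel :: (real^5) measure))"
      by (intro measurable_Pair1') 
    from measurable_compose[OF this, of "\<lambda>z. ennreal (slice_weight (fst (snd z)) (snd (snd z))) * F (normalized_points (fst z) (fst (snd z)) (snd (snd z)))" borel]
    have "(\<lambda>y. ennreal (slice_weight (fst y) (snd y)) * F (normalized_points q (fst y) (snd y))) \<in> borel_measurable (cots \<Otimes>\<^sub>M lborel)"
      by simp
    from lborel.nn_integral_fst[OF this]
    show "(\<integral>\<^sup>+y. ennreal (slice_weight (fst y) (snd y)) * F (normalized_points q (fst y) (snd y)) \<partial>(cots \<Otimes>\<^sub>M lborel)) =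
      (\<integral>\<^sup>+w. \<integral>\<^sup>+p. ennreal (slice_weight w p) * F (normalized_points q w p) \<partial>lborel \<partial>cots)" by simp
  qed
  finally show ?thesis .
qed

text \<open>Rectangles are tested. For fixed slopes the integral factors over i, and each right
  factor is the \<open>direction_law\<close> measure of its set whatever the slope; so it leaves the
  integral, and the left factor is integrated over slope and cotangent by itself.\<close>

lemma concrete_law_eq: "concrete_law = Pi\<^sub>M UNIV (\<lambda>_. direction_law)"
proof -
  interpret d: prob_space direction_law by (rule prob_space_direction_law)
  interpret D: product_sigma_finite "\<lambda>_::5+5. direction_law" by standard
  interpret c: prob_space cot_measure by (rule prob_space_cot_measure)
  interpret cc: pair_prob_space cot_measure cot_measure by standard
  interpret w: product_sigma_finite "\<lambda>_::5. cot_measure \<Otimes>\<^sub>M cot_measure" by standard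
  interpret y: prob_space cauchy by (rule prob_space_cauchy)
  interpret q: product_sigma_finite "\<lambda>_::5. cauchy" by standard
  show ?thesis
  proof (rule D.PiM_eqI)
    show "sets concrete_law = sets (Pi\<^sub>M UNIV (\<lambda>_. direction_law))"
      unfolding concrete_law_def by (simp cong: sets_PiM_cong)
    fix A :: "5 + 5 \<Rightarrow> (real^3) set" assume A: "\<And>k. k \<in> UNIV \<Longrightarrow> A k \<in> sets direction_law"
    then have [measurable]: "A k \<in> sets borel" for k by simp
    have R [measurable]: "Pi\<^sub>E UNIV A \<in> sets (Pi\<^sub>M UNIV (\<lambda>_. borel))"
      by (intro sets_PiM_I_finite) auto
    have ind: "(indicator (Pi\<^sub>E UNIV A) f :: ennreal) = (\<Prod>i\<in>UNIV. indicator (A (Inl i)) (f (Inl i)) * indicator (A (Inr i)) (f (Inr i)))" for f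
    proof (cases "f \<in> Pi\<^sub>E UNIV A")
      case False
      then obtain k where "f k \<notin> A k" by (auto simp: PiE_def)
      then have "\<exists>i. (indicator (A (Inl i)) (f (Inl i)) * indicator (A (Inr i)) (f (Inr i)) :: ennreal) = 0"
        by (cases k) (auto simp: indicator_def)
      then show ?thesis using False by (simp add: prod_zero_iff)
    qed (auto simp: PiE_def Pi_iff)
    define L where "L q x i = (indicator (A (Inl i)) (nrm (left_point q x)) :: ennreal)" for q x i
    define Rt where "Rt q y p i = (indicator (A (Inr i)) (nrm (right_point q y p)) :: ennreal)" for q y p i
    have [measurable]: "(\<lambda>z. L (f z) (g z) i) \<in> borel_measurable M"
      if [measurable]: "f \<in> borel_measurable M" "g \<in> borel_measurable M" for f g i and M :: "'b measure"
      unfolding L_def by measurable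
    have [measurable]: "(\<lambda>z. Rt (f z) (g z) (h z) i) \<in> borel_measurable M"
      if [measurable]: "f \<in> borel_measurable M" "g \<in> borel_measurable M" "h \<in> borel_measurable M" for f g h i and M :: "'b measure"
      unfolding Rt_def by measurable
    have right: "(\<integral>\<^sup>+y. \<integral>\<^sup>+p. ennreal (slice_density y p) * Rt q y p i \<partial>lborel \<partial>cot_measure) = emeasure direction_law (A (Inr i))" for q i
      using nn_integral_direction_law_right[of "indicator (A (Inr i))" q] by (simp add: Rt_def)
    have left: "(\<integral>\<^sup>+q. \<integral>\<^sup>+x. L q x i \<partial>cot_measure \<partial>cauchy) = emeasure direction_law (A (Inl i))" for i
      using nn_integral_direction_law_left[of "indicator (A (Inl i))"] by (simp add: L_def)
    have "emeasure concrete_law (Pi\<^sub>E UNIV A) = (\<integral>\<^sup>+f. indicator (Pi\<^sub>E UNIV A) f \<partial>concrete_law)"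
      by (rule nn_integral_indicator[symmetric]) (simp add: concrete_law_def)
    also have "\<dots> = (\<integral>\<^sup>+q. \<integral>\<^sup>+w. \<integral>\<^sup>+p. ennreal (slice_weight w p) * indicator (Pi\<^sub>E UNIV A) (normalized_points q w p) \<partial>lborel \<partial>cots \<partial>slopes)"
      by (rule nn_integral_concrete_law) measurable
    also have "\<dots> = (\<integral>\<^sup>+q. \<integral>\<^sup>+w. \<integral>\<^sup>+p. (\<Prod>i\<in>UNIV. L (q i) (fst (w i)) i * (ennreal (slice_density (snd (w i)) (p $ i)) * Rt (q i) (snd (w i)) (p $ i) i)) \<partial>lborel \<partial>cots \<partial>slopes)"
      by (intro nn_integral_cong)
        (simp add: ind slice_weight_def prod_ennreal[symmetric] prod.distrib[symmetric] normalized_points_def L_def Rt_def mult_ac)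
    also have "\<dots> = (\<integral>\<^sup>+q. \<integral>\<^sup>+w. (\<Prod>i\<in>UNIV. L (q i) (fst (w i)) i * (\<integral>\<^sup>+p. ennreal (slice_density (snd (w i)) p) * Rt (q i) (snd (w i)) p i \<partial>lborel)) \<partial>cots \<partial>slopes)"
      by (intro nn_integral_cong, subst nn_integral_vec_prod) (simp_all add: nn_integral_cmult)
    also have "\<dots> = (\<integral>\<^sup>+q. (\<Prod>i\<in>UNIV. (\<integral>\<^sup>+z. L (q i) (fst z) i * (\<integral>\<^sup>+p. ennreal (slice_density (snd z) p) * Rt (q i) (snd z) p i \<partial>lborel) \<partial>(cot_measure \<Otimes>\<^sub>M cot_measure))) \<partial>slopes)"
      by (intro nn_integral_cong w.product_nn_integral_prod) simp_all
    also have "\<dots> = (\<integral>\<^sup>+q. (\<Prod>i\<in>UNIV. (\<integral>\<^sup>+x. L (q i) x i \<partial>cot_measure) * emeasure direction_law (A (Inr i))) \<partial>slopes)"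
    proof (intro nn_integral_cong prod.cong refl)
      fix q :: "5 \<Rightarrow> real" and i :: 5
      have "(\<integral>\<^sup>+z. L (q i) (fst z) i * (\<integral>\<^sup>+p. ennreal (slice_density (snd z) p) * Rt (q i) (snd z) p i \<partial>lborel) \<partial>(cot_measure \<Otimes>\<^sub>M cot_measure)) =
        (\<integral>\<^sup>+x. \<integral>\<^sup>+y. L (q i) x i * (\<integral>\<^sup>+p. ennreal (slice_density y p) * Rt (q i) y p i \<partial>lborel) \<partial>cot_measure \<partial>cot_measure)"
        by (subst c.nn_integral_fst[symmetric]) simp_all
      also have "\<dots> = (\<integral>\<^sup>+x. L (q i) x i * emeasure direction_law (A (Inr i)) \<partial>cot_measure)"
        by (simp add: nn_integral_cmult right)
      also have "\<dots> = (\<integral>\<^sup>+x. L (q i) x i \<partial>cot_measure) * emeasure direction_law (A (Inr i))"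
        by (rule nn_integral_multc) (simp add: measurable_cong_sets[OF sets_cot_measure refl])
      finally show "(\<integral>\<^sup>+z. L (q i) (fst z) i * (\<integral>\<^sup>+p. ennreal (slice_density (snd z) p) * Rt (q i) (snd z) p i \<partial>lborel) \<partial>(cot_measure \<Otimes>\<^sub>M cot_measure)) = \<dots>" .
    qed
    also have "\<dots> = (\<Prod>i\<in>UNIV. (\<integral>\<^sup>+q. (\<integral>\<^sup>+x. L q x i \<partial>cot_measure) * emeasure direction_law (A (Inr i)) \<partial>cauchy))"
      by (rule q.product_nn_integral_prod) simp_all
    also have "\<dots> = (\<Prod>i\<in>UNIV. emeasure direction_law (A (Inl i)) * emeasure direction_law (A (Inr i)))"
      by (simp add: nn_integral_multc left)
    also have "\<dots> = (\<Prod>k\<in>UNIV. emeasure direction_law (A k))"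
      by (simp add: prod.distrib UNIV_Plus_UNIV[symmetric] prod.Plus del: UNIV_Plus_UNIV)
    finally show "emeasure concrete_law (Pi\<^sub>E UNIV A) = (\<Prod>k\<in>UNIV. emeasure direction_law (A k))" .
  qed simp
qed

end

section \<open>Passage to the limit\<close>

context haar_O3
begin

text \<open>The fixed matrix U multiplies the Haar matrix that generates the point and disappears by
  left invariance.\<close>

lemma distr_point:
  assumes M: "prob_space M" and w: "w \<in> borel_measurable M"
    and law: "distr M borel w = unif_RP2 \<mu> a" and U: "U \<in> O3"
  shows "distr M borel (\<lambda>\<omega>. nrm (U *v rep_projective (w \<omega>))) = direction_law"
proof -
  note [measurable] = nrm_mult_rep_measurable[of U] w
  define r where "r = rep_projective a"
  have r0: "r \<noteq> 0" by (simp add: r_def rep_projective_nonzero)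
  have "distr M borel (\<lambda>\<omega>. nrm (U *v rep_projective (w \<omega>))) = distr (distr M borel w) borel (\<lambda>a. nrm (U *v rep_projective a))"
    by (subst distr_distr) (simp_all add: comp_def)
  also have "\<dots> = distr \<mu> borel (\<lambda>Q. nrm (U *v rep_projective (proj_action Q a)))"
    unfolding law unif_RP2_def
    using proj_action_measurable[OF sets_haar, of a] by (subst distr_distr) (simp_all add: comp_def)
  also have "\<dots> = distr \<mu> borel (\<lambda>Q. nrm ((U ** Q) *v r))"
  proof (rule distr_cong)
    fix Q assume "Q \<in> space \<mu>"
    then have "Q *v r \<noteq> 0" using O3_mult_nonzero r0 by simp
    then show "nrm (U *v rep_projective (proj_action Q a)) = nrm ((U ** Q) *v r)"
      by (simp add: proj_action_def r_def[symmetric] nrm_mult_rep_abs matrix_vector_mul_assoc)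
  qed simp_all
  also have "\<dots> = distr \<mu> borel (\<lambda>Q. nrm (Q *v r))"
  proof (rule measure_eqI)
    fix A assume "A \<in> sets (distr \<mu> borel (\<lambda>Q. nrm ((U ** Q) *v r)))"
    then have [measurable]: "A \<in> sets borel" by simp
    have "emeasure (distr \<mu> borel (\<lambda>Q. nrm ((U ** Q) *v r))) A = (\<integral>\<^sup>+Q. indicator A (nrm ((U ** Q) *v r)) \<partial>\<mu>)"
      by (subst nn_integral_indicator[symmetric], simp, subst nn_integral_distr) auto
    also have "\<dots> = (\<integral>\<^sup>+Q. indicator A (nrm (Q *v r)) \<partial>\<mu>)"
      by (rule haar_left[where f = "\<lambda>Q. indicator A (nrm (Q *v r))", OF _ U]) measurable
    also have "\<dots> = emeasure (distr \<mu> borel (\<lambda>Q. nrm (Q *v r))) A"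
      by (subst nn_integral_indicator[symmetric], simp, subst nn_integral_distr) auto
    finally show "emeasure (distr \<mu> borel (\<lambda>Q. nrm ((U ** Q) *v r))) A = emeasure (distr \<mu> borel (\<lambda>Q. nrm (Q *v r))) A" .
  qed simp
  also have "\<dots> = direction_law" by (rule direction_law_eq[OF r0, symmetric])
  finally show ?thesis .
qed

text \<open>Independence makes the joint law the product of its marginals, and these are all
  \<open>direction_law\<close> by \<open>distr_point\<close>; \<open>b\<close> carries the index
  type to {1..5}.\<close>

lemma joint_law:
  fixes M :: "'w measure" and u v :: "nat \<Rightarrow> 'w \<Rightarrow> (real^3) projective" and b :: "5 \<Rightarrow> nat"
  assumes M: "prob_space M"
    and ind: "prob_space.indep_vars M (\<lambda>_. borel) (case_sum u v) ({1..5} <+> {1..5})"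
    and lu: "\<And>i. i \<in> {1..5} \<Longrightarrow> distr M borel (u i) = unif_RP2 \<mu> a"
    and lv: "\<And>i. i \<in> {1..5} \<Longrightarrow> distr M borel (v i) = unif_RP2 \<mu> a"
    and b: "bij_betw b UNIV {1..5}" and U: "U \<in> O3" and V: "V \<in> O3"
  shows "distr M (Pi\<^sub>M UNIV (\<lambda>_. borel)) (\<lambda>\<omega> k. case k of
      Inl i \<Rightarrow> nrm (U *v rep_projective (u (b i) \<omega>)) | Inr i \<Rightarrow> nrm (V *v rep_projective (v (b i) \<omega>)))
    = Pi\<^sub>M UNIV (\<lambda>_. direction_law)"
proof -
  interpret M: prob_space M by fact
  define I where "I = ({1..5} <+> {1..5} :: (nat + nat) set)"
  define g where "g k = (case k of Inl i \<Rightarrow> (\<lambda>a. nrm (U *v rep_projective a)) | Inr i \<Rightarrow> (\<lambda>a. nrm (V *v rep_projective a)))" for k :: "nat + nat"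
  define Z where "Z k \<omega> = g k (case_sum u v k \<omega>)" for k \<omega>
  define \<beta> where "\<beta> = map_sum b b"
  have rv: "case_sum u v k \<in> borel_measurable M" if "k \<in> I" for k
    using ind that unfolding M.indep_vars_def I_def by auto
  have indZ: "M.indep_vars (\<lambda>_. borel) Z I"
    unfolding Z_def I_def
    by (rule M.indep_vars_compose2[OF ind]) (auto simp: g_def nrm_mult_rep_measurable split: sum.splits)
  have Zm: "Z k \<in> borel_measurable M" if "k \<in> I" for k
    using indZ that unfolding M.indep_vars_def by auto
  have I0: "I \<noteq> {}" by (auto simp: I_def)
  have "distr M borel (Z k) = direction_law" if "k \<in> I" for k
  proof (cases k)
    case (Inl i)
    then have "i \<in> {1..5}" using that by (auto simp: I_def)
    then show ?thesis
      using distr_point[OF M _ lu U] rv[OF that] Inl by (simp add: Z_def[abs_def] g_def)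
  next
    case (Inr i)
    then have "i \<in> {1..5}" using that by (auto simp: I_def)
    then show ?thesis
      using distr_point[OF M _ lv V] rv[OF that] Inr by (simp add: Z_def[abs_def] g_def)
  qed
  then have law: "distr M (Pi\<^sub>M I (\<lambda>_. borel)) (\<lambda>\<omega>. \<lambda>k\<in>I. Z k \<omega>) = Pi\<^sub>M I (\<lambda>_. direction_law)"
    using M.indep_vars_iff_distr_eq_PiM'[OF I0 Zm, THEN iffD1, OF _ indZ] by (simp cong: PiM_cong)
  have \<beta>1: "\<beta> k \<in> I" for k
    using b by (cases k) (auto simp: \<beta>_def I_def bij_betw_def)
  have \<beta>2: "inj \<beta>"
  proof (rule injI)
    fix x y assume "\<beta> x = \<beta> y"
    then show "x = y" using b by (cases x; cases y) (auto simp: \<beta>_def bij_betw_def dest: injD)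
  qed
  note \<beta> = \<beta>1 \<beta>2
  have sets: "sets (Pi\<^sub>M I (\<lambda>_. direction_law)) = sets (Pi\<^sub>M I (\<lambda>_. borel))"
    "sets (Pi\<^sub>M (UNIV :: (5 + 5) set) (\<lambda>_. direction_law)) = sets (Pi\<^sub>M UNIV (\<lambda>_. borel))"
    by (simp_all cong: sets_PiM_cong)
  have m: "(\<lambda>f. \<lambda>n\<in>UNIV. f (\<beta> n)) \<in> measurable (Pi\<^sub>M I (\<lambda>_. borel)) (Pi\<^sub>M UNIV (\<lambda>_. borel :: (real^3) measure))"
    by (intro measurable_restrict measurable_component_singleton \<beta>)
  have m': "(\<lambda>\<omega>. \<lambda>k\<in>I. Z k \<omega>) \<in> measurable M (Pi\<^sub>M I (\<lambda>_. borel))"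
    by (intro measurable_restrict Zm)
  have "Pi\<^sub>M (UNIV :: (5 + 5) set) (\<lambda>_. direction_law) =
    distr (Pi\<^sub>M I (\<lambda>_. direction_law)) (Pi\<^sub>M UNIV (\<lambda>_. direction_law)) (\<lambda>f. \<lambda>n\<in>UNIV. f (\<beta> n))"
    using distr_PiM_reindex[of I "\<lambda>_. direction_law" \<beta> UNIV] prob_space_direction_law \<beta> by simp
  also have "\<dots> = distr (distr M (Pi\<^sub>M I (\<lambda>_. borel)) (\<lambda>\<omega>. \<lambda>k\<in>I. Z k \<omega>)) (Pi\<^sub>M UNIV (\<lambda>_. borel)) (\<lambda>f. \<lambda>n\<in>UNIV. f (\<beta> n))"
    unfolding law by (rule distr_cong) (simp_all add: sets)
  also have "\<dots> = distr M (Pi\<^sub>M UNIV (\<lambda>_. borel)) ((\<lambda>f. \<lambda>n\<in>UNIV. f (\<beta> n)) \<circ> (\<lambda>\<omega>. \<lambda>k\<in>I. Z k \<omega>))"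
    using m m' by (rule distr_distr)
  also have "(\<lambda>f. \<lambda>n\<in>UNIV. f (\<beta> n)) \<circ> (\<lambda>\<omega>. \<lambda>k\<in>I. Z k \<omega>) = (\<lambda>\<omega> k. case k of
      Inl i \<Rightarrow> nrm (U *v rep_projective (u (b i) \<omega>)) | Inr i \<Rightarrow> nrm (V *v rep_projective (v (b i) \<omega>)))"
    using \<beta>(1) by (auto simp: fun_eq_iff Z_def g_def \<beta>_def restrict_def split: sum.splits)
  finally show ?thesis by simp
qed

end

lemma left_point_nonzero: "left_point q x \<noteq> 0"
  using sqrt_1_square_pos[of q] by (auto simp: left_point_def vec_eq_iff forall_3 line_x_def)

lemma right_point_nonzero: "right_point q y p \<noteq> 0"
proof
  assume "right_point q y p = 0"
  then have 1: "line_y q = p * line_x q" and 2: "line_x q = - (p * line_y q)"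
    by (simp_all add: right_point_def vec_eq_iff forall_3)
  have "line_x q * line_x q + line_y q * line_y q = - (p * line_y q) * line_x q + line_y q * (p * line_x q)"
    by (simp only: 1[symmetric] 2[symmetric])
  then have "line_x q * line_x q + line_y q * line_y q = 0" by (simp add: mult_ac)
  then show False using line_unit[of q] by (simp add: power2_eq_square)
qed

text \<open>With h = pi / (2 (n + 3)) and n + 2 sectors, 2 h (n + 2) stays strictly below pi and
  tends to pi, so the gaps between the sectors vanish in the limit.\<close>

lemma chart_mass_bound_limit:
  "(\<lambda>n. (2 * (tan (pi / (2 * (real n + 3))) / cos (pi / (2 * (real n + 3))))\<^sup>2 / pi)\<^sup>2 / (2 * (real n + 2)) / (2 * (pi / (2 * (real n + 3)))) ^ 5)
    \<longlonglongrightarrow> 1 / (8 * pi ^ 3)"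
proof -
  define h where "h n = pi / (2 * (real n + 3))" for n
  have "((\<lambda>h::real. tan h / (h * cos h)) \<longlongrightarrow> 1) (at_right 0)"
    unfolding tan_def by real_asymp
  moreover have "filterlim h (at_right 0) sequentially"
    unfolding h_def by real_asymp
  ultimately have 1: "(\<lambda>n. tan (h n) / (h n * cos (h n))) \<longlonglongrightarrow> 1"
    by (rule filterlim_compose)
  have 2: "(\<lambda>n. h n * (real n + 2)) \<longlonglongrightarrow> pi / 2"
    unfolding h_def by real_asymp
  have "(\<lambda>n. 1 / (16 * pi\<^sup>2) * ((tan (h n) / (h n * cos (h n))) ^ 4 / (h n * (real n + 2)))) \<longlonglongrightarrow> 1 / (16 * pi\<^sup>2) * (1 ^ 4 / (pi / 2))"
    by (intro tendsto_mult tendsto_const tendsto_divide tendsto_power 1 2) simp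
  moreover have "1 / (16 * pi\<^sup>2) * (1 ^ 4 / (pi / 2)) = 1 / (8 * pi ^ 3)"
    by (simp add: eval_nat_numeral)
  moreover have "1 / (16 * pi\<^sup>2) * ((t / (k * c)) ^ 4 / (k * m)) = (2 * (t / c)\<^sup>2 / pi)\<^sup>2 / (2 * m) / (2 * k) ^ 5" for t c m k :: real
    by (simp add: power_divide power_mult_distrib power_mult[symmetric] eval_nat_numeral)
  ultimately show ?thesis unfolding h_def by (simp only:)
qed

definition solution_kernel :: "real \<Rightarrow> (5 \<Rightarrow> real) \<Rightarrow> (5 \<Rightarrow> real \<times> real) \<Rightarrow> real^5 \<Rightarrow> ennreal" where
  "solution_kernel h q w p = ennreal (slice_weight w p) * indicator (solvable h)
     (\<chi> i. normalized_points q w p (Inl i), \<chi> i. normalized_points q w p (Inr i))"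

lemma solution_kernel_measurable [measurable]:
  fixes f :: "'a \<Rightarrow> 5 \<Rightarrow> real" and g :: "'a \<Rightarrow> 5 \<Rightarrow> real \<times> real" and k :: "'a \<Rightarrow> real^5"
  assumes [measurable]: "f \<in> measurable M slopes" "g \<in> measurable M cots" "k \<in> measurable M lborel"
  shows "(\<lambda>x. solution_kernel h (f x) (g x) (k x)) \<in> borel_measurable M"
proof -
  note [measurable] = measurable_compose[OF assms(1) slope_measurable] measurable_compose[OF assms(2) cot_measurable(1)]
    measurable_compose[OF assms(2) cot_measurable(2)] measurable_compose[OF assms(3) nth_measurable_lborel]
  have "(\<lambda>x. (\<chi> i. normalized_points (f x) (g x) (k x) (Inl i), \<chi> i. normalized_points (f x) (g x) (k x) (Inr i))) \<in> borel_measurable M"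
    unfolding normalized_points_def sum.case by (intro borel_measurable_Pair vec_lambda_measurable) measurable
  from measurable_compose[OF this, of "indicator (solvable h) :: _ \<Rightarrow> ennreal" borel]
  have "(\<lambda>x. indicator (solvable h) (\<chi> i. normalized_points (f x) (g x) (k x) (Inl i), \<chi> i. normalized_points (f x) (g x) (k x) (Inr i)) :: ennreal) \<in> borel_measurable M"
    by simp
  then show ?thesis unfolding solution_kernel_def slice_weight_def by measurable
qed

text \<open>Every c strictly below the limit value is eventually a lower bound by
  \<open>eventually_solvable_slice\<close>, and \<open>dense_le\<close> passes to the value itself.
  Normalising the points does not affect solvability, since the equations are homogeneous.\<close>

lemma liminf_slices:
  fixes q :: "5 \<Rightarrow> real" and w :: "5 \<Rightarrow> real \<times> real" and h :: "nat \<Rightarrow> real"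
  assumes h: "filterlim h (at_right 0) sequentially" "\<And>n. 0 < h n"
  shows "ennreal ((1 / pi) ^ 5) * ennreal \<bar>det (\<chi> i j. jacobian_row (line_x (q i)) (line_y (q i)) (fst (w i)) (snd (w i)) j)\<bar> \<le>
    liminf (\<lambda>n. ennreal (1 / (2 * h n) ^ 5) * (\<integral>\<^sup>+p. solution_kernel (h n) q w p \<partial>lborel))"
    (is "?d \<le> liminf ?G")
proof (rule dense_le)
  define d where "d = (1 / pi) ^ 5 * \<bar>det (\<chi> i j. jacobian_row (line_x (q i)) (line_y (q i)) (fst (w i)) (snd (w i)) j)\<bar>"
  fix x assume "x < ?d"
  also have "?d = ennreal d" by (simp add: d_def ennreal_mult)
  finally have x: "x < ennreal d" .
  then obtain c where c: "x = ennreal c" "0 \<le> c" by (cases x) auto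
  with x have cd: "c < d" by (simp add: ennreal_less_iff)
  have w0: "slice_weight w 0 = (1 / pi) ^ 5" by (simp add: slice_weight_def)
  have "\<forall>\<^sub>F h in at_right 0. ennreal (c * (2 * h) ^ 5) \<le>
    (\<integral>\<^sup>+p. ennreal (slice_weight w p) * indicator {p. \<exists>\<xi>\<in>sym_box h. \<forall>i.
       left_point (q i) (fst (w i)) \<bullet> (essential_chart \<xi> *v right_point (q i) (snd (w i)) (p $ i)) = 0} p \<partial>lborel)"
  proof (rule eventually_solvable_slice)
    have ne: "sqrt (1 + t\<^sup>2 + y\<^sup>2) \<noteq> 0" for t y :: real
      by (metis add_pos_nonneg less_irrefl one_plus_square_pos real_sqrt_eq_zero_cancel_iff zero_le_power2)
    show "continuous_on UNIV (slice_weight w)"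
      unfolding slice_weight_def slice_density_def by (intro continuous_intros) (auto simp: ne simp del: real_sqrt_eq_zero_cancel_iff)
    show "0 \<le> slice_weight w p" for p by (simp add: slice_weight_def prod_nonneg)
  qed (use c cd in \<open>auto simp: w0 d_def\<close>)
  then have "\<forall>\<^sub>F n in sequentially. ennreal (c * (2 * h n) ^ 5) \<le>
    (\<integral>\<^sup>+p. ennreal (slice_weight w p) * indicator {p. \<exists>\<xi>\<in>sym_box (h n). \<forall>i.
       left_point (q i) (fst (w i)) \<bullet> (essential_chart \<xi> *v right_point (q i) (snd (w i)) (p $ i)) = 0} p \<partial>lborel)"
    using h(1) by (rule eventually_compose_filterlim)
  then have "\<forall>\<^sub>F n in sequentially. x \<le> ?G n"
  proof eventually_elim
    case (elim n)
    have eq: "ennreal (slice_weight w p) * indicator {p. \<exists>\<xi>\<in>sym_box (h n). \<forall>i.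
       left_point (q i) (fst (w i)) \<bullet> (essential_chart \<xi> *v right_point (q i) (snd (w i)) (p $ i)) = 0} p = solution_kernel (h n) q w p" for p
      unfolding solution_kernel_def normalized_points_def sum.case
      using solvable_nrm[of "\<lambda>i. left_point (q i) (fst (w i))" "\<lambda>i. right_point (q i) (snd (w i)) (p $ i)" "h n", OF left_point_nonzero right_point_nonzero]
      by (simp add: indicator_def solvable_def)
    have "x = ennreal (1 / (2 * h n) ^ 5) * ennreal (c * (2 * h n) ^ 5)"
      using h(2)[of n] c by (simp flip: ennreal_mult)
    also have "\<dots> \<le> ?G n" using elim unfolding eq by (intro mult_left_mono) auto
    finally show ?case .
  qed
  then show "x \<le> liminf ?G" by (rule Liminf_bounded)
qed

context haar_O3
begin

lemma liminf_solution_prob: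
  fixes h :: "nat \<Rightarrow> real"
  assumes h: "filterlim h (at_right 0) sequentially" "\<And>n. 0 < h n"
  shows "ennreal ((1 / pi) ^ 5) * ennreal jacobian_bound \<le>
    liminf (\<lambda>n. ennreal (1 / (2 * h n) ^ 5) * (\<integral>\<^sup>+q. \<integral>\<^sup>+w. \<integral>\<^sup>+p. solution_kernel (h n) q w p \<partial>lborel \<partial>cots \<partial>slopes))"
proof -
  interpret c: prob_space cot_measure by (rule prob_space_cot_measure)
  interpret cc: pair_prob_space cot_measure cot_measure by standard
  interpret q: prob_space slopes by (intro prob_space_PiM prob_space_cauchy)
  interpret w: prob_space cots by (intro prob_space_PiM cc.prob_space_axioms)
  define D where "D q w = ennreal \<bar>det (\<chi> i j. jacobian_row (line_x (q i)) (line_y (q i)) (fst (w i)) (snd (w i)) j)\<bar>" for q :: "5 \<Rightarrow> real" and w :: "5 \<Rightarrow> real \<times> real"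
  have Dm: "(\<lambda>z. D (fst z) (snd z)) \<in> borel_measurable (slopes \<Otimes>\<^sub>M cots)"
    unfolding D_def
    by (intro measurable_compose[OF _ measurable_ennreal] borel_measurable_abs det_measurable jacobian_row_measurable
        measurable_compose[OF measurable_fst measurable_compose[OF slope_measurable line_measurable(1)]]
        measurable_compose[OF measurable_fst measurable_compose[OF slope_measurable line_measurable(2)]]
        measurable_compose[OF measurable_snd cot_measurable(1)] measurable_compose[OF measurable_snd cot_measurable(2)])
  have Dm1: "D q \<in> borel_measurable cots" if "q \<in> space slopes" for q
    using measurable_compose[OF measurable_Pair1'[OF that] Dm] by simp
  have "ennreal ((1 / pi) ^ 5) * ennreal jacobian_bound \<le> ennreal ((1 / pi) ^ 5) * (\<integral>\<^sup>+q. \<integral>\<^sup>+w. D q w \<partial>cots \<partial>slopes)"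
    unfolding D_def by (intro mult_left_mono nn_integral_abs_det_jacobian) simp
  also have "\<dots> = (\<integral>\<^sup>+q. ennreal ((1 / pi) ^ 5) * (\<integral>\<^sup>+w. D q w \<partial>cots) \<partial>slopes)"
    using w.borel_measurable_nn_integral_fst[OF Dm] by (intro nn_integral_cmult[symmetric]) simp
  also have "\<dots> = (\<integral>\<^sup>+q. \<integral>\<^sup>+w. ennreal ((1 / pi) ^ 5) * D q w \<partial>cots \<partial>slopes)"
    by (intro nn_integral_cong nn_integral_cmult[symmetric] Dm1)
  also have "\<dots> \<le> (\<integral>\<^sup>+q. \<integral>\<^sup>+w. liminf (\<lambda>n. ennreal (1 / (2 * h n) ^ 5) * (\<integral>\<^sup>+p. solution_kernel (h n) q w p \<partial>lborel)) \<partial>cots \<partial>slopes)"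
    unfolding D_def by (intro nn_integral_mono liminf_slices h)
  \<comment> \<open>Fatou's lemma is applied to the cotangents first, then to the slopes.\<close>
  also have "\<dots> \<le> (\<integral>\<^sup>+q. liminf (\<lambda>n. \<integral>\<^sup>+w. ennreal (1 / (2 * h n) ^ 5) * (\<integral>\<^sup>+p. solution_kernel (h n) q w p \<partial>lborel) \<partial>cots) \<partial>slopes)"
    by (intro nn_integral_mono nn_integral_liminf) measurable
  also have "\<dots> \<le> liminf (\<lambda>n. \<integral>\<^sup>+q. \<integral>\<^sup>+w. ennreal (1 / (2 * h n) ^ 5) * (\<integral>\<^sup>+p. solution_kernel (h n) q w p \<partial>lborel) \<partial>cots \<partial>slopes)"
    by (intro nn_integral_liminf) measurable
  also have "\<dots> = liminf (\<lambda>n. ennreal (1 / (2 * h n) ^ 5) * (\<integral>\<^sup>+q. \<integral>\<^sup>+w. \<integral>\<^sup>+p. solution_kernel (h n) q w p \<partial>lborel \<partial>cots \<partial>slopes))"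
  proof -
    have "(\<integral>\<^sup>+q. \<integral>\<^sup>+w. ennreal (1 / (2 * h n) ^ 5) * (\<integral>\<^sup>+p. solution_kernel (h n) q w p \<partial>lborel) \<partial>cots \<partial>slopes) =
      (\<integral>\<^sup>+q. ennreal (1 / (2 * h n) ^ 5) * (\<integral>\<^sup>+w. \<integral>\<^sup>+p. solution_kernel (h n) q w p \<partial>lborel \<partial>cots) \<partial>slopes)" for n
      by (intro nn_integral_cong nn_integral_cmult) measurable
    moreover have "\<dots> n = ennreal (1 / (2 * h n) ^ 5) * (\<integral>\<^sup>+q. \<integral>\<^sup>+w. \<integral>\<^sup>+p. solution_kernel (h n) q w p \<partial>lborel \<partial>cots \<partial>slopes)" for n
      by (intro nn_integral_cmult) measurable
    ultimately show ?thesis by simp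
  qed
  finally show ?thesis .
qed

text \<open>By \<open>joint_law\<close> the probability that the moved data are solvable in the box
  is the same for all U and V, hence equal to its average over the group. Exchanging the integrals
  and applying \<open>count_chart_mass\<close> for each outcome bounds it by \<open>c\<close> times
  the mean count.\<close>

lemma expected_count_ge:
  fixes M :: "'w measure" and u v :: "nat \<Rightarrow> 'w \<Rightarrow> (real^3) projective"
  assumes M: "prob_space M"
    and ind: "prob_space.indep_vars M (\<lambda>_. borel) (case_sum u v) ({1..5} <+> {1..5})"
    and lu: "\<And>i. i \<in> {1..5} \<Longrightarrow> distr M borel (u i) = unif_RP2 \<mu> a"
    and lv: "\<And>i. i \<in> {1..5} \<Longrightarrow> distr M borel (v i) = unif_RP2 \<mu> a"
    and c: "0 < c" "chart_mass h \<le> ennreal c"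
  shows "ennreal (1 / c) * (\<integral>\<^sup>+q. \<integral>\<^sup>+w. \<integral>\<^sup>+p. solution_kernel h q w p \<partial>lborel \<partial>cots \<partial>slopes) \<le>
    (\<integral>\<^sup>+\<omega>. emeasure (count_space UNIV) (essential_variety \<inter> linear_space (\<lambda>i. u i \<omega>) (\<lambda>i. v i \<omega>)) \<partial>M)"
proof -
  interpret M: prob_space M by (rule M)
  interpret Mm: pair_sigma_finite M \<mu> by standard
  have "card (UNIV :: 5 set) = card {1..5::nat}" by simp
  then obtain b :: "5 \<Rightarrow> nat" where b: "bij_betw b UNIV {1..5}"
    by (metis finite_same_card_bij finite finite_atLeastAtMost)
  have bI: "b i \<in> {1..5}" for i using b by (auto simp: bij_betw_def)
  have um: "u i \<in> borel_measurable M" "v i \<in> borel_measurable M" if "i \<in> {1..5}" for i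
  proof -
    have "case_sum u v k \<in> borel_measurable M" if "k \<in> {1..5} <+> {1..5}" for k
      using ind that unfolding M.indep_vars_def by auto
    from this[of "Inl i", OF InlI[OF that]] this[of "Inr i", OF InrI[OF that]]
    show "u i \<in> borel_measurable M" "v i \<in> borel_measurable M" by simp_all
  qed
  define N where "N \<omega> = emeasure (count_space UNIV) (essential_variety \<inter> linear_space (\<lambda>i. u i \<omega>) (\<lambda>i. v i \<omega>))" for \<omega>
  define x where "x i \<omega> = nrm (rep_projective (u (b i) \<omega>))" for i \<omega>
  define y where "y i \<omega> = nrm (rep_projective (v (b i) \<omega>))" for i \<omega>
  have [measurable]: "x i \<in> borel_measurable M" "y i \<in> borel_measurable M" for i
    using measurable_compose[OF um(1)[OF bI] nrm_rep_measurable] measurable_compose[OF um(2)[OF bI] nrm_rep_measurable]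
    by (simp_all add: x_def[abs_def] y_def[abs_def])
  define F where "F f = (indicator (solvable h) (\<chi> i. f (Inl i), \<chi> i. f (Inr i)) :: ennreal)" for f :: "5 + 5 \<Rightarrow> real^3"
  have Fm: "F \<in> borel_measurable (Pi\<^sub>M UNIV (\<lambda>_. borel))"
  proof -
    have "(\<lambda>f :: 5 + 5 \<Rightarrow> real^3. (\<chi> i. f (Inl i), \<chi> i. f (Inr i))) \<in> borel_measurable (Pi\<^sub>M UNIV (\<lambda>_. borel))"
      by (intro borel_measurable_Pair vec_lambda_measurable measurable_component_singleton) simp_all
    from measurable_compose[OF this, of "indicator (solvable h) :: _ \<Rightarrow> ennreal" borel]
    show ?thesis unfolding F_def by simp
  qed
  define S where "S U V \<omega> = (indicator (solvable h) (\<chi> i. U *v x i \<omega>, \<chi> i. V *v y i \<omega>) :: ennreal)" for U V \<omega>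
  have Sm [measurable]: "(\<lambda>z. S (f z) (g z) (k z)) \<in> borel_measurable L"
    if [measurable]: "f \<in> borel_measurable L" "g \<in> borel_measurable L" "k \<in> measurable L M"
    for f g k and L :: "'b measure"
  proof -
    have "(\<lambda>z. (\<chi> i. f z *v x i (k z), \<chi> i. g z *v y i (k z))) \<in> borel_measurable L"
      by (intro borel_measurable_Pair vec_lambda_measurable) measurable
    from measurable_compose[OF this, of "indicator (solvable h) :: _ \<Rightarrow> ennreal" borel]
    show ?thesis unfolding S_def by simp
  qed
  have S_rep: "S U V \<omega> = indicator (solvable h) (\<chi> i. U *v rep_projective (u (b i) \<omega>), \<chi> i. V *v rep_projective (v (b i) \<omega>))" for U V \<omega>
  proof -
    have "\<forall>i. \<exists>c. c \<noteq> 0 \<and> x i \<omega> = c *\<^sub>R rep_projective (u (b i) \<omega>)" "\<forall>i. \<exists>c. c \<noteq> 0 \<and> y i \<omega> = c *\<^sub>R rep_projective (v (b i) \<omega>)"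
      using nrm_eq_scaleR[OF rep_projective_nonzero] by (simp_all add: x_def y_def)
    then obtain c d where "\<forall>i. c i \<noteq> 0 \<and> x i \<omega> = c i *\<^sub>R rep_projective (u (b i) \<omega>)" "\<forall>i. d i \<noteq> 0 \<and> y i \<omega> = d i *\<^sub>R rep_projective (v (b i) \<omega>)"
      by (auto dest!: choice)
    then show ?thesis
      using solvable_scaleR[of c d "\<lambda>i. U *v rep_projective (u (b i) \<omega>)" "\<lambda>i. V *v rep_projective (v (b i) \<omega>)" h]
      by (simp add: S_def indicator_def matrix_vector_mult_scaleR)
  qed
  have count: "(\<integral>\<^sup>+U. \<integral>\<^sup>+V. S U V \<omega> \<partial>\<mu> \<partial>\<mu>) \<le> N \<omega> * ennreal c" for \<omega>
    unfolding S_rep N_def by (rule count_chart_mass[OF b c])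
  have prob: "(\<integral>\<^sup>+\<omega>. S U V \<omega> \<partial>M) = (\<integral>\<^sup>+q. \<integral>\<^sup>+w. \<integral>\<^sup>+p. solution_kernel h q w p \<partial>lborel \<partial>cots \<partial>slopes)"
    if U: "U \<in> O3" and V: "V \<in> O3" for U V
  proof -
    define Z where "Z \<omega> k = (case k of
      Inl i \<Rightarrow> nrm (U *v rep_projective (u (b i) \<omega>)) | Inr i \<Rightarrow> nrm (V *v rep_projective (v (b i) \<omega>)))" for \<omega> and k :: "5 + 5"
    have Zm: "Z \<in> measurable M (Pi\<^sub>M UNIV (\<lambda>_. borel))"
    proof (rule measurable_PiM_single')
      fix k :: "5 + 5"
      show "(\<lambda>\<omega>. Z \<omega> k) \<in> borel_measurable M"
        using measurable_compose[OF um(1)[OF bI] nrm_mult_rep_measurable] measurable_compose[OF um(2)[OF bI] nrm_mult_rep_measurable]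
        by (cases k) (simp_all add: Z_def)
    qed auto
    have "S U V \<omega> = F (Z \<omega>)" for \<omega>
    proof -
      have "U *v rep_projective (u (b i) \<omega>) \<noteq> 0" "V *v rep_projective (v (b i) \<omega>) \<noteq> 0" for i
        using O3_mult_nonzero U V rep_projective_nonzero by blast+
      then show ?thesis
        using solvable_nrm[of "\<lambda>i. U *v rep_projective (u (b i) \<omega>)" "\<lambda>i. V *v rep_projective (v (b i) \<omega>)" h]
        by (simp add: S_rep F_def Z_def indicator_def)
    qed
    then have "(\<integral>\<^sup>+\<omega>. S U V \<omega> \<partial>M) = (\<integral>\<^sup>+f. F f \<partial>distr M (Pi\<^sub>M UNIV (\<lambda>_. borel)) Z)"
      using nn_integral_distr[OF Zm, of F] Fm by simp
    also have "distr M (Pi\<^sub>M UNIV (\<lambda>_. borel)) Z = concrete_law"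
      using joint_law[OF M ind lu lv b U V] unfolding concrete_law_eq Z_def[abs_def] by simp
    also have "(\<integral>\<^sup>+f. F f \<partial>concrete_law) = (\<integral>\<^sup>+q. \<integral>\<^sup>+w. \<integral>\<^sup>+p. solution_kernel h q w p \<partial>lborel \<partial>cots \<partial>slopes)"
      unfolding nn_integral_concrete_law[OF Fm] by (simp add: F_def solution_kernel_def)
    finally show ?thesis .
  qed
  have "(\<integral>\<^sup>+q. \<integral>\<^sup>+w. \<integral>\<^sup>+p. solution_kernel h q w p \<partial>lborel \<partial>cots \<partial>slopes) = (\<integral>\<^sup>+U. \<integral>\<^sup>+V. (\<integral>\<^sup>+\<omega>. S U V \<omega> \<partial>M) \<partial>\<mu> \<partial>\<mu>)" (is "?P = _")
  proof -
    have "(\<integral>\<^sup>+U. \<integral>\<^sup>+V. (\<integral>\<^sup>+\<omega>. S U V \<omega> \<partial>M) \<partial>\<mu> \<partial>\<mu>) = (\<integral>\<^sup>+U. \<integral>\<^sup>+V. ?P \<partial>\<mu> \<partial>\<mu>)"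
      by (intro nn_integral_cong prob) simp_all
    then show ?thesis by (simp add: emeasure_space_1[simplified])
  qed
  also have "\<dots> = (\<integral>\<^sup>+U. \<integral>\<^sup>+\<omega>. \<integral>\<^sup>+V. S U V \<omega> \<partial>\<mu> \<partial>M \<partial>\<mu>)"
    by (intro nn_integral_cong Mm.Fubini') measurable
  also have "\<dots> = (\<integral>\<^sup>+\<omega>. \<integral>\<^sup>+U. \<integral>\<^sup>+V. S U V \<omega> \<partial>\<mu> \<partial>\<mu> \<partial>M)"
    by (rule Mm.Fubini') measurable
  finally have "ennreal (1 / c) * ?P = ennreal (1 / c) * (\<integral>\<^sup>+\<omega>. \<integral>\<^sup>+U. \<integral>\<^sup>+V. S U V \<omega> \<partial>\<mu> \<partial>\<mu> \<partial>M)" by simp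
  also have "\<dots> = (\<integral>\<^sup>+\<omega>. ennreal (1 / c) * (\<integral>\<^sup>+U. \<integral>\<^sup>+V. S U V \<omega> \<partial>\<mu> \<partial>\<mu>) \<partial>M)"
    by (rule nn_integral_cmult[symmetric]) measurable
  also have "\<dots> \<le> (\<integral>\<^sup>+\<omega>. N \<omega> \<partial>M)"
  proof (rule nn_integral_mono)
    fix \<omega>
    have "ennreal (1 / c) * (\<integral>\<^sup>+U. \<integral>\<^sup>+V. S U V \<omega> \<partial>\<mu> \<partial>\<mu>) \<le> ennreal (1 / c) * (N \<omega> * ennreal c)"
      by (intro mult_left_mono count) simp
    also have "\<dots> = (ennreal (1 / c) * ennreal c) * N \<omega>" by (simp only: mult_ac)
    also have "ennreal (1 / c) * ennreal c = 1" using c(1) by (simp flip: ennreal_mult)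
    finally show "ennreal (1 / c) * (\<integral>\<^sup>+U. \<integral>\<^sup>+V. S U V \<omega> \<partial>\<mu> \<partial>\<mu>) \<le> N \<omega>" by simp
  qed
  finally show ?thesis by (simp add: N_def)
qed

end

theorem proposition5p1:
  fixes M :: "'w measure"
    and \<mu> :: "(real^3^3) measure"
    and a\<^sub>0 :: "(real^3) projective"
    and u v :: "nat \<Rightarrow> 'w \<Rightarrow> (real^3) projective"
  assumes "prob_space M"
    and "normalized_haar_O3 \<mu>"
    and "prob_space.indep_vars M (\<lambda>_. borel) (case_sum u v) ({1..5} <+> {1..5})"
    and "\<And>i. i \<in> {1..5} \<Longrightarrow> distr M borel (u i) = unif_RP2 \<mu> a\<^sub>0"
    and "\<And>i. i \<in> {1..5} \<Longrightarrow> distr M borel (v i) = unif_RP2 \<mu> a\<^sub>0"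
  shows "(\<integral>\<^sup>+\<omega>. emeasure (count_space UNIV)
            (essential_variety \<inter> linear_space (\<lambda>i. u i \<omega>) (\<lambda>i. v i \<omega>)) \<partial>M) \<ge> ennreal 0.93"
proof -
  interpret haar_O3 \<mu> by (rule haar_O3.intro) fact
  define EN where "EN = (\<integral>\<^sup>+\<omega>. emeasure (count_space UNIV) (essential_variety \<inter> linear_space (\<lambda>i. u i \<omega>) (\<lambda>i. v i \<omega>)) \<partial>M)"
  define h where "h n = pi / (2 * (real n + 3))" for n
  \<comment> \<open>The bound of \<open>chart_mass_le\<close> for n + 2 sectors, divided by their
    number 2 (n + 2) of copies; the offset 2 ensures at least two sectors.\<close>
  define c where "c n = (2 * (tan (h n) / cos (h n))\<^sup>2 / pi)\<^sup>2 / (2 * (real n + 2))" for n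
  have h0: "0 < h n" for n by (simp add: h_def)
  have hn: "2 * h n * real (n + 2) < pi" for n
  proof -
    have "pi = h n * (2 * (real n + 3))" by (simp add: h_def)
    then show ?thesis using h0[of n] by (simp add: algebra_simps)
  qed
  have hl: "h n < pi / 2" for n
    unfolding h_def by (rule divide_strict_left_mono) simp_all
  have c0: "0 < c n" for n
    unfolding c_def using h0[of n] hl[of n] tan_gt_zero[of "h n"] cos_gt_zero[of "h n"] by simp
  have mass: "chart_mass (h n) \<le> ennreal (c n)" for n
  proof -
    define k where "k = 2 * real (n + 2)"
    have k: "0 < k" "2 * (real n + 2) = k" by (simp_all add: k_def)
    have "of_nat (2 * (n + 2)) = ennreal k" unfolding k_def by (simp only: ennreal_of_nat_eq_real_of_nat of_nat_mult of_nat_numeral)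
    then have "ennreal k * chart_mass (h n) \<le> ennreal ((2 * (tan (h n) / cos (h n))\<^sup>2 / pi)\<^sup>2)"
      using chart_mass_le[OF _ h0 hn, of n] by simp
    also have "\<dots> = ennreal k * ennreal (c n)"
    proof -
      have "k * c n = (2 * (tan (h n) / cos (h n))\<^sup>2 / pi)\<^sup>2" unfolding c_def k(2) using k(1) by simp
      then show ?thesis using ennreal_mult[of k "c n"] k(1) c0[of n] by (simp only: less_imp_le)
    qed
    finally show ?thesis using k(1) by (simp add: ennreal_mult_le_mult_iff)
  qed
  have hlim: "filterlim h (at_right 0) sequentially" unfolding h_def by real_asymp
  have "ennreal ((1 / pi) ^ 5) * ennreal jacobian_bound \<le>
    liminf (\<lambda>n. ennreal (1 / (2 * h n) ^ 5) * (\<integral>\<^sup>+q. \<integral>\<^sup>+w. \<integral>\<^sup>+p. solution_kernel (h n) q w p \<partial>lborel \<partial>cots \<partial>slopes))"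
    by (rule liminf_solution_prob[OF hlim h0])
  also have "\<dots> \<le> liminf (\<lambda>n. ennreal (c n / (2 * h n) ^ 5) * EN)"
  proof (intro Liminf_mono always_eventually allI)
    fix n
    have "ennreal (1 / (2 * h n) ^ 5) * (\<integral>\<^sup>+q. \<integral>\<^sup>+w. \<integral>\<^sup>+p. solution_kernel (h n) q w p \<partial>lborel \<partial>cots \<partial>slopes) =
      ennreal (c n / (2 * h n) ^ 5) * (ennreal (1 / c n) * (\<integral>\<^sup>+q. \<integral>\<^sup>+w. \<integral>\<^sup>+p. solution_kernel (h n) q w p \<partial>lborel \<partial>cots \<partial>slopes))"
      using c0[of n] h0[of n] by (simp add: mult.assoc[symmetric] flip: ennreal_mult)
    also have "\<dots> \<le> ennreal (c n / (2 * h n) ^ 5) * EN"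
      unfolding EN_def by (intro mult_left_mono expected_count_ge[OF assms(1,3,4,5) c0 mass]) auto
    finally show "ennreal (1 / (2 * h n) ^ 5) * (\<integral>\<^sup>+q. \<integral>\<^sup>+w. \<integral>\<^sup>+p. solution_kernel (h n) q w p \<partial>lborel \<partial>cots \<partial>slopes) \<le>
      ennreal (c n / (2 * h n) ^ 5) * EN" .
  qed
  finally have le: "ennreal ((1 / pi) ^ 5) * ennreal jacobian_bound \<le> liminf (\<lambda>n. ennreal (c n / (2 * h n) ^ 5) * EN)" .
  have "ennreal 0.93 \<le> EN"
  \<comment> \<open>An infinite expectation satisfies the claim; a finite one is a real number
    \<open>e\<close>, and the limit is taken in the reals.\<close>
  proof (cases EN)
    case (real e)
    have "(\<lambda>n. c n / (2 * h n) ^ 5 * e) \<longlonglongrightarrow> 1 / (8 * pi ^ 3) * e"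
      using chart_mass_bound_limit by (intro tendsto_mult tendsto_const) (simp add: c_def h_def)
    then have "(\<lambda>n. ennreal (c n / (2 * h n) ^ 5 * e)) \<longlonglongrightarrow> ennreal (1 / (8 * pi ^ 3) * e)"
      by (rule tendsto_ennrealI)
    then have "liminf (\<lambda>n. ennreal (c n / (2 * h n) ^ 5 * e)) = ennreal (1 / (8 * pi ^ 3) * e)"
      by (intro lim_imp_Liminf) simp_all
    moreover have jb: "0 \<le> jacobian_bound" by (simp add: jacobian_bound_def)
    moreover have "ennreal (c n / (2 * h n) ^ 5) * EN = ennreal (c n / (2 * h n) ^ 5 * e)" for n
      unfolding real(2) using c0[of n] h0[of n] real(1) by (intro ennreal_mult[symmetric]) simp_all
    ultimately have "ennreal ((1 / pi) ^ 5 * jacobian_bound) \<le> ennreal (1 / (8 * pi ^ 3) * e)"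
      using le jb by (simp only: ennreal_mult[symmetric] zero_le_power zero_le_divide_iff pi_ge_zero zero_le_one simp_thms)
    then have "(1 / pi) ^ 5 * jacobian_bound \<le> 1 / (8 * pi ^ 3) * e"
      using real(1) by (subst (asm) ennreal_le_iff) simp_all
    \<comment> \<open>Multiplication by 8 pi^3 turns pi^-5 into the factor 8 / pi^2 of
      \<open>jacobian_bound_ge\<close>.\<close>
    then have "(8 * pi ^ 3) * ((1 / pi) ^ 5 * jacobian_bound) \<le> (8 * pi ^ 3) * (1 / (8 * pi ^ 3) * e)"
      by (intro mult_left_mono) simp_all
    then have "8 / pi\<^sup>2 * jacobian_bound \<le> e"
      by (simp add: power_divide eval_nat_numeral)
    then have "0.93 \<le> e" using jacobian_bound_ge by linarith
    then show ?thesis using real by (simp add: ennreal_leI)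
  qed simp
  then show ?thesis by (simp add: EN_def)
qed

end
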